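(* Let $(A,\mathfrak m,k)$ be a Gorenstein commutative Noetherian local ring, let $M$ be a nonzero finitely generated $A$-module having reducible complexity, and let $N$ be a nonzero finitely generated $A$-module. For $A$-modules $X,Y$ put $\mathrm p^A(X,Y)=\sup\{n\mid\operatorname{Ext}_A^n(X,Y)\ne0\}$. Then $$\mathrm p^A(N,M)<\infty\ \Longrightarrow\ \mathrm p^A(M,N)<\infty .$$ In particular, symmetry in the vanishing of $\operatorname{Ext}$ holds for modules with reducible complexity over a local Gorenstein ring: if $M$ and $N$ both have reducible complexity, then $\operatorname{Ext}_A^i(M,N)=0$ for $i\gg0$ if and only if $\operatorname{Ext}_A^i(N,M)=0$ for $i\gg0$.
   Context: All modules are finitely generated. Complexity: for an $A$-module $X$ the $n$-th Betti number is $\beta_n(X)=\dim_k\operatorname{Ext}_A^n(X,k)$, and $\operatorname{cx}X=\inf\{t\in\mathbb N_0 \mid \exists\, a\in\mathbb R \text{ with } \beta_n(X)\le a n^{t-1}\text{ for } n\gg 0\}$ (where $\mathbb N_0=\{0,1,2,\dots\}$; the value is $\infty$ if no such $t$ exists). Thus $\operatorname{cx}X=0$ iff $X$ has finite projective dimension. Syzygies and $K_\eta$: if $\cdots\to P_1\to P_0\to X\to 0$ is the minimal free resolution of $X$, then $\Omega_A^n(X)$ denotes the cokernel of $P_{n+1}\to P_n$ (so $\Omega_A^0(X)=X$). For a homogeneous element $\eta\in\operatorname{Ext}_A^*(X,Y)$ of degree $|\eta|>0$, choose a map $f_\eta:\Omega_A^{|\eta|}(X)\to Y$ representing $\eta$,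 and let $K_\eta$ be the pushout of $f_\eta$ and the inclusion $\Omega_A^{|\eta|}(X)\hookrightarrow P_{|\eta|-1}$. There is an exact sequence $0\to Y\to K_\eta\to\Omega_A^{|\eta|-1}(X)\to 0$, and up to isomorphism $K_\eta$ is independent of the choice of $f_\eta$. Reducible complexity: the class of $A$-modules having reducible complexity is defined inductively, inside the class of $A$-modules of finite complexity, by: (1) every module of finite projective dimension has reducible complexity; (2) a module $X$ with $0<\operatorname{cx}X<\infty$ has reducible complexity if there is a homogeneous $\eta\in\operatorname{Ext}_A^*(X,X)$ of positive degree such that $\operatorname{cx}K_\eta<\operatorname{cx}X$, $\operatorname{depth}K_\eta=\operatorname{depth}X$, and $K_\eta$ has reducible complexity. *)

theory Defs
  imports "HOL-Algebra.Module" "HOL-Algebra.QuotRing" "HOL-Algebra.Ring_Divisibility" "HOL-Library.Extended_Nat" "HOL-Library.Extended_Real"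
begin

section \<open>Modules over a commutative ring\<close>

text \<open>The fields \<open>mult\<close> and \<open>one\<close>, which the record of modules inherits from rings, carry no
  meaning for a module; they are left \<^const>\<open>undefined\<close> in the constructions below.\<close>

definition zero_mod :: "('a, 'm) module \<Rightarrow> bool"
  where "zero_mod M \<longleftrightarrow> carrier M = {\<zero>\<^bsub>M\<^esub>}"

definition mod_span :: "'a ring \<Rightarrow> ('a, 'm) module \<Rightarrow> 'm set \<Rightarrow> 'm set"
  where "mod_span A M S = \<Inter> {H. submodule H A M \<and> S \<subseteq> H}"

definition fin_gen :: "'a ring \<Rightarrow> ('a, 'm) module \<Rightarrow> bool"
  where "fin_gen A M \<longleftrightarrow> (\<exists>S \<subseteq> carrier M. finite S \<and> mod_span A M S = carrier M)"

definition fg_module :: "'a ring \<Rightarrow> ('a, 'm) module \<Rightarrow> bool"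
  where "fg_module A M \<longleftrightarrow> module A M \<and> fin_gen A M"

text \<open>Homomorphisms are extensional, so that equal maps are equal as functions.\<close>

definition mod_hom :: "'a ring \<Rightarrow> ('a, 'm) module \<Rightarrow> ('a, 'n) module \<Rightarrow> ('m \<Rightarrow> 'n) set"
  where "mod_hom A M N =
    {f \<in> extensional (carrier M) \<inter> hom (add_monoid M) (add_monoid N).
      \<forall>a \<in> carrier A. \<forall>x \<in> carrier M. f (a \<odot>\<^bsub>M\<^esub> x) = a \<odot>\<^bsub>N\<^esub> f x}"

definition mod_iso :: "'a ring \<Rightarrow> ('a, 'm) module \<Rightarrow> ('a, 'n) module \<Rightarrow> bool"
  where "mod_iso A M N \<longleftrightarrow> (\<exists>f \<in> mod_hom A M N. bij_betw f (carrier M) (carrier N))"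

definition hom_mod :: "'a ring \<Rightarrow> ('a, 'm) module \<Rightarrow> ('a, 'n) module \<Rightarrow> ('a, 'm \<Rightarrow> 'n) module"
  where "hom_mod A M N =
    \<lparr>carrier = mod_hom A M N, monoid.mult = undefined, monoid.one = undefined,
     ring.zero = (\<lambda>x \<in> carrier M. \<zero>\<^bsub>N\<^esub>),
     ring.add = (\<lambda>f g. \<lambda>x \<in> carrier M. f x \<oplus>\<^bsub>N\<^esub> g x),
     smult = (\<lambda>a f. \<lambda>x \<in> carrier M. a \<odot>\<^bsub>N\<^esub> f x)\<rparr>"

definition quot_mod :: "('a, 'm) module \<Rightarrow> 'm set \<Rightarrow> ('a, 'm set) module"
  where "quot_mod M H =
    \<lparr>carrier = a_rcosets\<^bsub>M\<^esub> H, monoid.mult = undefined, monoid.one = undefined,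
     ring.zero = H, ring.add = set_add M,
     smult = (\<lambda>a C. \<Union>c \<in> C. H +>\<^bsub>M\<^esub> (a \<odot>\<^bsub>M\<^esub> c))\<rparr>"

definition prod_mod :: "('a, 'm) module \<Rightarrow> ('a, 'n) module \<Rightarrow> ('a, 'm \<times> 'n) module"
  where "prod_mod M N =
    \<lparr>carrier = carrier M \<times> carrier N, monoid.mult = undefined, monoid.one = undefined,
     ring.zero = (\<zero>\<^bsub>M\<^esub>, \<zero>\<^bsub>N\<^esub>),
     ring.add = (\<lambda>(x, y) (x', y'). (x \<oplus>\<^bsub>M\<^esub> x', y \<oplus>\<^bsub>N\<^esub> y')),
     smult = (\<lambda>a (x, y). (a \<odot>\<^bsub>M\<^esub> x, a \<odot>\<^bsub>N\<^esub> y))\<rparr>"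

text \<open>The pushout of \<open>f : Z \<rightarrow> X\<close> and \<open>g : Z \<rightarrow> Y\<close>.\<close>

definition pushout ::
  "('a, 'z) module \<Rightarrow> ('a, 'm) module \<Rightarrow> ('a, 'n) module \<Rightarrow> ('z \<Rightarrow> 'm) \<Rightarrow> ('z \<Rightarrow> 'n)
    \<Rightarrow> ('a, ('m \<times> 'n) set) module"
  where "pushout Z X Y f g =
    quot_mod (prod_mod X Y) ((\<lambda>z. (f z, \<ominus>\<^bsub>Y\<^esub> g z)) ` carrier Z)"

definition reg_mod :: "'a ring \<Rightarrow> ('a, 'a) module"
  where "reg_mod A =
    \<lparr>carrier = carrier A, monoid.mult = undefined, monoid.one = undefined,
     ring.zero = \<zero>\<^bsub>A\<^esub>, ring.add = ring.add A, smult = monoid.mult A\<rparr>"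

text \<open>The free module of rank \<open>n\<close>; its elements are the functions \<open>{..<n} \<rightarrow> A\<close>, extended by
  \<^const>\<open>undefined\<close>.\<close>

definition free_mod :: "'a ring \<Rightarrow> nat \<Rightarrow> ('a, nat \<Rightarrow> 'a) module"
  where "free_mod A n =
    \<lparr>carrier = {..<n} \<rightarrow>\<^sub>E carrier A, monoid.mult = undefined, monoid.one = undefined,
     ring.zero = (\<lambda>i \<in> {..<n}. \<zero>\<^bsub>A\<^esub>),
     ring.add = (\<lambda>x y. \<lambda>i \<in> {..<n}. x i \<oplus>\<^bsub>A\<^esub> y i),
     smult = (\<lambda>a x. \<lambda>i \<in> {..<n}. a \<otimes>\<^bsub>A\<^esub> x i)\<rparr>"

text \<open>Statements that quantify over modules need a fixed type for the elements. We use
  \<open>(nat \<Rightarrow> 'a) set\<close>: every finitely generated module is isomorphic to a quotient of some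
  \<^term>\<open>free_mod A n\<close>, whose elements are cosets and hence have this type. The type is also large
  enough for injective modules: with \<open>\<kappa> = max |A| \<aleph>\<^sub>0\<close>, every module of cardinality at most
  \<open>2\<^sup>\<kappa>\<close> embeds into an injective one of cardinality at most \<open>2\<^sup>\<kappa>\<close>, and
  \<open>(nat \<Rightarrow> 'a) set\<close> has at least \<open>2\<^sup>\<kappa>\<close> elements as soon as \<open>A\<close> is not the zero ring.\<close>

type_synonym 'a univ = "(nat \<Rightarrow> 'a) set"


section \<open>Local rings\<close>

definition local_ring :: "'a ring \<Rightarrow> bool"
  where "local_ring A \<longleftrightarrow> cring A \<and> (\<exists>!I. maximalideal I A)"

definition max_ideal :: "'a ring \<Rightarrow> 'a set"
  where "max_ideal A = (THE I. maximalideal I A)"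

abbreviation residue_field :: "'a ring \<Rightarrow> 'a set ring"
  where "residue_field A \<equiv> A Quot max_ideal A"

definition residue_mod :: "'a ring \<Rightarrow> ('a, 'a set) module"
  where "residue_mod A = quot_mod (reg_mod A) (max_ideal A)"

text \<open>An \<open>A\<close>-module annihilated by the maximal ideal, regarded as a vector space over the residue
  field: a coset acts through any of its elements.\<close>

definition residue_space :: "('a, 'm) module \<Rightarrow> ('a set, 'm) module"
  where "residue_space V =
    \<lparr>carrier = carrier V, monoid.mult = undefined, monoid.one = undefined,
     ring.zero = \<zero>\<^bsub>V\<^esub>, ring.add = ring.add V,
     smult = (\<lambda>C v. THE w. \<exists>c \<in> C. w = c \<odot>\<^bsub>V\<^esub> v)\<rparr>"

definition fin_basis :: "'k ring \<Rightarrow> ('k, 'v) module \<Rightarrow> 'v set \<Rightarrow> bool"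
  where "fin_basis K V B \<longleftrightarrow> finite B \<and> B \<subseteq> carrier V \<and>
    (\<forall>v \<in> carrier V. \<exists>!c. c \<in> B \<rightarrow>\<^sub>E carrier K \<and> v = (\<Oplus>\<^bsub>V\<^esub>b \<in> B. c b \<odot>\<^bsub>V\<^esub> b))"

definition vec_dim :: "'k ring \<Rightarrow> ('k, 'v) module \<Rightarrow> nat"
  where "vec_dim K V = (THE n. \<exists>B. fin_basis K V B \<and> card B = n)"


section \<open>Resolutions and homological dimensions\<close>

text \<open>\<open>\<cdots> \<rightarrow> P 1 \<rightarrow> P 0 \<rightarrow> X \<rightarrow> 0\<close>, with \<open>d n : P (n + 1) \<rightarrow> P n\<close> and \<open>e : P 0 \<rightarrow> X\<close>.\<close>

definition left_resolution ::
  "'a ring \<Rightarrow> ('a, 'm) module \<Rightarrow> (nat \<Rightarrow> ('a, 'p) module) \<Rightarrow> (nat \<Rightarrow> 'p \<Rightarrow> 'p) \<Rightarrow> ('p \<Rightarrow> 'm) \<Rightarrow> bool"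
  where "left_resolution A X P d e \<longleftrightarrow>
    (\<forall>n. module A (P n)) \<and> (\<forall>n. d n \<in> mod_hom A (P (Suc n)) (P n)) \<and>
    e \<in> mod_hom A (P 0) X \<and> e ` carrier (P 0) = carrier X \<and>
    d 0 ` carrier (P (Suc 0)) = a_kernel (P 0) X e \<and>
    (\<forall>n. d (Suc n) ` carrier (P (Suc (Suc n))) = a_kernel (P (Suc n)) (P n) (d n))"

text \<open>\<open>0 \<rightarrow> X \<rightarrow> I 0 \<rightarrow> I 1 \<rightarrow> \<cdots>\<close>, with \<open>e : X \<rightarrow> I 0\<close> and \<open>d n : I n \<rightarrow> I (n + 1)\<close>.\<close>

definition right_resolution ::
  "'a ring \<Rightarrow> ('a, 'm) module \<Rightarrow> (nat \<Rightarrow> ('a, 'p) module) \<Rightarrow> (nat \<Rightarrow> 'p \<Rightarrow> 'p) \<Rightarrow> ('m \<Rightarrow> 'p) \<Rightarrow> bool"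
  where "right_resolution A X I d e \<longleftrightarrow>
    (\<forall>n. module A (I n)) \<and> (\<forall>n. d n \<in> mod_hom A (I n) (I (Suc n))) \<and>
    e \<in> mod_hom A X (I 0) \<and> inj_on e (carrier X) \<and>
    e ` carrier X = a_kernel (I 0) (I (Suc 0)) (d 0) \<and>
    (\<forall>n. d n ` carrier (I n) = a_kernel (I (Suc n)) (I (Suc (Suc n))) (d (Suc n)))"

definition projective_mod :: "'a ring \<Rightarrow> ('a, 'a univ) module \<Rightarrow> bool"
  where "projective_mod A P \<longleftrightarrow> module A P \<and>
    (\<forall>(Y :: ('a, 'a univ) module) (Z :: ('a, 'a univ) module) g h.
      module A Y \<longrightarrow> module A Z \<longrightarrow> g \<in> mod_hom A Y Z \<longrightarrow> g ` carrier Y = carrier Z \<longrightarrow>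
      h \<in> mod_hom A P Z \<longrightarrow> (\<exists>l \<in> mod_hom A P Y. \<forall>x \<in> carrier P. g (l x) = h x))"

definition injective_mod :: "'a ring \<Rightarrow> ('a, 'a univ) module \<Rightarrow> bool"
  where "injective_mod A I \<longleftrightarrow> module A I \<and>
    (\<forall>(Y :: ('a, 'a univ) module) (Z :: ('a, 'a univ) module) g h.
      module A Y \<longrightarrow> module A Z \<longrightarrow> g \<in> mod_hom A Y Z \<longrightarrow> inj_on g (carrier Y) \<longrightarrow>
      h \<in> mod_hom A Y I \<longrightarrow> (\<exists>l \<in> mod_hom A Z I. \<forall>y \<in> carrier Y. l (g y) = h y))"

definition finite_proj_dim :: "'a ring \<Rightarrow> ('a, 'm) module \<Rightarrow> bool"
  where "finite_proj_dim A X \<longleftrightarrow>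
    (\<exists>(P :: nat \<Rightarrow> ('a, 'a univ) module) d e n. left_resolution A X P d e \<and>
      (\<forall>i. fin_gen A (P i) \<and> projective_mod A (P i)) \<and> (\<forall>i > n. zero_mod (P i)))"

definition finite_inj_dim :: "'a ring \<Rightarrow> ('a, 'm) module \<Rightarrow> bool"
  where "finite_inj_dim A X \<longleftrightarrow>
    (\<exists>(I :: nat \<Rightarrow> ('a, 'a univ) module) d e n. right_resolution A X I d e \<and>
      (\<forall>i. injective_mod A (I i)) \<and> (\<forall>i > n. zero_mod (I i)))"

definition gorenstein_local_ring :: "'a ring \<Rightarrow> bool"
  where "gorenstein_local_ring A \<longleftrightarrow>
    local_ring A \<and> noetherian_ring A \<and> finite_inj_dim A (reg_mod A)"


section \<open>Minimal free resolutions, syzygies and Ext\<close>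

text \<open>A free resolution is given by the ranks \<open>b\<close>, the differentials \<open>d\<close> and the augmentation
  \<open>e\<close>. It is minimal if the image of each differential is contained in the maximal ideal times
  its target.\<close>

definition is_minimal_free_resolution ::
  "'a ring \<Rightarrow> ('a, 'm) module \<Rightarrow>
    (nat \<Rightarrow> nat) \<times> (nat \<Rightarrow> (nat \<Rightarrow> 'a) \<Rightarrow> nat \<Rightarrow> 'a) \<times> ((nat \<Rightarrow> 'a) \<Rightarrow> 'm) \<Rightarrow> bool"
  where "is_minimal_free_resolution A X = (\<lambda>(b, d, e).
    left_resolution A X (\<lambda>n. free_mod A (b n)) d e \<and>
    (\<forall>n. \<forall>x \<in> carrier (free_mod A (b (Suc n))). \<forall>i < b n. d n x i \<in> max_ideal A))"

text \<open>Over a Noetherian local ring every finitely generated module has a minimal free resolution,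
  unique up to isomorphism; we fix one.\<close>

definition minimal_free_resolution ::
  "'a ring \<Rightarrow> ('a, 'm) module \<Rightarrow>
    (nat \<Rightarrow> nat) \<times> (nat \<Rightarrow> (nat \<Rightarrow> 'a) \<Rightarrow> nat \<Rightarrow> 'a) \<times> ((nat \<Rightarrow> 'a) \<Rightarrow> 'm)"
  where "minimal_free_resolution A X = (SOME F. is_minimal_free_resolution A X F)"

definition res_mod :: "'a ring \<Rightarrow> ('a, 'm) module \<Rightarrow> nat \<Rightarrow> ('a, nat \<Rightarrow> 'a) module"
  where "res_mod A X n = free_mod A (fst (minimal_free_resolution A X) n)"

definition res_diff :: "'a ring \<Rightarrow> ('a, 'm) module \<Rightarrow> nat \<Rightarrow> (nat \<Rightarrow> 'a) \<Rightarrow> nat \<Rightarrow> 'a"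
  where "res_diff A X n = fst (snd (minimal_free_resolution A X)) n"

definition res_image :: "'a ring \<Rightarrow> ('a, 'm) module \<Rightarrow> nat \<Rightarrow> (nat \<Rightarrow> 'a) set"
  where "res_image A X n = res_diff A X n ` carrier (res_mod A X (Suc n))"

definition syzygy :: "'a ring \<Rightarrow> ('a, 'm) module \<Rightarrow> nat \<Rightarrow> ('a, (nat \<Rightarrow> 'a) set) module"
  where "syzygy A X n = quot_mod (res_mod A X n) (res_image A X n)"

text \<open>For \<open>n > 0\<close>, the inclusion of the \<open>n\<close>-th syzygy into the \<open>(n - 1)\<close>-st free module, induced by
  the differential \<open>res_diff A X (n - 1)\<close>, which is constant on cosets.\<close>

definition syzygy_incl ::
  "'a ring \<Rightarrow> ('a, 'm) module \<Rightarrow> nat \<Rightarrow> (nat \<Rightarrow> 'a) set \<Rightarrow> nat \<Rightarrow> 'a"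
  where "syzygy_incl A X n =
    (\<lambda>C \<in> carrier (syzygy A X n). THE y. \<exists>c \<in> C. y = res_diff A X (n - 1) c)"

definition ext_cocycles ::
  "'a ring \<Rightarrow> nat \<Rightarrow> ('a, 'm) module \<Rightarrow> ('a, 'n) module \<Rightarrow> ((nat \<Rightarrow> 'a) \<Rightarrow> 'n) set"
  where "ext_cocycles A n X Y =
    {f \<in> mod_hom A (res_mod A X n) Y.
      \<forall>x \<in> carrier (res_mod A X (Suc n)). f (res_diff A X n x) = \<zero>\<^bsub>Y\<^esub>}"

fun ext_coboundaries ::
  "'a ring \<Rightarrow> nat \<Rightarrow> ('a, 'm) module \<Rightarrow> ('a, 'n) module \<Rightarrow> ((nat \<Rightarrow> 'a) \<Rightarrow> 'n) set"
  where
    "ext_coboundaries A 0 X Y = {\<lambda>x \<in> carrier (res_mod A X 0). \<zero>\<^bsub>Y\<^esub>}"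
  | "ext_coboundaries A (Suc n) X Y =
      (\<lambda>f. compose (carrier (res_mod A X (Suc n))) f (res_diff A X n)) `
        mod_hom A (res_mod A X n) Y"

definition Ext ::
  "'a ring \<Rightarrow> nat \<Rightarrow> ('a, 'm) module \<Rightarrow> ('a, 'n) module
    \<Rightarrow> ('a, ((nat \<Rightarrow> 'a) \<Rightarrow> 'n) set) module"
  where "Ext A n X Y =
    quot_mod ((hom_mod A (res_mod A X n) Y)\<lparr>carrier := ext_cocycles A n X Y\<rparr>)
      (ext_coboundaries A n X Y)"

text \<open>The supremum is \<open>-\<infinity>\<close> if all \<open>Ext\<close> modules vanish.\<close>

definition ext_sup :: "'a ring \<Rightarrow> ('a, 'm) module \<Rightarrow> ('a, 'n) module \<Rightarrow> ereal"
  where "ext_sup A X Y = (SUP n \<in> {n. \<not> zero_mod (Ext A n X Y)}. ereal (real n))"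


section \<open>Complexity and depth\<close>

definition betti :: "'a ring \<Rightarrow> ('a, 'm) module \<Rightarrow> nat \<Rightarrow> nat"
  where "betti A X n = vec_dim (residue_field A) (residue_space (Ext A n X (residue_mod A)))"

definition complexity :: "'a ring \<Rightarrow> ('a, 'm) module \<Rightarrow> enat"
  where "complexity A X =
    (INF t \<in> {t :: nat. \<exists>a :: real. \<forall>\<^sub>F n in sequentially.
      real (betti A X n) \<le> a * real n powi (int t - 1)}. enat t)"

text \<open>The submodule \<open>(x\<^sub>1, \<dots>, x\<^sub>r) M\<close>.\<close>

definition list_smult :: "'a ring \<Rightarrow> 'a list \<Rightarrow> ('a, 'm) module \<Rightarrow> 'm set"
  where "list_smult A xs M = mod_span A M {x \<odot>\<^bsub>M\<^esub> v | x v. x \<in> set xs \<and> v \<in> carrier M}"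

definition regular_sequence :: "'a ring \<Rightarrow> ('a, 'm) module \<Rightarrow> 'a list \<Rightarrow> bool"
  where "regular_sequence A M xs \<longleftrightarrow> set xs \<subseteq> carrier A \<and>
    (\<forall>i < length xs. let Q = quot_mod M (list_smult A (take i xs) M) in
      \<forall>v \<in> carrier Q. (xs ! i) \<odot>\<^bsub>Q\<^esub> v = \<zero>\<^bsub>Q\<^esub> \<longrightarrow> v = \<zero>\<^bsub>Q\<^esub>) \<and>
    list_smult A xs M \<noteq> carrier M"

text \<open>The depth of the zero module is \<open>\<infinity>\<close> by convention.\<close>

definition depth :: "'a ring \<Rightarrow> ('a, 'm) module \<Rightarrow> enat"
  where "depth A M = (if zero_mod M then \<infinity> else
    (SUP xs \<in> {xs. set xs \<subseteq> max_ideal A \<and> regular_sequence A M xs}. enat (length xs)))"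


section \<open>Reducible complexity\<close>

text \<open>For \<open>n > 0\<close> and a class \<open>\<eta>\<close> of degree \<open>n\<close>, the map \<open>f\<close> on the \<open>n\<close>-th syzygy represents \<open>\<eta>\<close>
  if its composite with the projection from the \<open>n\<close>-th free module is a cocycle in \<open>\<eta>\<close>.\<close>

definition represents ::
  "'a ring \<Rightarrow> ('a, 'm) module \<Rightarrow> ('a, 'n) module \<Rightarrow> nat \<Rightarrow> ((nat \<Rightarrow> 'a) \<Rightarrow> 'n) set
    \<Rightarrow> ((nat \<Rightarrow> 'a) set \<Rightarrow> 'n) \<Rightarrow> bool"
  where "represents A X Y n \<eta> f \<longleftrightarrow>
    f \<in> mod_hom A (syzygy A X n) Y \<and>
    (\<lambda>x \<in> carrier (res_mod A X n). f (res_image A X n +>\<^bsub>res_mod A X n\<^esub> x)) \<in> \<eta>"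

definition K_mod ::
  "'a ring \<Rightarrow> ('a, 'm) module \<Rightarrow> ('a, 'n) module \<Rightarrow> nat \<Rightarrow> ((nat \<Rightarrow> 'a) \<Rightarrow> 'n) set
    \<Rightarrow> ('a, ('n \<times> (nat \<Rightarrow> 'a)) set) module"
  where "K_mod A X Y n \<eta> =
    pushout (syzygy A X n) Y (res_mod A X (n - 1))
      (SOME f. represents A X Y n \<eta> f) (syzygy_incl A X n)"

text \<open>The inductive definition is carried out inside the type \<^typ>\<open>'a univ\<close>, in which \<open>K\<^sub>\<eta>\<close> is
  replaced by an isomorphic copy; \<open>has_reducible_complexity\<close> then transports the notion along
  isomorphisms to modules on any type.\<close>

inductive red_cx :: "'a ring \<Rightarrow> ('a, 'a univ) module \<Rightarrow> bool" for A :: "'a ring"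
  where
    finite_pd: "fg_module A X \<Longrightarrow> finite_proj_dim A X \<Longrightarrow> red_cx A X"
  | reduce: "fg_module A X \<Longrightarrow> 0 < complexity A X \<Longrightarrow> complexity A X < \<infinity> \<Longrightarrow>
      0 < n \<Longrightarrow> \<eta> \<in> carrier (Ext A n X X) \<Longrightarrow>
      complexity A (K_mod A X X n \<eta>) < complexity A X \<Longrightarrow>
      depth A (K_mod A X X n \<eta>) = depth A X \<Longrightarrow>
      mod_iso A K (K_mod A X X n \<eta>) \<Longrightarrow> red_cx A K \<Longrightarrow>
      red_cx A X"

definition has_reducible_complexity :: "'a ring \<Rightarrow> ('a, 'm) module \<Rightarrow> bool"
  where "has_reducible_complexity A M \<longleftrightarrow> (\<exists>X. red_cx A X \<and> mod_iso A X M)"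

end

theory Submission
  imports Defs
begin

text \<open>
  Only the exact sequences \<open>0 \<rightarrow> X \<rightarrow> K\<^sub>\<eta> \<rightarrow> \<Omega>\<^sup>n\<^sup>-\<^sup>1 X \<rightarrow> 0\<close> of the reductions matter, neither depth nor the Betti
  numbers. The transposed differentials of a resolution of \<open>N\<close> form a complex that is exact in degrees
  above the injective dimension of \<open>A\<close>; continued to the left by a free resolution of a kernel it becomes
  an acyclic complex \<open>S\<close>, indexed by the integers, whose cohomology with coefficients in \<open>Y\<close> agrees with
  \<open>Ext(N, Y)\<close> in large degrees and vanishes for \<open>Y = A\<close>, hence for all \<open>Y\<close> of finite projective
  dimension. Suppose \<open>Ext(N, M)\<close> vanishes in large degrees. By induction along the reduction of \<open>M\<close>, the
  cohomology of \<open>K\<^sub>\<eta>\<close> vanishes everywhere, so that of \<open>M\<close> is periodic and vanishes everywhere, as does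
  that of all syzygies of \<open>M\<close>.

  Let \<open>W\<close> be the kernel of a differential \<open>S i\<close> with \<open>i\<close> large and \<open>P\<close> a free resolution of \<open>M\<close>. The
  vanishing for all syzygies of \<open>M\<close> says that \<open>W \<otimes> P\<close> is exact in positive degrees. The dual of \<open>S\<close> is
  acyclic as well, since each of its degrees lies arbitrarily far to the right of some other one; therefore
  \<open>Ext(W, A)\<close> vanishes in positive degrees, and \<open>Hom(W, A)\<close> is a syzygy \<open>L\<close> of \<open>N\<close>. A finite injective
  resolution of \<open>A\<close> now turns exactness of \<open>W \<otimes> P\<close> into exactness of \<open>Hom(P, Hom(W, A)) = Hom(P, L)\<close> in large degrees, so
  \<open>Ext(M, L)\<close>, and with it \<open>Ext(M, N)\<close>, vanishes in large degrees.\<close>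

section \<open>Linear maps and exactness of matrix complexes\<close>

text \<open>Ext, Tor and the cohomology of \<open>S\<close> are all handled as exactness of tuples
  under matrices over \<open>A\<close>, so one matrix acts on every coefficient module. W \<otimes>
  P then needs no tensor product: it is the matrices of P acting on tuples in W, and Hom(P, Y) is
  the transposed matrices acting on tuples in Y. The decisive exchange is that an element of a power
  of W is a rectangular array: read one way it is a tuple in W, read the other way a tuple in a
  syzygy of M on which S acts. Hence vanishing is wanted for the syzygies of M and not just for M.
  Injective dimension enters through dimension shifting along the cosyzygies of \<open>A\<close>,
  which vanish beyond \<open>n\<close>; Hom(W, -) is exact on the cosyzygy sequences because the
  dual of S is acyclic with cosyzygy coefficients. That S extends in both directions is used twice:
  every degree can be reached from one far to its right, and periodicity can be followed downwards
  without end. Injectivity and projectivity are tested on modules over one fixed type only, so other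
  modules are copied there along explicit injections.\<close>

definition lin :: "'a ring \<Rightarrow> ('a, 'm) module \<Rightarrow> ('a, 'n) module \<Rightarrow> ('m \<Rightarrow> 'n) \<Rightarrow> bool"
  where "lin A M N f \<longleftrightarrow> (\<forall>x \<in> carrier M. f x \<in> carrier N) \<and>
    (\<forall>x \<in> carrier M. \<forall>y \<in> carrier M. f (x \<oplus>\<^bsub>M\<^esub> y) = f x \<oplus>\<^bsub>N\<^esub> f y) \<and>
    (\<forall>a \<in> carrier A. \<forall>x \<in> carrier M. f (a \<odot>\<^bsub>M\<^esub> x) = a \<odot>\<^bsub>N\<^esub> f x)"

lemma mod_hom_iff: "f \<in> mod_hom A M N \<longleftrightarrow> f \<in> extensional (carrier M) \<and> lin A M N f"
  by (auto simp: mod_hom_def lin_def hom_def)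

lemma mod_hom_lin: "f \<in> mod_hom A M N \<Longrightarrow> lin A M N f"
  by (simp add: mod_hom_iff)

lemma linI:
  assumes "\<And>x. x \<in> carrier M \<Longrightarrow> f x \<in> carrier N"
    and "\<And>x y. x \<in> carrier M \<Longrightarrow> y \<in> carrier M \<Longrightarrow> f (x \<oplus>\<^bsub>M\<^esub> y) = f x \<oplus>\<^bsub>N\<^esub> f y"
    and "\<And>a x. a \<in> carrier A \<Longrightarrow> x \<in> carrier M \<Longrightarrow> f (a \<odot>\<^bsub>M\<^esub> x) = a \<odot>\<^bsub>N\<^esub> f x"
  shows "lin A M N f"
  using assms by (auto simp: lin_def)

lemma lin_closed: "lin A M N f \<Longrightarrow> x \<in> carrier M \<Longrightarrow> f x \<in> carrier N"
  and lin_add: "lin A M N f \<Longrightarrow> x \<in> carrier M \<Longrightarrow> y \<in> carrier M \<Longrightarrow> f (x \<oplus>\<^bsub>M\<^esub> y) = f x \<oplus>\<^bsub>N\<^esub> f y"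
  and lin_smult: "lin A M N f \<Longrightarrow> a \<in> carrier A \<Longrightarrow> x \<in> carrier M \<Longrightarrow> f (a \<odot>\<^bsub>M\<^esub> x) = a \<odot>\<^bsub>N\<^esub> f x"
  by (auto simp: lin_def)

lemma lin_zero:
  assumes "module A M" "module A N" "lin A M N f"
  shows "f \<zero>\<^bsub>M\<^esub> = \<zero>\<^bsub>N\<^esub>"
proof -
  interpret M: module A M by fact
  interpret N: module A N by fact
  have "f (\<zero>\<^bsub>A\<^esub> \<odot>\<^bsub>M\<^esub> \<zero>\<^bsub>M\<^esub>) = \<zero>\<^bsub>A\<^esub> \<odot>\<^bsub>N\<^esub> f \<zero>\<^bsub>M\<^esub>"
    using assms(3) by (intro lin_smult) auto
  then show ?thesis using lin_closed[OF assms(3)] by simp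
qed

lemma lin_neg:
  assumes "module A M" "module A N" "lin A M N f" "x \<in> carrier M"
  shows "f (\<ominus>\<^bsub>M\<^esub> x) = \<ominus>\<^bsub>N\<^esub> f x"
proof -
  interpret M: module A M by fact
  interpret N: module A N by fact
  have "f (\<ominus>\<^bsub>M\<^esub> x) \<oplus>\<^bsub>N\<^esub> f x = f (\<ominus>\<^bsub>M\<^esub> x \<oplus>\<^bsub>M\<^esub> x)"
    using assms by (simp add: lin_add)
  also have "\<dots> = \<zero>\<^bsub>N\<^esub>"
    using assms by (simp add: M.l_neg lin_zero)
  finally show ?thesis
    using N.minus_equality[of "f (\<ominus>\<^bsub>M\<^esub> x)" "f x"] assms by (simp add: lin_closed)
qed

lemma lin_minus:
  assumes "module A M" "module A N" "lin A M N f" "x \<in> carrier M" "y \<in> carrier M"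
  shows "f (x \<ominus>\<^bsub>M\<^esub> y) = f x \<ominus>\<^bsub>N\<^esub> f y"
proof -
  interpret M: module A M by fact
  show ?thesis using assms by (simp add: a_minus_def lin_add lin_neg)
qed

lemma lin_comp: "lin A M N f \<Longrightarrow> lin A N L g \<Longrightarrow> lin A M L (\<lambda>x. g (f x))"
  by (simp add: lin_def)

lemma lin_restrict: "lin A M N f \<Longrightarrow> module A M \<Longrightarrow> restrict f (carrier M) \<in> mod_hom A M N"
proof -
  assume f: "lin A M N f" and "module A M"
  then interpret module A M by simp
  show ?thesis using f by (auto simp: mod_hom_iff lin_def)
qed

lemma lin_cong: "(\<And>x. x \<in> carrier M \<Longrightarrow> f x = g x) \<Longrightarrow> module A M \<Longrightarrow> lin A M N f \<Longrightarrow> lin A M N g"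
proof -
  assume f: "\<And>x. x \<in> carrier M \<Longrightarrow> f x = g x" "lin A M N f" and "module A M"
  then interpret module A M by simp
  show ?thesis using f(2) by (simp add: lin_def f(1)[symmetric])
qed

lemma lin_id: "lin A M M (\<lambda>x. x)"
  by (simp add: lin_def)

text \<open>Finite sums by recursion: unlike \<^const>\<open>finsum\<close> they do not refer to the carrier, so they do not
  change when the carrier is restricted to a submodule.\<close>

primrec msum :: "('a, 'm) module \<Rightarrow> (nat \<Rightarrow> 'm) \<Rightarrow> nat \<Rightarrow> 'm"
  where
    "msum Y f 0 = \<zero>\<^bsub>Y\<^esub>"
  | "msum Y f (Suc n) = msum Y f n \<oplus>\<^bsub>Y\<^esub> f n"

lemma msum_carrier_update [simp]: "msum (Y\<lparr>carrier := H\<rparr>) f n = msum Y f n"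
  by (induction n) auto

lemma msum_cong: "(\<And>l. l < n \<Longrightarrow> f l = g l) \<Longrightarrow> msum Y f n = msum Y g n"
  by (induction n) auto

locale amod = module A M for A :: "'a ring" (structure) and M :: "('a, 'm) module" (structure)

context amod
begin

lemma msum_closed: "(\<And>l. l < n \<Longrightarrow> f l \<in> carrier M) \<Longrightarrow> msum M f n \<in> carrier M"
  by (induction n) auto

lemma msum_closed' [simp, intro]: "(\<And>l. f l \<in> carrier M) \<Longrightarrow> msum M f n \<in> carrier M"
  by (induction n) auto

lemma msum_add:
  "(\<And>l. l < n \<Longrightarrow> f l \<in> carrier M) \<Longrightarrow> (\<And>l. l < n \<Longrightarrow> g l \<in> carrier M) \<Longrightarrow>
    msum M (\<lambda>l. f l \<oplus>\<^bsub>M\<^esub> g l) n = msum M f n \<oplus>\<^bsub>M\<^esub> msum M g n"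
  by (induction n) (auto simp: M.a_ac msum_closed)

lemma msum_zero: "(\<And>l. l < n \<Longrightarrow> f l = \<zero>\<^bsub>M\<^esub>) \<Longrightarrow> msum M f n = \<zero>\<^bsub>M\<^esub>"
  by (induction n) auto

lemma zero_neg [simp]: "\<ominus>\<^bsub>M\<^esub> \<zero>\<^bsub>M\<^esub> = \<zero>\<^bsub>M\<^esub>"
  by (metis M.a_inv_closed M.r_neg M.l_zero M.zero_closed)

lemma minus_self [simp]: "x \<in> carrier M \<Longrightarrow> x \<ominus>\<^bsub>M\<^esub> x = \<zero>\<^bsub>M\<^esub>"
  by (simp add: a_minus_def M.r_neg)

lemma minus_zero_right [simp]: "x \<in> carrier M \<Longrightarrow> x \<ominus>\<^bsub>M\<^esub> \<zero>\<^bsub>M\<^esub> = x"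
  by (simp add: a_minus_def)

lemma msum_neg:
  "(\<And>l. l < n \<Longrightarrow> f l \<in> carrier M) \<Longrightarrow> msum M (\<lambda>l. \<ominus>\<^bsub>M\<^esub> f l) n = \<ominus>\<^bsub>M\<^esub> msum M f n"
  by (induction n) (auto simp: M.minus_add msum_closed)

lemma msum_diff:
  "(\<And>l. l < n \<Longrightarrow> f l \<in> carrier M) \<Longrightarrow> (\<And>l. l < n \<Longrightarrow> g l \<in> carrier M) \<Longrightarrow>
    msum M (\<lambda>l. f l \<ominus>\<^bsub>M\<^esub> g l) n = msum M f n \<ominus>\<^bsub>M\<^esub> msum M g n"
  by (simp add: a_minus_def msum_add msum_neg)

lemma msum_smult:
  "a \<in> carrier A \<Longrightarrow> (\<And>l. l < n \<Longrightarrow> f l \<in> carrier M) \<Longrightarrow>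
    a \<odot>\<^bsub>M\<^esub> msum M f n = msum M (\<lambda>l. a \<odot>\<^bsub>M\<^esub> f l) n"
  by (induction n) (auto simp: smult_r_distr msum_closed)

lemma msum_swap:
  "(\<And>i j. i < m \<Longrightarrow> j < n \<Longrightarrow> f i j \<in> carrier M) \<Longrightarrow>
    msum M (\<lambda>i. msum M (f i) n) m = msum M (\<lambda>j. msum M (\<lambda>i. f i j) m) n"
  by (induction m) (auto simp: msum_add msum_zero msum_closed)

lemma smult_minus_r: "a \<in> carrier A \<Longrightarrow> x \<in> carrier M \<Longrightarrow> y \<in> carrier M \<Longrightarrow>
   a \<odot>\<^bsub>M\<^esub> (x \<ominus>\<^bsub>M\<^esub> y) = a \<odot>\<^bsub>M\<^esub> x \<ominus>\<^bsub>M\<^esub> a \<odot>\<^bsub>M\<^esub> y"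
  by (simp add: a_minus_def smult_r_distr smult_r_minus)

lemma minus_zero_iff: "x \<in> carrier M \<Longrightarrow> y \<in> carrier M \<Longrightarrow> x \<ominus>\<^bsub>M\<^esub> y = \<zero>\<^bsub>M\<^esub> \<longleftrightarrow> x = y"
  by (metis M.minus_closed M.r_neg M.add.inv_closed M.add.inv_solve_right M.l_zero M.zero_closed a_minus_def)

lemma submodule_minus: "submodule H A M \<Longrightarrow> x \<in> H \<Longrightarrow> y \<in> H \<Longrightarrow> x \<ominus>\<^bsub>M\<^esub> y \<in> H"
  using submoduleE by (metis a_minus_def)

lemma submodule_zero: "submodule H A M \<Longrightarrow> \<zero>\<^bsub>M\<^esub> \<in> H"
  using submoduleE(2,3,5) M.r_neg submoduleE(1) by (metis ex_in_conv subsetD)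

lemma submodule_msum: "submodule H A M \<Longrightarrow> (\<And>l. l < n \<Longrightarrow> f l \<in> H) \<Longrightarrow> msum M f n \<in> H"
  by (induction n) (auto simp: submodule_zero submoduleE(5))

lemma minus_add_cancel': "x \<in> carrier M \<Longrightarrow> y \<in> carrier M \<Longrightarrow> (x \<ominus>\<^bsub>M\<^esub> y) \<oplus>\<^bsub>M\<^esub> y = x"
  by (simp add: a_minus_def M.a_assoc M.l_neg)

end

lemma lin_msum:
  assumes "module A M" "module A N" "lin A M N h" "\<And>l. l < n \<Longrightarrow> f l \<in> carrier M"
  shows "h (msum M f n) = msum N (\<lambda>l. h (f l)) n"
proof -
  interpret M: module A M by fact
  have "msum M f n \<in> carrier M \<and> h (msum M f n) = msum N (\<lambda>l. h (f l)) n"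
    using assms(4) by (induction n) (auto simp: lin_zero[OF assms(1-3)] lin_add[OF assms(3)])
  then show ?thesis ..
qed


lemma submodule_module: "module A M \<Longrightarrow> submodule H A M \<Longrightarrow> module A (M\<lparr>carrier := H\<rparr>)"
  by (rule submodule.submodule_is_module)

lemma lin_ker_submodule:
  assumes "module A M" "module A N" "lin A M N f"
  shows "submodule {x \<in> carrier M. f x = \<zero>\<^bsub>N\<^esub>} A M"
proof -
  interpret M: amod A M by (rule amod.intro) fact
  interpret N: amod A N by (rule amod.intro) fact
  show ?thesis
    by (rule M.submoduleI)
      (use assms in \<open>auto simp: lin_zero lin_neg lin_add lin_smult\<close>)
qed

lemma lin_image_submodule:
  assumes "module A M" "module A N" "lin A M N f" "submodule H A M"
  shows "submodule (f ` H) A N"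
proof -
  interpret M: amod A M by (rule amod.intro) fact
  interpret N: amod A N by (rule amod.intro) fact
  note H = M.submoduleE[OF assms(4)]
  show ?thesis
  proof (rule N.submoduleI)
    show "\<zero>\<^bsub>N\<^esub> \<in> f ` H"
      using lin_zero[OF assms(1-3)] M.submodule_zero[OF assms(4)] by (metis imageI)
  next
    fix b assume "b \<in> f ` H"
    then obtain x where x: "x \<in> H" "b = f x" by auto
    then have "f (\<ominus>\<^bsub>M\<^esub> x) = \<ominus>\<^bsub>N\<^esub> b" using lin_neg[OF assms(1-3)] H(1) by auto
    then show "\<ominus>\<^bsub>N\<^esub> b \<in> f ` H" using H(3)[OF x(1)] by (metis imageI)
  next
    fix b c assume "b \<in> f ` H" "c \<in> f ` H"
    then obtain x y where x: "x \<in> H" "b = f x" "y \<in> H" "c = f y" by auto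
    then have "f (x \<oplus>\<^bsub>M\<^esub> y) = b \<oplus>\<^bsub>N\<^esub> c" using lin_add[OF assms(3)] H(1) by auto
    then show "b \<oplus>\<^bsub>N\<^esub> c \<in> f ` H" using H(5)[OF x(1,3)] by (metis imageI)
  next
    fix a b assume a: "a \<in> carrier A" and "b \<in> f ` H"
    then obtain x where x: "x \<in> H" "b = f x" by auto
    then have "f (a \<odot>\<^bsub>M\<^esub> x) = a \<odot>\<^bsub>N\<^esub> b" using lin_smult[OF assms(3) a] H(1) by auto
    then show "a \<odot>\<^bsub>N\<^esub> b \<in> f ` H" using H(4)[OF a x(1)] by (metis imageI)
  qed (use H lin_closed[OF assms(3)] in auto)
qed

text \<open>The maps are only \<open>lin\<close>, not members of \<open>mod_hom\<close>, so the
  inclusion of a submodule can be written as the identity function. The three element types may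
  differ.\<close>

definition ses :: "'a ring \<Rightarrow> ('a, 'x) module \<Rightarrow> ('a, 'y) module \<Rightarrow> ('a, 'z) module
    \<Rightarrow> ('x \<Rightarrow> 'y) \<Rightarrow> ('y \<Rightarrow> 'z) \<Rightarrow> bool"
  where "ses A X Y Z i p \<longleftrightarrow> module A X \<and> module A Y \<and> module A Z \<and> lin A X Y i \<and> lin A Y Z p \<and>
    inj_on i (carrier X) \<and> p ` carrier Y = carrier Z \<and>
    i ` carrier X = {y \<in> carrier Y. p y = \<zero>\<^bsub>Z\<^esub>}"

text \<open>Matrices and tuples are total functions; only the entries within the stated ranks matter.\<close>

definition mact :: "('a, 'm) module \<Rightarrow> nat \<Rightarrow> (nat \<Rightarrow> nat \<Rightarrow> 'a) \<Rightarrow> (nat \<Rightarrow> 'm) \<Rightarrow> nat \<Rightarrow> 'm"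
  where "mact Y n T y k = msum Y (\<lambda>l. T k l \<odot>\<^bsub>Y\<^esub> y l) n"

definition mat :: "'a ring \<Rightarrow> (nat \<Rightarrow> nat \<Rightarrow> 'a) \<Rightarrow> bool"
  where "mat A T \<longleftrightarrow> (\<forall>k l. T k l \<in> carrier A)"

definition tr :: "(nat \<Rightarrow> nat \<Rightarrow> 'a) \<Rightarrow> nat \<Rightarrow> nat \<Rightarrow> 'a"
  where "tr T k l = T l k"

text \<open>The complex property is kept apart from \<open>exact_at\<close>, which only says that
  the kernel lies in the image. As an identity over \<open>A\<close> it holds for all coefficient
  modules at once.\<close>

definition zprod :: "'a ring \<Rightarrow> nat \<Rightarrow> (nat \<Rightarrow> nat \<Rightarrow> 'a) \<Rightarrow> nat \<Rightarrow> (nat \<Rightarrow> nat \<Rightarrow> 'a) \<Rightarrow> nat \<Rightarrow> bool"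
  where "zprod A c T b S a \<longleftrightarrow>
    (\<forall>k < c. \<forall>j < a. msum (reg_mod A) (\<lambda>l. T k l \<otimes>\<^bsub>A\<^esub> S l j) b = \<zero>\<^bsub>A\<^esub>)"

text \<open>Exactness of \<open>Y\<^sup>a \<rightarrow> Y\<^sup>b \<rightarrow> Y\<^sup>c\<close>. If \<open>S\<close> and \<open>T\<close> are the transposes of consecutive differentials
  of a free resolution of \<open>N\<close>, this is the vanishing of \<open>Ext(N, Y)\<close> in the degree of \<open>Y\<^sup>b\<close>.\<close>

definition exact_at :: "('a, 'm) module \<Rightarrow> nat \<Rightarrow> (nat \<Rightarrow> nat \<Rightarrow> 'a) \<Rightarrow> nat \<Rightarrow> (nat \<Rightarrow> nat \<Rightarrow> 'a) \<Rightarrow> nat \<Rightarrow> bool"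
  where "exact_at Y a S b T c \<longleftrightarrow>
    (\<forall>y. (\<forall>k. y k \<in> carrier Y) \<longrightarrow> (\<forall>k < c. mact Y b T y k = \<zero>\<^bsub>Y\<^esub>) \<longrightarrow>
      (\<exists>z. (\<forall>k. z k \<in> carrier Y) \<and> (\<forall>k < b. y k = mact Y a S z k)))"

text \<open>Here \<open>E s\<close> is the \<open>c s \<times> c (s + 1)\<close> matrix of the differential of a free resolution from degree
  \<open>s + 1\<close> to degree \<open>s\<close>.\<close>

abbreviation exact_res :: "('a, 'm) module \<Rightarrow> (nat \<Rightarrow> nat) \<Rightarrow> (nat \<Rightarrow> nat \<Rightarrow> nat \<Rightarrow> 'a) \<Rightarrow> nat \<Rightarrow> bool"
  where "exact_res Y c E s \<equiv> exact_at Y (c (Suc (Suc s))) (E (Suc s)) (c (Suc s)) (E s) (c s)"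

text \<open>The index is off by one: the spot tested has rank \<open>c (Suc s)\<close>, so this
  concerns Ext in degree \<open>Suc s\<close>.\<close>

abbreviation exact_dual :: "('a, 'm) module \<Rightarrow> (nat \<Rightarrow> nat) \<Rightarrow> (nat \<Rightarrow> nat \<Rightarrow> nat \<Rightarrow> 'a) \<Rightarrow> nat \<Rightarrow> bool"
  where "exact_dual Y c E s \<equiv>
    exact_at Y (c s) (tr (E s)) (c (Suc s)) (tr (E (Suc s))) (c (Suc (Suc s)))"

abbreviation zprod_res :: "'a ring \<Rightarrow> (nat \<Rightarrow> nat) \<Rightarrow> (nat \<Rightarrow> nat \<Rightarrow> nat \<Rightarrow> 'a) \<Rightarrow> nat \<Rightarrow> bool"
  where "zprod_res A c E s \<equiv> zprod A (c s) (E s) (c (Suc s)) (E (Suc s)) (c (Suc (Suc s)))"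

lemma exact_atI:
  assumes "\<And>y. (\<And>k. y k \<in> carrier Y) \<Longrightarrow> (\<And>k. k < c \<Longrightarrow> mact Y b T y k = \<zero>\<^bsub>Y\<^esub>) \<Longrightarrow>
      \<exists>z. (\<forall>k. z k \<in> carrier Y) \<and> (\<forall>k < b. y k = mact Y a S z k)"
  shows "exact_at Y a S b T c"
  using assms by (auto simp: exact_at_def)

lemma exact_atE:
  assumes "exact_at Y a S b T c" "\<And>k. y k \<in> carrier Y"
    "\<And>k. k < c \<Longrightarrow> mact Y b T y k = \<zero>\<^bsub>Y\<^esub>"
  obtains z where "\<And>k. z k \<in> carrier Y" "\<And>k. k < b \<Longrightarrow> y k = mact Y a S z k"
  using assms unfolding exact_at_def by blast

lemma mat_tr [simp]: "mat A (tr T) \<longleftrightarrow> mat A T"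
  by (auto simp: mat_def tr_def)

lemma mact_cong: "(\<And>l. l < n \<Longrightarrow> y l = y' l) \<Longrightarrow> mact Y n T y k = mact Y n T y' k"
  unfolding mact_def by (rule msum_cong) auto

lemma mact_carrier_update [simp]: "mact (Y\<lparr>carrier := H\<rparr>) n T y k = mact Y n T y k"
  by (simp add: mact_def)

lemma reg_mod_simps [simp]:
  "carrier (reg_mod A) = carrier A" "\<zero>\<^bsub>reg_mod A\<^esub> = \<zero>\<^bsub>A\<^esub>"
  "x \<oplus>\<^bsub>reg_mod A\<^esub> y = x \<oplus>\<^bsub>A\<^esub> y" "x \<odot>\<^bsub>reg_mod A\<^esub> y = x \<otimes>\<^bsub>A\<^esub> y"
  by (simp_all add: reg_mod_def)

lemma module_reg_mod:
  assumes "cring A"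
  shows "module A (reg_mod A)"
proof -
  interpret cring A by fact
  show ?thesis
  proof (rule moduleI)
    show "abelian_group (reg_mod A)"
      by (rule abelian_groupI) (use l_neg a_inv_closed in \<open>auto simp: a_assoc a_comm a_lcomm\<close>)
  qed (auto simp: assms l_distr r_distr m_assoc)
qed

lemma lin_mact:
  assumes "module A M" "module A N" "lin A M N h" "\<And>l. y l \<in> carrier M" "mat A T"
  shows "h (mact M n T y k) = mact N n T (\<lambda>l. h (y l)) k"
proof -
  interpret M: amod A M by (rule amod.intro) fact
  show ?thesis
    using assms by (simp add: mact_def lin_msum mat_def lin_smult)
qed

context amod
begin

lemma mact_closed [simp, intro]:
  "mat A T \<Longrightarrow> (\<And>l. y l \<in> carrier M) \<Longrightarrow> mact M n T y k \<in> carrier M"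
  by (simp add: mact_def mat_def)

lemma mact_diff:
  "mat A T \<Longrightarrow> (\<And>l. y l \<in> carrier M) \<Longrightarrow> (\<And>l. z l \<in> carrier M) \<Longrightarrow>
    mact M n T (\<lambda>l. y l \<ominus>\<^bsub>M\<^esub> z l) k = mact M n T y k \<ominus>\<^bsub>M\<^esub> mact M n T z k"
  by (simp add: mact_def mat_def smult_minus_r msum_diff)

lemma mact_add:
  "mat A T \<Longrightarrow> (\<And>l. y l \<in> carrier M) \<Longrightarrow> (\<And>l. z l \<in> carrier M) \<Longrightarrow>
    mact M n T (\<lambda>l. y l \<oplus>\<^bsub>M\<^esub> z l) k = mact M n T y k \<oplus>\<^bsub>M\<^esub> mact M n T z k"
  by (simp add: mact_def mat_def smult_r_distr msum_add)

lemma msum_smult_left: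
  "(\<And>l. l < n \<Longrightarrow> a l \<in> carrier A) \<Longrightarrow> x \<in> carrier M \<Longrightarrow>
    msum (reg_mod A) a n \<odot>\<^bsub>M\<^esub> x = msum M (\<lambda>l. a l \<odot>\<^bsub>M\<^esub> x) n"
proof (induction n)
  case (Suc n)
  then show ?case
    using amod.msum_closed[OF amod.intro[OF module_reg_mod[OF R.is_cring]], of n a]
    by (auto simp: smult_l_distr)
qed auto

lemma mact_mact:
  assumes "mat A S" "mat A T" "\<And>l. y l \<in> carrier M"
  shows "mact M b T (mact M a S y) k
    = mact M a (\<lambda>k j. msum (reg_mod A) (\<lambda>l. T k l \<otimes> S l j) b) y k"
proof -
  have "mact M b T (mact M a S y) k = msum M (\<lambda>l. msum M (\<lambda>j. (T k l \<otimes> S l j) \<odot>\<^bsub>M\<^esub> y j) a) b"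
    using assms by (simp add: mact_def mat_def msum_smult smult_assoc1)
  also have "\<dots> = msum M (\<lambda>j. msum M (\<lambda>l. (T k l \<otimes> S l j) \<odot>\<^bsub>M\<^esub> y j) b) a"
    using assms by (intro msum_swap) (simp add: mat_def)
  finally show ?thesis
    using assms by (simp add: mact_def mat_def msum_smult_left)
qed

lemma mact_zprod:
  assumes "mat A S" "mat A T" "\<And>l. y l \<in> carrier M" "zprod A c T b S a" "k < c"
  shows "mact M b T (mact M a S y) k = \<zero>\<^bsub>M\<^esub>"
  unfolding mact_mact[OF assms(1-3)] unfolding mact_def
  by (rule msum_zero) (use assms in \<open>simp add: zprod_def\<close>)

end

lemma zprod_tr:
  assumes "cring A" "mat A S" "mat A T"
  shows "zprod A a (tr S) b (tr T) c \<longleftrightarrow> zprod A c T b S a"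
proof -
  interpret cring A by fact
  have "msum (reg_mod A) (\<lambda>l. tr S j l \<otimes>\<^bsub>A\<^esub> tr T l k) b = msum (reg_mod A) (\<lambda>l. T k l \<otimes>\<^bsub>A\<^esub> S l j) b" for j k
    by (rule msum_cong) (use assms in \<open>simp add: tr_def mat_def m_comm\<close>)
  then show ?thesis by (auto simp: zprod_def)
qed

section \<open>The long exact cohomology sequence, by diagram chases on tuples\<close>

lemma ses_exact_middle:
  assumes "ses A X Y Z i p" "mat A S" "mat A T" "zprod A c T b S a"
    and "exact_at X a S b T c" "exact_at Z a S b T c"
  shows "exact_at Y a S b T c"
proof (rule exact_atI)
  from assms(1) have m: "module A X" "module A Y" "module A Z" and l: "lin A X Y i" "lin A Y Z p"
    and inj: "inj_on i (carrier X)" and sur: "p ` carrier Y = carrier Z"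
    and ker: "i ` carrier X = {y \<in> carrier Y. p y = \<zero>\<^bsub>Z\<^esub>}"
    by (auto simp: ses_def)
  interpret X: amod A X by (rule amod.intro) fact
  interpret Y: amod A Y by (rule amod.intro) fact
  interpret Z: amod A Z by (rule amod.intro) fact
  fix y assume y: "\<And>k. y k \<in> carrier Y" "\<And>k. k < c \<Longrightarrow> mact Y b T y k = \<zero>\<^bsub>Y\<^esub>"
  have "mact Z b T (\<lambda>k. p (y k)) k = \<zero>\<^bsub>Z\<^esub>" if "k < c" for k
    using lin_mact[where y = y and n = b and k = k, OF m(2,3) l(2) y(1) assms(3)] y(2)[OF that] lin_zero[OF m(2,3) l(2)] by simp
  then obtain z where z: "\<And>k. z k \<in> carrier Z" "\<And>k. k < b \<Longrightarrow> p (y k) = mact Z a S z k"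
    using exact_atE[OF assms(6), of "\<lambda>k. p (y k)"] y(1) lin_closed[OF l(2)] by blast
  have "\<forall>k. \<exists>w. w \<in> carrier Y \<and> p w = z k" using z(1) sur by (metis imageE)
  then obtain w where w: "\<And>k. w k \<in> carrier Y" "\<And>k. p (w k) = z k" by metis
  \<comment> \<open>Beyond rank \<open>b\<close> nothing relates \<open>y k\<close> to
    \<open>z\<close>; the value zero there keeps every entry in the kernel of \<open>p\<close>, so
    that the whole total tuple can be pulled back to \<open>X\<close>.\<close>
  define u where "u k = (if k < b then y k \<ominus>\<^bsub>Y\<^esub> mact Y a S w k else \<zero>\<^bsub>Y\<^esub>)" for k
  have u: "u k \<in> carrier Y" for k using y w assms(2) by (simp add: u_def)
  have "p (u k) = \<zero>\<^bsub>Z\<^esub>" for k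
    using z w y lin_mact[where y = w and n = a and k = k, OF m(2,3) l(2) w(1) assms(2)] assms(2)
    by (simp add: u_def lin_minus[OF m(2,3) l(2)] lin_zero[OF m(2,3) l(2)])
  then have "\<forall>k. \<exists>x. x \<in> carrier X \<and> i x = u k" using u ker by (metis (mono_tags, lifting) imageE mem_Collect_eq)
  then obtain x where x: "\<And>k. x k \<in> carrier X" "\<And>k. i (x k) = u k" by metis
  have "mact X b T x k = \<zero>\<^bsub>X\<^esub>" if k: "k < c" for k
  proof -
    have "i (mact X b T x k) = mact Y b T u k"
      using lin_mact[where y = x and n = b and k = k, OF m(1,2) l(1) x(1) assms(3)] x by simp
    also have "\<dots> = mact Y b T (\<lambda>k. y k \<ominus>\<^bsub>Y\<^esub> mact Y a S w k) k"
      by (rule mact_cong) (simp add: u_def)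
    also have "\<dots> = \<zero>\<^bsub>Y\<^esub>"
      using y(1) w(1) assms(2-4) k y(2)[OF k] by (simp add: Y.mact_diff Y.mact_zprod)
    finally show ?thesis
      using inj x(1) assms(3) lin_zero[OF m(1,2) l(1)] by (metis X.mact_closed X.zero_closed inj_onD)
  qed
  then obtain v where v: "\<And>k. v k \<in> carrier X" "\<And>k. k < b \<Longrightarrow> x k = mact X a S v k"
    using exact_atE[OF assms(5), of x] x by blast
  have "y k = mact Y a S (\<lambda>l. i (v l) \<oplus>\<^bsub>Y\<^esub> w l) k" if "k < b" for k
  proof -
    have "mact Y a S (\<lambda>l. i (v l) \<oplus>\<^bsub>Y\<^esub> w l) k = i (x k) \<oplus>\<^bsub>Y\<^esub> mact Y a S w k"
      using v w assms(2) lin_closed[OF l(1)] that lin_mact[where y = v and n = a and k = k, OF m(1,2) l(1) v(1) assms(2)]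
      by (simp add: Y.mact_add)
    also have "\<dots> = y k"
      using x that y w assms(2) by (simp add: u_def Y.minus_add_cancel')
    finally show ?thesis ..
  qed
  then show "\<exists>z. (\<forall>k. z k \<in> carrier Y) \<and> (\<forall>k<b. y k = mact Y a S z k)"
    using v w lin_closed[OF l(1)] by (intro exI[of _ "\<lambda>l. i (v l) \<oplus>\<^bsub>Y\<^esub> w l"]) auto
qed

text \<open>In the long exact sequence the cohomology of \<open>Z\<close> lies between that of
  \<open>Y\<close> at the same spot and that of \<open>X\<close> one spot later.\<close>

lemma ses_exact_right:
  assumes "ses A X Y Z i p" "mat A S" "mat A T" "mat A U" "zprod A d U c T b"
    and "exact_at X b T c U d" "exact_at Y a S b T c"
  shows "exact_at Z a S b T c"
proof (rule exact_atI)
  from assms(1) have m: "module A X" "module A Y" "module A Z" and l: "lin A X Y i" "lin A Y Z p"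
    and inj: "inj_on i (carrier X)" and sur: "p ` carrier Y = carrier Z"
    and ker: "i ` carrier X = {y \<in> carrier Y. p y = \<zero>\<^bsub>Z\<^esub>}"
    by (auto simp: ses_def)
  interpret X: amod A X by (rule amod.intro) fact
  interpret Y: amod A Y by (rule amod.intro) fact
  interpret Z: amod A Z by (rule amod.intro) fact
  fix z assume z: "\<And>k. z k \<in> carrier Z" "\<And>k. k < c \<Longrightarrow> mact Z b T z k = \<zero>\<^bsub>Z\<^esub>"
  have "\<forall>k. \<exists>w. w \<in> carrier Y \<and> p w = z k" using z(1) sur by (metis imageE)
  then obtain w where w: "\<And>k. w k \<in> carrier Y" "\<And>k. p (w k) = z k" by metis
  \<comment> \<open>This is the connecting homomorphism: the differential of a lift of
    \<open>z\<close> comes from a cocycle in \<open>X\<close>, one spot further on.\<close>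
  define u where "u k = (if k < c then mact Y b T w k else \<zero>\<^bsub>Y\<^esub>)" for k
  have u: "u k \<in> carrier Y" for k using w assms by (simp add: u_def)
  have "p (u k) = \<zero>\<^bsub>Z\<^esub>" for k
    using z w lin_mact[where y = w and n = b and k = k, OF m(2,3) l(2) w(1) assms(3)] by (simp add: u_def lin_zero[OF m(2,3) l(2)])
  then have "\<forall>k. \<exists>x. x \<in> carrier X \<and> i x = u k" using u ker by (metis (mono_tags, lifting) imageE mem_Collect_eq)
  then obtain x where x: "\<And>k. x k \<in> carrier X" "\<And>k. i (x k) = u k" by metis
  have "mact X c U x k = \<zero>\<^bsub>X\<^esub>" if k: "k < d" for k
  proof -
    have "i (mact X c U x k) = mact Y c U u k"
      using lin_mact[where y = x and n = c and k = k, OF m(1,2) l(1) x(1) assms(4)] x by simp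
    also have "\<dots> = mact Y c U (mact Y b T w) k"
      by (rule mact_cong) (simp add: u_def)
    also have "\<dots> = \<zero>\<^bsub>Y\<^esub>"
      using w assms k by (simp add: Y.mact_zprod)
    finally show ?thesis
      using inj x(1) assms(4) lin_zero[OF m(1,2) l(1)] by (metis X.mact_closed X.zero_closed inj_onD)
  qed
  then obtain v where v: "\<And>k. v k \<in> carrier X" "\<And>k. k < c \<Longrightarrow> x k = mact X b T v k"
    using exact_atE[OF assms(6), of x] x by blast
  have "mact Y b T (\<lambda>k. w k \<ominus>\<^bsub>Y\<^esub> i (v k)) k = \<zero>\<^bsub>Y\<^esub>" if "k < c" for k
    using w v assms(3) that lin_closed[OF l(1)] lin_mact[where y = v and n = b and k = k, OF m(1,2) l(1) v(1) assms(3)] x(2)[of k] x(1)[of k]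
    by (simp add: Y.mact_diff u_def)
  then obtain t where t: "\<And>k. t k \<in> carrier Y" "\<And>k. k < b \<Longrightarrow> w k \<ominus>\<^bsub>Y\<^esub> i (v k) = mact Y a S t k"
    using exact_atE[OF assms(7), of "\<lambda>k. w k \<ominus>\<^bsub>Y\<^esub> i (v k)"] w v lin_closed[OF l(1)] by blast
  have "z k = mact Z a S (\<lambda>l. p (t l)) k" if "k < b" for k
  proof -
    have "p (i (v k)) = \<zero>\<^bsub>Z\<^esub>" using v(1) ker by blast
    then have "p (w k \<ominus>\<^bsub>Y\<^esub> i (v k)) = z k"
      using w v lin_closed[OF l(1)] z by (simp add: lin_minus[OF m(2,3) l(2)])
    then show ?thesis using t(2)[OF that] lin_mact[where y = t and n = a and k = k, OF m(2,3) l(2) t(1) assms(2)] by simp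
  qed
  then show "\<exists>z'. (\<forall>k. z' k \<in> carrier Z) \<and> (\<forall>k<b. z k = mact Z a S z' k)"
    using t lin_closed[OF l(2)] by (intro exI[of _ "\<lambda>l. p (t l)"]) auto
qed

text \<open>In the long exact sequence the cohomology of \<open>X\<close> lies between that of
  \<open>Z\<close> one spot earlier and that of \<open>Y\<close> at the same spot.\<close>

lemma ses_exact_left:
  assumes "ses A X Y Z i p" "mat A S" "mat A T" "mat A U" "zprod A c T b S a"
    and "exact_at Z a S b T c" "exact_at Y b T c U d"
  shows "exact_at X b T c U d"
proof (rule exact_atI)
  from assms(1) have m: "module A X" "module A Y" "module A Z" and l: "lin A X Y i" "lin A Y Z p"
    and inj: "inj_on i (carrier X)" and sur: "p ` carrier Y = carrier Z"
    and ker: "i ` carrier X = {y \<in> carrier Y. p y = \<zero>\<^bsub>Z\<^esub>}"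
    by (auto simp: ses_def)
  interpret X: amod A X by (rule amod.intro) fact
  interpret Y: amod A Y by (rule amod.intro) fact
  interpret Z: amod A Z by (rule amod.intro) fact
  fix x assume x: "\<And>k. x k \<in> carrier X" "\<And>k. k < d \<Longrightarrow> mact X c U x k = \<zero>\<^bsub>X\<^esub>"
  have "mact Y c U (\<lambda>k. i (x k)) k = \<zero>\<^bsub>Y\<^esub>" if "k < d" for k
    using x(2)[OF that] lin_mact[where y = x and n = c and k = k, OF m(1,2) l(1) x(1) assms(4)] by (simp add: lin_zero[OF m(1,2) l(1)])
  then obtain y where y: "\<And>k. y k \<in> carrier Y" "\<And>k. k < c \<Longrightarrow> i (x k) = mact Y b T y k"
    using exact_atE[OF assms(7), of "\<lambda>k. i (x k)"] x lin_closed[OF l(1)] by blast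
  have "mact Z b T (\<lambda>k. p (y k)) k = \<zero>\<^bsub>Z\<^esub>" if "k < c" for k
  proof -
    have "p (i (x k)) = \<zero>\<^bsub>Z\<^esub>" using x(1) ker by blast
    then show ?thesis using y(2)[OF that] lin_mact[where y = y and n = b and k = k, OF m(2,3) l(2) y(1) assms(3)] by simp
  qed
  then obtain z where z: "\<And>k. z k \<in> carrier Z" "\<And>k. k < b \<Longrightarrow> p (y k) = mact Z a S z k"
    using exact_atE[OF assms(6), of "\<lambda>k. p (y k)"] y(1) lin_closed[OF l(2)] by blast
  have "\<forall>k. \<exists>w. w \<in> carrier Y \<and> p w = z k" using z(1) sur by (metis imageE)
  then obtain w where w: "\<And>k. w k \<in> carrier Y" "\<And>k. p (w k) = z k" by metis
  define u where "u k = (if k < b then y k \<ominus>\<^bsub>Y\<^esub> mact Y a S w k else \<zero>\<^bsub>Y\<^esub>)" for k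
  have u: "u k \<in> carrier Y" for k using y w assms(2) by (simp add: u_def)
  have "p (u k) = \<zero>\<^bsub>Z\<^esub>" for k
    using z w y lin_mact[where y = w and n = a and k = k, OF m(2,3) l(2) w(1) assms(2)] assms(2)
    by (simp add: u_def lin_minus[OF m(2,3) l(2)] lin_zero[OF m(2,3) l(2)])
  then have "\<forall>k. \<exists>x. x \<in> carrier X \<and> i x = u k" using u ker by (metis (mono_tags, lifting) imageE mem_Collect_eq)
  then obtain v where v: "\<And>k. v k \<in> carrier X" "\<And>k. i (v k) = u k" by metis
  have "x k = mact X b T v k" if k: "k < c" for k
  proof -
    have "i (mact X b T v k) = mact Y b T u k"
      using lin_mact[where y = v and n = b and k = k, OF m(1,2) l(1) v(1) assms(3)] v by simp
    also have "\<dots> = mact Y b T (\<lambda>k. y k \<ominus>\<^bsub>Y\<^esub> mact Y a S w k) k"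
      by (rule mact_cong) (simp add: u_def)
    also have "\<dots> = i (x k)"
      using y(1) w(1) assms(2-5) k y(2)[OF k] lin_closed[OF l(1) x(1)[of k]]
      by (simp add: Y.mact_diff Y.mact_zprod)
    finally show ?thesis
      using inj x(1) v(1) assms(3) by (metis X.mact_closed inj_onD)
  qed
  then show "\<exists>z. (\<forall>k. z k \<in> carrier X) \<and> (\<forall>k<c. x k = mact X b T z k)"
    using v by blast
qed

section \<open>Free modules, products and modules of homomorphisms\<close>

text \<open>Finite powers of an arbitrary module are needed besides free modules: a tuple of maps on
  \<open>W\<close> is one map on a power of \<open>W\<close>, and as such it can be extended into an
  injective module.\<close>

definition pow_mod :: "nat \<Rightarrow> ('a, 'm) module \<Rightarrow> ('a, nat \<Rightarrow> 'm) module"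
  where "pow_mod n Y =
    \<lparr>carrier = {..<n} \<rightarrow>\<^sub>E carrier Y, monoid.mult = undefined, monoid.one = undefined,
     ring.zero = (\<lambda>i \<in> {..<n}. \<zero>\<^bsub>Y\<^esub>),
     ring.add = (\<lambda>x y. \<lambda>i \<in> {..<n}. x i \<oplus>\<^bsub>Y\<^esub> y i),
     smult = (\<lambda>a x. \<lambda>i \<in> {..<n}. a \<odot>\<^bsub>Y\<^esub> x i)\<rparr>"

lemma free_mod_eq: "free_mod A n = pow_mod n (reg_mod A)"
  by (simp add: free_mod_def pow_mod_def)

lemma pow_mod_simps [simp]:
  "carrier (pow_mod n Y) = {..<n} \<rightarrow>\<^sub>E carrier Y"
  "\<zero>\<^bsub>pow_mod n Y\<^esub> = (\<lambda>i \<in> {..<n}. \<zero>\<^bsub>Y\<^esub>)"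
  "x \<oplus>\<^bsub>pow_mod n Y\<^esub> y = (\<lambda>i \<in> {..<n}. x i \<oplus>\<^bsub>Y\<^esub> y i)"
  "a \<odot>\<^bsub>pow_mod n Y\<^esub> x = (\<lambda>i \<in> {..<n}. a \<odot>\<^bsub>Y\<^esub> x i)"
  by (simp_all add: pow_mod_def)

lemma free_mod_simps [simp]:
  "carrier (free_mod A n) = {..<n} \<rightarrow>\<^sub>E carrier A"
  "\<zero>\<^bsub>free_mod A n\<^esub> = (\<lambda>i \<in> {..<n}. \<zero>\<^bsub>A\<^esub>)"
  "x \<oplus>\<^bsub>free_mod A n\<^esub> y = (\<lambda>i \<in> {..<n}. x i \<oplus>\<^bsub>A\<^esub> y i)"
  "a \<odot>\<^bsub>free_mod A n\<^esub> x = (\<lambda>i \<in> {..<n}. a \<otimes>\<^bsub>A\<^esub> x i)"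
  by (simp_all add: free_mod_def)

lemma tuple_ext: "x \<in> {..<n} \<rightarrow>\<^sub>E S \<Longrightarrow> y \<in> {..<n} \<rightarrow>\<^sub>E S' \<Longrightarrow> (\<And>i. i < n \<Longrightarrow> x i = y i) \<Longrightarrow> x = (y :: nat \<Rightarrow> 'b)"
  by (rule ext) (metis PiE_arb lessThan_iff)

lemma PiE_closed: "x \<in> {..<n} \<rightarrow>\<^sub>E S \<Longrightarrow> i < n \<Longrightarrow> x i \<in> S" for x :: "nat \<Rightarrow> 'b"
  by auto

lemma module_pow_mod:
  fixes A :: "'a ring"
  assumes "module A Y"
  shows "module A (pow_mod n Y)"
proof -
  interpret Y: amod A Y by (rule amod.intro) fact
  show ?thesis
  proof (rule moduleI)
    show "abelian_group (pow_mod n Y)"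
    proof (rule abelian_groupI)
      fix x assume x: "x \<in> carrier (pow_mod n Y)"
      have "(\<lambda>i\<in>{..<n}. \<ominus>\<^bsub>Y\<^esub> x i) \<oplus>\<^bsub>pow_mod n Y\<^esub> x = \<zero>\<^bsub>pow_mod n Y\<^esub>"
        using x by (simp add: fun_eq_iff restrict_def PiE_iff Y.l_neg)
      moreover have "(\<lambda>i\<in>{..<n}. \<ominus>\<^bsub>Y\<^esub> x i) \<in> carrier (pow_mod n Y)"
        using x by (simp add: PiE_iff)
      ultimately show "\<exists>y\<in>carrier (pow_mod n Y). y \<oplus>\<^bsub>pow_mod n Y\<^esub> x = \<zero>\<^bsub>pow_mod n Y\<^esub>"
        by blast
    qed (simp_all add: fun_eq_iff restrict_def PiE_iff extensional_def Y.a_assoc Y.a_comm Y.a_lcomm)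
  qed (simp_all add: fun_eq_iff restrict_def PiE_iff extensional_def Y.smult_l_distr Y.smult_r_distr
      Y.smult_assoc1 Y.R.is_cring)
qed

lemma module_free_mod: "cring A \<Longrightarrow> module A (free_mod A n)"
  unfolding free_mod_eq by (intro module_pow_mod module_reg_mod)

lemma prod_mod_simps [simp]:
  "carrier (prod_mod M N) = carrier M \<times> carrier N"
  "\<zero>\<^bsub>prod_mod M N\<^esub> = (\<zero>\<^bsub>M\<^esub>, \<zero>\<^bsub>N\<^esub>)"
  "x \<oplus>\<^bsub>prod_mod M N\<^esub> y = (fst x \<oplus>\<^bsub>M\<^esub> fst y, snd x \<oplus>\<^bsub>N\<^esub> snd y)"
  "a \<odot>\<^bsub>prod_mod M N\<^esub> x = (a \<odot>\<^bsub>M\<^esub> fst x, a \<odot>\<^bsub>N\<^esub> snd x)"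
  by (simp_all add: prod_mod_def split_beta)

lemma module_prod_mod:
  fixes A :: "'a ring"
  assumes "module A M" "module A N"
  shows "module A (prod_mod M N)"
proof -
  interpret M: amod A M by (rule amod.intro) fact
  interpret N: amod A N by (rule amod.intro) fact
  show ?thesis
  proof (rule moduleI)
    show "abelian_group (prod_mod M N)"
    proof (rule abelian_groupI)
      fix x assume "x \<in> carrier (prod_mod M N)"
      then show "\<exists>y\<in>carrier (prod_mod M N). y \<oplus>\<^bsub>prod_mod M N\<^esub> x = \<zero>\<^bsub>prod_mod M N\<^esub>"
        by (intro bexI[of _ "(\<ominus>\<^bsub>M\<^esub> fst x, \<ominus>\<^bsub>N\<^esub> snd x)"]) (auto simp: M.l_neg N.l_neg)
    qed (auto simp: M.M.a_ac N.M.a_ac)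
  qed (auto simp: M.smult_l_distr M.smult_r_distr M.smult_assoc1 N.smult_l_distr N.smult_r_distr
      N.smult_assoc1 M.R.is_cring)
qed

lemma hom_mod_simps [simp]:
  "carrier (hom_mod A M N) = mod_hom A M N"
  "\<zero>\<^bsub>hom_mod A M N\<^esub> = (\<lambda>x \<in> carrier M. \<zero>\<^bsub>N\<^esub>)"
  "f \<oplus>\<^bsub>hom_mod A M N\<^esub> g = (\<lambda>x \<in> carrier M. f x \<oplus>\<^bsub>N\<^esub> g x)"
  "a \<odot>\<^bsub>hom_mod A M N\<^esub> f = (\<lambda>x \<in> carrier M. a \<odot>\<^bsub>N\<^esub> f x)"
  by (simp_all add: hom_mod_def)

lemma mod_hom_ext:
  "f \<in> mod_hom A M N \<Longrightarrow> g \<in> mod_hom A M N' \<Longrightarrow> (\<And>x. x \<in> carrier M \<Longrightarrow> f x = g x) \<Longrightarrow> f = g"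
  by (auto simp: mod_hom_iff intro: extensionalityI)

lemma mod_hom_closed: "f \<in> mod_hom A M N \<Longrightarrow> x \<in> carrier M \<Longrightarrow> f x \<in> carrier N"
  by (auto simp: mod_hom_iff lin_def)

lemma module_hom_mod:
  assumes "module A M" "module A N"
  shows "module A (hom_mod A M N)"
proof -
  interpret M: amod A M by (rule amod.intro) fact
  interpret N: amod A N by (rule amod.intro) fact
  have add: "f \<oplus>\<^bsub>hom_mod A M N\<^esub> g \<in> mod_hom A M N" if "f \<in> mod_hom A M N" "g \<in> mod_hom A M N" for f g
    using that by (auto simp: mod_hom_iff lin_def N.M.a_ac N.smult_r_distr)
  have smult: "a \<odot>\<^bsub>hom_mod A M N\<^esub> f \<in> mod_hom A M N" if "a \<in> carrier A" "f \<in> mod_hom A M N" for a f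
    using that by (auto simp: mod_hom_iff lin_def N.smult_r_distr N.smult_assoc1[symmetric] M.R.m_comm)
  have zero: "\<zero>\<^bsub>hom_mod A M N\<^esub> \<in> mod_hom A M N"
    by (auto simp: mod_hom_iff lin_def)
  show ?thesis
  proof (rule moduleI)
    show "abelian_group (hom_mod A M N)"
    proof (rule abelian_groupI)
      fix f assume f: "f \<in> carrier (hom_mod A M N)"
      have "(\<lambda>x\<in>carrier M. \<ominus>\<^bsub>N\<^esub> f x) \<in> mod_hom A M N"
        using f by (auto simp: mod_hom_iff lin_def N.M.minus_add N.smult_r_minus)
      then show "\<exists>g\<in>carrier (hom_mod A M N). g \<oplus>\<^bsub>hom_mod A M N\<^esub> f = \<zero>\<^bsub>hom_mod A M N\<^esub>"
        using f by (intro bexI[of _ "\<lambda>x\<in>carrier M. \<ominus>\<^bsub>N\<^esub> f x"]) (auto simp: N.l_neg mod_hom_closed intro!: restrict_ext)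
    next
      fix f assume f: "f \<in> carrier (hom_mod A M N)"
      then show "\<zero>\<^bsub>hom_mod A M N\<^esub> \<oplus>\<^bsub>hom_mod A M N\<^esub> f = f"
        by (intro mod_hom_ext[OF add[OF zero]]) (auto simp: mod_hom_closed)
    qed (use add zero in \<open>auto simp: mod_hom_closed N.M.a_ac intro!: restrict_ext\<close>)
  next
    fix f assume f: "f \<in> carrier (hom_mod A M N)"
    then show "\<one>\<^bsub>A\<^esub> \<odot>\<^bsub>hom_mod A M N\<^esub> f = f"
      by (intro mod_hom_ext[OF smult]) (auto simp: mod_hom_closed)
  qed (use smult M.R.is_cring in \<open>auto simp: mod_hom_closed N.smult_l_distr N.smult_r_distr N.smult_assoc1 intro!: restrict_ext\<close>)
qed

lemma msum_pow_mod: "i < n \<Longrightarrow> msum (pow_mod n Y) f m i = msum Y (\<lambda>l. f l i) m"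
  by (induction m) auto

lemma mact_pow_mod: "i < n \<Longrightarrow> mact (pow_mod n Y) m T y k i = mact Y m T (\<lambda>l. y l i) k"
  by (simp add: mact_def msum_pow_mod cong: msum_cong)

lemma exact_at_pow_mod:
  assumes "module A Y" "mat A S" "mat A T" "exact_at Y a S b T c"
  shows "exact_at (pow_mod n Y) a S b T c"
proof (rule exact_atI)
  interpret Y: amod A Y by (rule amod.intro) fact
  fix y assume y: "\<And>k. y k \<in> carrier (pow_mod n Y)"
    and 0: "\<And>k. k < c \<Longrightarrow> mact (pow_mod n Y) b T y k = \<zero>\<^bsub>pow_mod n Y\<^esub>"
  have "\<exists>z. (\<forall>k. z k \<in> carrier Y) \<and> (\<forall>k<b. y k i = mact Y a S z k)" if i: "i < n" for i
  proof -
    have "mact Y b T (\<lambda>l. y l i) k = \<zero>\<^bsub>Y\<^esub>" if "k < c" for k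
      using fun_cong[OF 0[OF that], of i] i by (simp add: mact_pow_mod)
    moreover have "y k i \<in> carrier Y" for k using y[of k] i by auto
    ultimately show ?thesis
      using exact_atE[OF assms(4), of "\<lambda>l. y l i"] by metis
  qed
  then obtain z where z: "\<And>i k. i < n \<Longrightarrow> z i k \<in> carrier Y"
    "\<And>i k. i < n \<Longrightarrow> k < b \<Longrightarrow> y k i = mact Y a S (z i) k" by metis
  define w where "w k = (\<lambda>i\<in>{..<n}. z i k)" for k
  interpret P: amod A "pow_mod n Y" by (rule amod.intro[OF module_pow_mod]) fact
  have w: "w k \<in> carrier (pow_mod n Y)" for k using z by (auto simp: w_def)
  have "y k = mact (pow_mod n Y) a S w k" if "k < b" for k
  proof (rule tuple_ext)
    show "mact (pow_mod n Y) a S w k \<in> {..<n} \<rightarrow>\<^sub>E carrier Y"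
      using P.mact_closed[of S w a k] w assms(2) by simp
    show "y k \<in> {..<n} \<rightarrow>\<^sub>E carrier Y" using y by simp
  next
    fix i assume "i < n"
    then show "y k i = mact (pow_mod n Y) a S w k i"
      using z(2) that by (simp add: mact_pow_mod w_def)
  qed
  with w show "\<exists>z. (\<forall>k. z k \<in> carrier (pow_mod n Y)) \<and> (\<forall>k<b. y k = mact (pow_mod n Y) a S z k)"
    by blast
qed

text \<open>A cocycle is sent to \<open>F\<close> by \<open>s\<close>, solved there, and the
  solution is brought back by \<open>p\<close>. Isomorphisms and projective modules are both treated
  as retracts.\<close>

lemma exact_at_retract:
  fixes A :: "'a ring"
  assumes "module A P" "module A F" "lin A P F s" "lin A F P p" "\<And>x. x \<in> carrier P \<Longrightarrow> p (s x) = x"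
    "mat A S" "mat A T" "exact_at F a S b T c"
  shows "exact_at P a S b T c"
proof (rule exact_atI)
  fix y assume y: "\<And>k. y k \<in> carrier P" "\<And>k. k < c \<Longrightarrow> mact P b T y k = \<zero>\<^bsub>P\<^esub>"
  have "mact F b T (\<lambda>k. s (y k)) k = \<zero>\<^bsub>F\<^esub>" if "k < c" for k
    using lin_mact[where y = y and n = b and k = k, OF assms(1,2,3) y(1) assms(7)] y(2)[OF that]
      lin_zero[OF assms(1,2,3)] by simp
  then obtain z where z: "\<And>k. z k \<in> carrier F" "\<And>k. k < b \<Longrightarrow> s (y k) = mact F a S z k"
    using exact_atE[OF assms(8), of "\<lambda>k. s (y k)"] y(1) lin_closed[OF assms(3)] by blast
  have "y k = mact P a S (\<lambda>l. p (z l)) k" if "k < b" for k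
    using lin_mact[where y = z and n = a and k = k, OF assms(2,1,4) z(1) assms(6)] z(2)[OF that] assms(5)[OF y(1), of k]
    by simp
  then show "\<exists>z. (\<forall>k. z k \<in> carrier P) \<and> (\<forall>k<b. y k = mact P a S z k)"
    using z(1) lin_closed[OF assms(4)] by (intro exI[of _ "\<lambda>l. p (z l)"]) auto
qed

lemma lin_inv_into:
  fixes A :: "'a ring"
  assumes "module A X" "module A Y" "lin A X Y f" "bij_betw f (carrier X) (carrier Y)"
  shows "lin A Y X (inv_into (carrier X) f)"
proof -
  interpret X: amod A X by (rule amod.intro) fact
  have g: "inv_into (carrier X) f y \<in> carrier X" "f (inv_into (carrier X) f y) = y" if "y \<in> carrier Y" for y
    using that assms(4) by (auto simp: bij_betw_def inv_into_into f_inv_into_f)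
  have inj: "x = x'" if "f x = f x'" "x \<in> carrier X" "x' \<in> carrier X" for x x'
    using assms(4) that by (auto simp: bij_betw_def inj_on_def)
  interpret Y: amod A Y by (rule amod.intro) fact
  show ?thesis
    by (rule linI; (rule inj)?) (simp_all add: g lin_add[OF assms(3)] lin_smult[OF assms(3)])
qed

lemma exact_at_iso:
  fixes A :: "'a ring"
  assumes "module A X" "module A Y" "lin A X Y f" "bij_betw f (carrier X) (carrier Y)"
    "mat A S" "mat A T"
  shows "exact_at X a S b T c \<longleftrightarrow> exact_at Y a S b T c"
proof
  note g = lin_inv_into[OF assms(1-4)]
  show "exact_at Y a S b T c" if "exact_at X a S b T c"
    by (rule exact_at_retract[OF assms(2,1) g assms(3) _ assms(5,6) that])
      (use assms(4) in \<open>simp add: bij_betw_def f_inv_into_f\<close>)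
  show "exact_at X a S b T c" if "exact_at Y a S b T c"
    by (rule exact_at_retract[OF assms(1,2,3) g _ assms(5,6) that])
      (use assms(4) in \<open>simp add: bij_betw_def\<close>)
qed

lemma exact_at_free_mod:
  assumes "cring A" "mat A S" "mat A T" "exact_at (reg_mod A) a S b T c"
  shows "exact_at (free_mod A n) a S b T c"
  unfolding free_mod_eq using assms by (intro exact_at_pow_mod[OF module_reg_mod])

section \<open>Maps out of free modules and their matrices\<close>

definition uvec :: "'a ring \<Rightarrow> nat \<Rightarrow> nat \<Rightarrow> nat \<Rightarrow> 'a"
  where "uvec A n l = (\<lambda>i\<in>{..<n}. if i = l then \<one>\<^bsub>A\<^esub> else \<zero>\<^bsub>A\<^esub>)"

lemma uvec_closed [simp]: "cring A \<Longrightarrow> uvec A n l \<in> {..<n} \<rightarrow>\<^sub>E carrier A"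
  by (auto simp: uvec_def cring_def ring.ring_simprules)

lemma (in amod) msum_delta:
  assumes "x \<in> carrier M" "i < n"
  shows "msum M (\<lambda>l. if l = i then x else \<zero>\<^bsub>M\<^esub>) n = x"
proof -
  have "msum M (\<lambda>l. if l = i then x else \<zero>\<^bsub>M\<^esub>) n = (if i < n then x else \<zero>\<^bsub>M\<^esub>)"
    using assms(1) by (induction n) auto
  then show ?thesis using assms by simp
qed

lemma free_mod_expand:
  assumes "cring A" "x \<in> carrier (free_mod A n)"
  shows "x = msum (free_mod A n) (\<lambda>l. x l \<odot>\<^bsub>free_mod A n\<^esub> uvec A n l) n"
proof (rule tuple_ext)
  interpret F: amod A "free_mod A n" by (rule amod.intro[OF module_free_mod]) fact
  interpret cring A by fact
  interpret R: amod A "reg_mod A" by (rule amod.intro[OF module_reg_mod]) fact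
  have "msum (free_mod A n) (\<lambda>l. x l \<odot>\<^bsub>free_mod A n\<^esub> uvec A n l) n \<in> carrier (free_mod A n)"
    by (rule F.msum_closed, rule F.smult_closed) (use assms in auto)
  then show "msum (free_mod A n) (\<lambda>l. x l \<odot>\<^bsub>free_mod A n\<^esub> uvec A n l) n \<in> {..<n} \<rightarrow>\<^sub>E carrier A"
    by simp
  show "x \<in> {..<n} \<rightarrow>\<^sub>E carrier A" using assms by simp
  fix i assume i: "i < n"
  have "msum (free_mod A n) (\<lambda>l. x l \<odot>\<^bsub>free_mod A n\<^esub> uvec A n l) n i
      = msum (reg_mod A) (\<lambda>l. if l = i then x i else \<zero>\<^bsub>A\<^esub>) n"
    unfolding free_mod_eq msum_pow_mod[OF i]
  proof (rule msum_cong)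
    fix l assume "l < n"
    then have "x l \<in> carrier A" using assms(2) by auto
    then show "(x l \<odot>\<^bsub>pow_mod n (reg_mod A)\<^esub> uvec A n l) i = (if l = i then x i else \<zero>\<^bsub>A\<^esub>)"
      using i by (auto simp: uvec_def)
  qed
  also have "\<dots> = x i"
  proof -
    have "x i \<in> carrier A" using i assms(2) by auto
    then show ?thesis using R.msum_delta[of "x i" i n] i by (simp cong: if_cong)
  qed
  finally show "x i = msum (free_mod A n) (\<lambda>l. x l \<odot>\<^bsub>free_mod A n\<^esub> uvec A n l) n i" ..
qed

lemma lin_free_eq:
  assumes "module A Y" "lin A (free_mod A n) Y f" "x \<in> carrier (free_mod A n)"
  shows "f x = msum Y (\<lambda>l. x l \<odot>\<^bsub>Y\<^esub> f (uvec A n l)) n"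
proof -
  interpret Y: amod A Y by (rule amod.intro) fact
  note c = Y.R.is_cring
  interpret F: amod A "free_mod A n" by (rule amod.intro[OF module_free_mod[OF c]])
  have "f x = msum Y (\<lambda>l. f (x l \<odot>\<^bsub>free_mod A n\<^esub> uvec A n l)) n"
    by (subst free_mod_expand[OF c assms(3)], rule lin_msum[OF module_free_mod[OF c] assms(1,2)],
        rule F.smult_closed) (use assms c in auto)
  also have "\<dots> = msum Y (\<lambda>l. x l \<odot>\<^bsub>Y\<^esub> f (uvec A n l)) n"
    by (rule msum_cong, rule lin_smult[OF assms(2)]) (use assms c in auto)
  finally show ?thesis .
qed

lemma lin_of_tuple:
  assumes "module A Y" "\<And>l. l < n \<Longrightarrow> y l \<in> carrier Y"
  shows "lin A (free_mod A n) Y (\<lambda>x. msum Y (\<lambda>l. x l \<odot>\<^bsub>Y\<^esub> y l) n)"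
proof -
  interpret Y: amod A Y by (rule amod.intro) fact
  show ?thesis
    by (rule linI)
      (use assms in \<open>auto simp: PiE_closed Y.smult_l_distr Y.smult_assoc1 Y.msum_add[symmetric] Y.msum_smult
        intro!: Y.msum_closed msum_cong\<close>)
qed

lemma of_tuple_uvec:
  assumes "module A Y" "\<And>l. l < n \<Longrightarrow> y l \<in> carrier Y" "i < n"
  shows "msum Y (\<lambda>l. uvec A n i l \<odot>\<^bsub>Y\<^esub> y l) n = y i"
proof -
  interpret Y: amod A Y by (rule amod.intro) fact
  have "msum Y (\<lambda>l. uvec A n i l \<odot>\<^bsub>Y\<^esub> y l) n = msum Y (\<lambda>l. if l = i then y i else \<zero>\<^bsub>Y\<^esub>) n"
    by (rule msum_cong) (use assms in \<open>auto simp: uvec_def\<close>)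
  then show ?thesis using Y.msum_delta[of "y i" i n] assms by simp
qed

text \<open>Entries outside the ranks are zero because \<open>mat\<close> constrains all
  indices.\<close>

definition free_mat :: "'a ring \<Rightarrow> nat \<Rightarrow> nat \<Rightarrow> ((nat \<Rightarrow> 'a) \<Rightarrow> nat \<Rightarrow> 'a) \<Rightarrow> nat \<Rightarrow> nat \<Rightarrow> 'a"
  where "free_mat A m n d k l = (if k < m \<and> l < n then d (uvec A n l) k else \<zero>\<^bsub>A\<^esub>)"

lemma mat_free_mat:
  assumes "cring A" "lin A (free_mod A n) (free_mod A m) d"
  shows "mat A (free_mat A m n d)"
proof -
  interpret cring A by fact
  show ?thesis
    unfolding mat_def free_mat_def using lin_closed[OF assms(2), of "uvec A n _"] assms by auto
qed

lemma free_mat_eq: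
  assumes "cring A" "lin A (free_mod A n) (free_mod A m) d" "x \<in> carrier (free_mod A n)" "k < m"
  shows "d x k = mact (reg_mod A) n (free_mat A m n d) x k"
proof -
  interpret cring A by fact
  have "d x k = msum (reg_mod A) (\<lambda>l. x l \<otimes>\<^bsub>A\<^esub> d (uvec A n l) k) n"
    using lin_free_eq[OF module_free_mod[OF assms(1)] assms(2,3)] assms(4)
    by (simp add: free_mod_eq msum_pow_mod)
  also have "\<dots> = msum (reg_mod A) (\<lambda>l. d (uvec A n l) k \<otimes>\<^bsub>A\<^esub> x l) n"
  proof (rule msum_cong)
    fix l assume "l < n"
    have "d (uvec A n l) \<in> {..<m} \<rightarrow>\<^sub>E carrier A" using lin_closed[OF assms(2), of "uvec A n l"] assms(1) by simp
    then show "x l \<otimes>\<^bsub>A\<^esub> d (uvec A n l) k = d (uvec A n l) k \<otimes>\<^bsub>A\<^esub> x l"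
      using assms(3,4) \<open>l < n\<close> by (intro m_comm) auto
  qed
  finally show ?thesis unfolding mact_def by (auto simp: free_mat_def assms(4) intro: msum_cong)
qed

text \<open>A map out of a free module is its tuple of values on the unit vectors; on such tuples,
  precomposition with \<open>d\<close> is the transposed matrix. This is how Hom complexes become
  transposed matrix complexes.\<close>

lemma comp_free_mat:
  assumes "module A Y" "lin A (free_mod A n) (free_mod A m) d" "lin A (free_mod A m) Y f" "j < n"
  shows "f (d (uvec A n j)) = mact Y m (tr (free_mat A m n d)) (\<lambda>k. f (uvec A m k)) j"
proof -
  interpret Y: amod A Y by (rule amod.intro) fact
  have "d (uvec A n j) \<in> carrier (free_mod A m)" using lin_closed[OF assms(2)] Y.R.is_cring by simp
  from lin_free_eq[OF assms(1,3) this] show ?thesis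
    unfolding mact_def by (auto simp: tr_def free_mat_def assms(4) intro: msum_cong)
qed

section \<open>Injective modules\<close>

text \<open>This moves modules into the fixed type \<^typ>\<open>'a univ\<close> over which injectivity and
  projectivity quantify.\<close>

definition copy_mod :: "('m \<Rightarrow> 'n) \<Rightarrow> ('a, 'm) module \<Rightarrow> ('a, 'n) module"
  where "copy_mod h M =
    \<lparr>carrier = h ` carrier M, monoid.mult = undefined, monoid.one = undefined,
     ring.zero = h \<zero>\<^bsub>M\<^esub>,
     ring.add = (\<lambda>x y. h (inv_into UNIV h x \<oplus>\<^bsub>M\<^esub> inv_into UNIV h y)),
     smult = (\<lambda>a x. h (a \<odot>\<^bsub>M\<^esub> inv_into UNIV h x))\<rparr>"

lemma copy_mod_simps [simp]:
  "carrier (copy_mod h M) = h ` carrier M"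
  "\<zero>\<^bsub>copy_mod h M\<^esub> = h \<zero>\<^bsub>M\<^esub>"
  "x \<oplus>\<^bsub>copy_mod h M\<^esub> y = h (inv_into UNIV h x \<oplus>\<^bsub>M\<^esub> inv_into UNIV h y)"
  "a \<odot>\<^bsub>copy_mod h M\<^esub> x = h (a \<odot>\<^bsub>M\<^esub> inv_into UNIV h x)"
  by (simp_all add: copy_mod_def)

lemma module_copy_mod:
  fixes A :: "'a ring"
  assumes "module A M" "inj h"
  shows "module A (copy_mod h M)"
proof -
  interpret M: amod A M by (rule amod.intro) fact
  note [simp] = inv_f_f[OF assms(2)]
  show ?thesis
  proof (rule moduleI)
    show "abelian_group (copy_mod h M)"
    proof (rule abelian_groupI)
      fix x assume "x \<in> carrier (copy_mod h M)"
      then obtain y where y: "y \<in> carrier M" "x = h y" by auto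
      then show "\<exists>y\<in>carrier (copy_mod h M). y \<oplus>\<^bsub>copy_mod h M\<^esub> x = \<zero>\<^bsub>copy_mod h M\<^esub>"
        by (intro bexI[of _ "h (\<ominus>\<^bsub>M\<^esub> y)"]) (simp_all add: M.l_neg)
    qed (auto simp: M.a_assoc M.a_comm M.a_lcomm)
  qed (auto simp: M.smult_l_distr M.smult_r_distr M.smult_assoc1 M.R.is_cring)
qed

lemma lin_copy_mod: "inj h \<Longrightarrow> lin A M (copy_mod h M) h"
  by (rule linI) auto

lemma lin_inv_copy_mod: "inj h \<Longrightarrow> module A M \<Longrightarrow> lin A (copy_mod h M) M (inv_into UNIV h)"
  by (rule linI) auto

lemma lin_subset: "lin A M N f \<Longrightarrow> H \<subseteq> carrier M \<Longrightarrow> lin A (M\<lparr>carrier := H\<rparr>) N f"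
  by (auto simp: lin_def subset_iff)

lemma lin_codomain: "lin A M N f \<Longrightarrow> f ` carrier M \<subseteq> H \<Longrightarrow> lin A M (N\<lparr>carrier := H\<rparr>) f"
  by (auto simp: lin_def)

lemma lin_codomain': "lin A M (N\<lparr>carrier := H\<rparr>) f \<Longrightarrow> H \<subseteq> carrier N \<Longrightarrow> lin A M N f"
  by (auto simp: lin_def subset_iff)

text \<open>Injectivity is assumed for test modules on \<open>'a univ\<close> only; the inclusion of
  \<open>H\<close> in \<open>Z\<close> is transported there along \<open>h\<close>, extended, and
  transported back.\<close>

lemma injective_extend:
  fixes A :: "'a ring" and Z :: "('a, 'z) module" and h :: "'z \<Rightarrow> 'a univ"
  assumes "injective_mod A I" "inj h" "module A Z" "submodule H A Z" "lin A (Z\<lparr>carrier := H\<rparr>) I f"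
  obtains g where "lin A Z I g" "\<And>x. x \<in> H \<Longrightarrow> g x = f x"
proof -
  interpret Z: amod A Z by (rule amod.intro) fact
  note [simp] = inv_f_f[OF assms(2)]
  let ?Z = "copy_mod h Z" and ?Y = "copy_mod h (Z\<lparr>carrier := H\<rparr>)"
  have mH: "module A (Z\<lparr>carrier := H\<rparr>)" using assms(3,4) by (rule submodule_module)
  have mZ: "module A ?Z" and mY: "module A ?Y"
    using module_copy_mod[OF assms(3,2)] module_copy_mod[OF mH assms(2)] .
  have sub: "H \<subseteq> carrier Z" using Z.submoduleE(1)[OF assms(4)] .
  have "lin A ?Y ?Z (\<lambda>x. x)" using sub by (intro linI) auto
  then have "restrict (\<lambda>x. x) (carrier ?Y) \<in> mod_hom A ?Y ?Z"
    using mY by (rule lin_restrict)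
  moreover have "lin A ?Y I (\<lambda>x. f (inv_into UNIV h x))"
    using lin_comp[OF lin_inv_copy_mod[OF assms(2) mH] assms(5)] .
  then have "restrict (\<lambda>x. f (inv_into UNIV h x)) (carrier ?Y) \<in> mod_hom A ?Y I"
    using mY by (rule lin_restrict)
  moreover have "inj_on (restrict (\<lambda>x. x) (carrier ?Y)) (carrier ?Y)"
    by (auto intro: inj_onI)
  ultimately obtain l where l: "l \<in> mod_hom A ?Z I"
    "\<forall>y \<in> carrier ?Y. l (restrict (\<lambda>x. x) (carrier ?Y) y) = restrict (\<lambda>x. f (inv_into UNIV h x)) (carrier ?Y) y"
    using assms(1) mZ mY unfolding injective_mod_def by blast
  show thesis
  proof
    show "lin A Z I (\<lambda>x. l (h x))"
      using lin_comp[OF lin_copy_mod[OF assms(2)] mod_hom_lin[OF l(1)]] .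
    show "l (h x) = f x" if "x \<in> H" for x
      using l(2) that by auto
  qed
qed

text \<open>The homomorphism theorem, for a \<open>p\<close> that need not be onto: the target is
  cut down to the image, and \<open>q\<close> is evaluated at chosen preimages.\<close>

lemma lin_factor:
  fixes A :: "'a ring"
  assumes "module A M" "module A N" "module A L" "lin A M N p" "lin A M L q"
    and ker: "\<And>x. x \<in> carrier M \<Longrightarrow> p x = \<zero>\<^bsub>N\<^esub> \<Longrightarrow> q x = \<zero>\<^bsub>L\<^esub>"
  obtains f where "lin A (N\<lparr>carrier := p ` carrier M\<rparr>) L f" "\<And>x. x \<in> carrier M \<Longrightarrow> f (p x) = q x"
proof -
  interpret M: amod A M by (rule amod.intro) fact
  interpret N: amod A N by (rule amod.intro) fact
  interpret L: amod A L by (rule amod.intro) fact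
  define s where "s y = (SOME x. x \<in> carrier M \<and> p x = y)" for y
  have s: "s y \<in> carrier M \<and> p (s y) = y" if "y \<in> p ` carrier M" for y
    unfolding s_def using that by (intro someI_ex[of "\<lambda>x. x \<in> carrier M \<and> p x = y"]) auto
  have q: "q (s (p x)) = q x" if x: "x \<in> carrier M" for x
  proof -
    have sx: "s (p x) \<in> carrier M" "p (s (p x)) = p x" using s[of "p x"] x by auto
    have "q (s (p x) \<ominus>\<^bsub>M\<^esub> x) = \<zero>\<^bsub>L\<^esub>"
      using sx x lin_closed[OF assms(4) x]
      by (intro ker) (simp_all add: lin_minus[OF assms(1,2,4)])
    then have "q (s (p x)) \<ominus>\<^bsub>L\<^esub> q x = \<zero>\<^bsub>L\<^esub>"
      using sx x by (simp add: lin_minus[OF assms(1,3,5)])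
    then show ?thesis
      using L.minus_zero_iff lin_closed[OF assms(5)] sx x by simp
  qed
  show thesis
  proof
    show "q (s (p x)) = q x" if "x \<in> carrier M" for x using q[OF that] .
    show "lin A (N\<lparr>carrier := p ` carrier M\<rparr>) L (\<lambda>y. q (s y))"
    proof (rule linI)
      fix x assume "x \<in> carrier (N\<lparr>carrier := p ` carrier M\<rparr>)"
      then show "q (s x) \<in> carrier L" using s[of x] lin_closed[OF assms(5)] by auto
    next
      fix x y assume "x \<in> carrier (N\<lparr>carrier := p ` carrier M\<rparr>)" "y \<in> carrier (N\<lparr>carrier := p ` carrier M\<rparr>)"
      then obtain x' y' where "x' \<in> carrier M" "x = p x'" "y' \<in> carrier M" "y = p y'" by auto
      then show "q (s (x \<oplus>\<^bsub>N\<lparr>carrier := p ` carrier M\<rparr>\<^esub> y)) = q (s x) \<oplus>\<^bsub>L\<^esub> q (s y)"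
        using q by (simp add: lin_add[OF assms(4), symmetric] lin_add[OF assms(5)])
    next
      fix a x assume "a \<in> carrier A" "x \<in> carrier (N\<lparr>carrier := p ` carrier M\<rparr>)"
      then obtain x' where "a \<in> carrier A" "x' \<in> carrier M" "x = p x'" by auto
      then show "q (s (a \<odot>\<^bsub>N\<lparr>carrier := p ` carrier M\<rparr>\<^esub> x)) = a \<odot>\<^bsub>L\<^esub> q (s x)"
        using q by (simp add: lin_smult[OF assms(4), symmetric] lin_smult[OF assms(5)])
    qed
  qed
qed

lemma msum_hom_mod: "x \<in> carrier W \<Longrightarrow> msum (hom_mod A W Y) f n x = msum Y (\<lambda>l. f l x) n"
  by (induction n) auto

lemma mact_hom_mod: "x \<in> carrier W \<Longrightarrow> mact (hom_mod A W Y) n T f k x = mact Y n T (\<lambda>l. f l x) k"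
  by (simp add: mact_def msum_hom_mod)

definition single :: "('a, 'm) module \<Rightarrow> nat \<Rightarrow> nat \<Rightarrow> 'm \<Rightarrow> nat \<Rightarrow> 'm"
  where "single W n i w = (\<lambda>j\<in>{..<n}. if j = i then w else \<zero>\<^bsub>W\<^esub>)"

lemma lin_single:
  fixes A :: "'a ring"
  assumes "module A W"
  shows "lin A W (pow_mod n W) (single W n i)"
proof -
  interpret W: amod A W by (rule amod.intro) fact
  show ?thesis by (rule linI) (auto simp: single_def fun_eq_iff)
qed

lemma pow_mod_expand:
  fixes A :: "'a ring"
  assumes "module A W" "x \<in> carrier (pow_mod n W)"
  shows "x = msum (pow_mod n W) (\<lambda>i. single W n i (x i)) n"
proof (rule tuple_ext)
  interpret W: amod A W by (rule amod.intro) fact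
  interpret P: amod A "pow_mod n W" by (rule amod.intro[OF module_pow_mod]) fact
  have x: "x i \<in> carrier W" if "i < n" for i using assms(2) that by auto
  have "msum (pow_mod n W) (\<lambda>i. single W n i (x i)) n \<in> carrier (pow_mod n W)"
    by (rule P.msum_closed) (rule lin_closed[OF lin_single[OF assms(1)] x])
  then show "msum (pow_mod n W) (\<lambda>i. single W n i (x i)) n \<in> {..<n} \<rightarrow>\<^sub>E carrier W" by simp
  show "x \<in> {..<n} \<rightarrow>\<^sub>E carrier W" using assms(2) by simp
  fix i assume i: "i < n"
  have "msum (pow_mod n W) (\<lambda>i. single W n i (x i)) n i = msum W (\<lambda>l. if l = i then x i else \<zero>\<^bsub>W\<^esub>) n"
    unfolding msum_pow_mod[OF i] by (rule msum_cong) (use i in \<open>auto simp: single_def\<close>)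
  then show "x i = msum (pow_mod n W) (\<lambda>i. single W n i (x i)) n i"
    using W.msum_delta[OF x[OF i] i] by simp
qed

lemma lin_pow_mod_sum:
  fixes A :: "'a ring"
  assumes "module A W" "module A Y" "\<And>k. k < n \<Longrightarrow> lin A W Y (\<phi> k)"
  shows "lin A (pow_mod n W) Y (\<lambda>x. msum Y (\<lambda>k. \<phi> k (x k)) n)"
proof -
  interpret W: amod A W by (rule amod.intro) fact
  interpret Y: amod A Y by (rule amod.intro) fact
  have c: "\<phi> k (x k) \<in> carrier Y" if "x \<in> carrier (pow_mod n W)" "k < n" for k x
    using that lin_closed[OF assms(3)] by auto
  show ?thesis
  proof (rule linI)
    fix x y assume x: "x \<in> carrier (pow_mod n W)" "y \<in> carrier (pow_mod n W)"
    have "msum Y (\<lambda>k. \<phi> k ((x \<oplus>\<^bsub>pow_mod n W\<^esub> y) k)) n = msum Y (\<lambda>k. \<phi> k (x k) \<oplus>\<^bsub>Y\<^esub> \<phi> k (y k)) n"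
      by (rule msum_cong) (use x in \<open>auto intro!: lin_add[OF assms(3)]\<close>)
    then show "msum Y (\<lambda>k. \<phi> k ((x \<oplus>\<^bsub>pow_mod n W\<^esub> y) k)) n = msum Y (\<lambda>k. \<phi> k (x k)) n \<oplus>\<^bsub>Y\<^esub> msum Y (\<lambda>k. \<phi> k (y k)) n"
      using c[OF x(1)] c[OF x(2)] by (simp add: Y.msum_add)
  next
    fix a x assume x: "a \<in> carrier A" "x \<in> carrier (pow_mod n W)"
    have "msum Y (\<lambda>k. \<phi> k ((a \<odot>\<^bsub>pow_mod n W\<^esub> x) k)) n = msum Y (\<lambda>k. a \<odot>\<^bsub>Y\<^esub> \<phi> k (x k)) n"
      by (rule msum_cong) (use x in \<open>auto intro!: lin_smult[OF assms(3)]\<close>)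
    then show "msum Y (\<lambda>k. \<phi> k ((a \<odot>\<^bsub>pow_mod n W\<^esub> x) k)) n = a \<odot>\<^bsub>Y\<^esub> msum Y (\<lambda>k. \<phi> k (x k)) n"
      using c[OF x(2)] x(1) by (simp add: Y.msum_smult)
  qed (use c in \<open>auto intro: Y.msum_closed\<close>)
qed

lemma lin_mact_pow:
  fixes A :: "'a ring"
  assumes "module A W" "mat A T"
  shows "lin A (pow_mod n W) (pow_mod m W) (\<lambda>x. \<lambda>i\<in>{..<m}. mact W n T x i)"
proof -
  interpret W: amod A W by (rule amod.intro) fact
  have "lin A (pow_mod n W) W (\<lambda>x. mact W n T x i)" for i
    unfolding mact_def
    by (rule lin_pow_mod_sum[OF assms(1,1)], rule linI)
      (use assms(2) in \<open>auto simp: mat_def W.smult_r_distr W.smult_assoc1[symmetric] W.R.m_comm\<close>)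
  note l = this
  show ?thesis
  proof (rule linI)
    show "(\<lambda>i\<in>{..<m}. mact W n T x i) \<in> carrier (pow_mod m W)" if "x \<in> carrier (pow_mod n W)" for x
      using lin_closed[OF l that] by simp
    show "(\<lambda>i\<in>{..<m}. mact W n T (x \<oplus>\<^bsub>pow_mod n W\<^esub> y) i) =
        (\<lambda>i\<in>{..<m}. mact W n T x i) \<oplus>\<^bsub>pow_mod m W\<^esub> (\<lambda>i\<in>{..<m}. mact W n T y i)"
      if "x \<in> carrier (pow_mod n W)" "y \<in> carrier (pow_mod n W)" for x y
      using lin_add[OF l that] by (simp del: pow_mod_simps(3) add: fun_eq_iff) (simp add: fun_eq_iff)
    show "(\<lambda>i\<in>{..<m}. mact W n T (a \<odot>\<^bsub>pow_mod n W\<^esub> x) i) =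
        a \<odot>\<^bsub>pow_mod m W\<^esub> (\<lambda>i\<in>{..<m}. mact W n T x i)"
      if "a \<in> carrier A" "x \<in> carrier (pow_mod n W)" for a x
      using lin_smult[OF l that] by (simp del: pow_mod_simps(4) add: fun_eq_iff) (simp add: fun_eq_iff)
  qed
qed

text \<open>Exactness of Hom(-, I). A cocycle of maps \<phi> is one map on the \<open>b\<close>-th
  power of \<open>W\<close> that vanishes on the image of \<open>T\<close>, hence on the kernel of
  \<open>S\<close>. It therefore factors through the image of \<open>S\<close>, and injectivity
  extends the factor to the whole \<open>a\<close>-th power.\<close>

lemma exact_at_hom_injective:
  fixes A :: "'a ring" and W :: "('a, 'w) module" and h :: "(nat \<Rightarrow> 'w) \<Rightarrow> 'a univ"
  assumes "injective_mod A I" "inj h" "module A W" "mat A T" "mat A S"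
    and ex: "exact_at W c T b S a"
  shows "exact_at (hom_mod A W I) a (tr S) b (tr T) c"
proof (rule exact_atI)
  have mI: "module A I" using assms(1) by (simp add: injective_mod_def)
  interpret W: amod A W by (rule amod.intro) fact
  interpret I: amod A I by (rule amod.intro) fact
  fix \<phi> assume \<phi>: "\<And>k. \<phi> k \<in> carrier (hom_mod A W I)"
    and 0: "\<And>k. k < c \<Longrightarrow> mact (hom_mod A W I) b (tr T) \<phi> k = \<zero>\<^bsub>hom_mod A W I\<^esub>"
  have l\<phi>: "lin A W I (\<phi> k)" for k using \<phi>[of k] by (auto dest: mod_hom_lin)
  have 0: "msum I (\<lambda>k. T k l \<odot>\<^bsub>I\<^esub> \<phi> k w) b = \<zero>\<^bsub>I\<^esub>" if "l < c" "w \<in> carrier W" for l w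
    using fun_cong[OF 0[OF that(1)], of w] that mact_hom_mod[OF that(2), of A I b "tr T" \<phi> l]
    by (simp add: mact_def tr_def)
  let ?d = "\<lambda>x. \<lambda>i\<in>{..<a}. mact W b S x i" and ?q = "\<lambda>x. msum I (\<lambda>k. \<phi> k (x k)) b"
  let ?Wa = "pow_mod a W" and ?Wb = "pow_mod b W"
  have mWa: "module A ?Wa" and mWb: "module A ?Wb" using module_pow_mod[OF assms(3)] by auto
  have ld: "lin A ?Wb ?Wa ?d" using lin_mact_pow assms by blast
  have lq: "lin A ?Wb I ?q" by (rule lin_pow_mod_sum[OF assms(3) mI l\<phi>])
  \<comment> \<open>Exactness writes \<open>x\<close> as the image of \<open>z\<close> under
    \<open>T\<close>; after interchanging the two sums each inner sum is a cocycle condition on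
    \<phi>.\<close>
  have ker: "?q x = \<zero>\<^bsub>I\<^esub>" if x: "x \<in> carrier ?Wb" and dx: "?d x = \<zero>\<^bsub>?Wa\<^esub>" for x
  proof -
    let ?y = "\<lambda>i. if i < b then x i else \<zero>\<^bsub>W\<^esub>"
    have y: "?y i \<in> carrier W" for i using x by auto
    have "mact W b S ?y k = \<zero>\<^bsub>W\<^esub>" if "k < a" for k
    proof -
      have "mact W b S ?y k = mact W b S x k" by (rule mact_cong) simp
      also have "\<dots> = \<zero>\<^bsub>W\<^esub>" using fun_cong[OF dx, of k] that by simp
      finally show ?thesis .
    qed
    then obtain z where z: "\<And>k. z k \<in> carrier W" "\<And>k. k < b \<Longrightarrow> ?y k = mact W c T z k"
      using exact_atE[OF ex, of ?y] y by blast
    have "?q x = msum I (\<lambda>k. msum I (\<lambda>l. T k l \<odot>\<^bsub>I\<^esub> \<phi> k (z l)) c) b"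
    proof (rule msum_cong)
      fix k assume "k < b"
      then have "\<phi> k (x k) = \<phi> k (mact W c T z k)" using z(2)[of k] by simp
      also have "\<dots> = mact I c T (\<lambda>l. \<phi> k (z l)) k"
        by (rule lin_mact[OF assms(3) mI l\<phi> z(1) assms(4)])
      finally show "\<phi> k (x k) = msum I (\<lambda>l. T k l \<odot>\<^bsub>I\<^esub> \<phi> k (z l)) c" by (simp add: mact_def)
    qed
    also have "\<dots> = msum I (\<lambda>l. msum I (\<lambda>k. T k l \<odot>\<^bsub>I\<^esub> \<phi> k (z l)) b) c"
      by (rule I.msum_swap) (use assms(4) z lin_closed[OF l\<phi>] in \<open>auto simp: mat_def\<close>)
    also have "\<dots> = \<zero>\<^bsub>I\<^esub>" by (rule I.msum_zero) (use 0 z(1) in auto)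
    finally show ?thesis .
  qed
  obtain f where f: "lin A (?Wa\<lparr>carrier := ?d ` carrier ?Wb\<rparr>) I f"
    "\<And>x. x \<in> carrier ?Wb \<Longrightarrow> f (?d x) = ?q x"
    using lin_factor[OF mWb mWa mI ld lq ker] by blast
  have sm: "submodule (?d ` carrier ?Wb) A ?Wa"
    using lin_image_submodule[OF mWb mWa ld] module.carrier_is_submodule[OF mWb] by blast
  obtain g where g: "lin A ?Wa I g" "\<And>x. x \<in> ?d ` carrier ?Wb \<Longrightarrow> g x = f x"
    using injective_extend[OF assms(1,2) mWa sm f(1)] by blast
  \<comment> \<open>The components of the extended map \<open>g\<close> are the coefficients
    sought.\<close>
  define \<psi> where "\<psi> i = restrict (\<lambda>w. g (single W a i w)) (carrier W)" for i
  have \<psi>: "\<psi> i \<in> carrier (hom_mod A W I)" for i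
    using lin_restrict[OF lin_comp[OF lin_single[OF assms(3)] g(1)] assms(3)] by (simp add: \<psi>_def)
  interpret Hm: amod A "hom_mod A W I" by (rule amod.intro[OF module_hom_mod[OF assms(3) mI]])
  have "\<phi> k = mact (hom_mod A W I) a (tr S) \<psi> k" if k: "k < b" for k
  proof (rule mod_hom_ext)
    show "\<phi> k \<in> mod_hom A W I" using \<phi> by simp
    show "mact (hom_mod A W I) a (tr S) \<psi> k \<in> mod_hom A W I"
      using Hm.mact_closed[of "tr S" \<psi> a k] \<psi> assms(5) by simp
  next
    fix w assume w: "w \<in> carrier W"
    let ?x = "single W b k w"
    have x: "?x \<in> carrier ?Wb" using lin_closed[OF lin_single[OF assms(3)] w] .
    have dx: "?d ?x i = S i k \<odot>\<^bsub>W\<^esub> w" if "i < a" for i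
    proof -
      have "mact W b S ?x i = msum W (\<lambda>l. if l = k then S i k \<odot>\<^bsub>W\<^esub> w else \<zero>\<^bsub>W\<^esub>) b"
        unfolding mact_def by (rule msum_cong) (use assms(5) in \<open>auto simp: single_def mat_def\<close>)
      then show ?thesis using W.msum_delta[of "S i k \<odot>\<^bsub>W\<^esub> w" k b] w k assms(5) that by (simp add: mat_def)
    qed
    have "\<phi> k w = ?q ?x"
    proof -
      have "?q ?x = msum I (\<lambda>l. if l = k then \<phi> k w else \<zero>\<^bsub>I\<^esub>) b"
        by (rule msum_cong) (use lin_zero[OF assms(3) mI l\<phi>] in \<open>auto simp: single_def\<close>)
      then show ?thesis using I.msum_delta[of "\<phi> k w" k b] w k lin_closed[OF l\<phi>] by simp
    qed
    also have "\<dots> = g (?d ?x)" using f(2)[OF x] g(2)[of "?d ?x"] x by simp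
    also have "\<dots> = msum I (\<lambda>i. g (single W a i (?d ?x i))) a"
    proof -
      have d: "?d ?x \<in> carrier ?Wa" using lin_closed[OF ld x] .
      have "g (msum ?Wa (\<lambda>i. single W a i (?d ?x i)) a) = msum I (\<lambda>i. g (single W a i (?d ?x i))) a"
        by (rule lin_msum[OF mWa mI g(1)], rule lin_closed[OF lin_single[OF assms(3)]]) (use d in auto)
      then show ?thesis by (simp only: pow_mod_expand[OF assms(3) d, symmetric])
    qed
    also have "\<dots> = msum I (\<lambda>i. S i k \<odot>\<^bsub>I\<^esub> \<psi> i w) a"
    proof (rule msum_cong)
      fix i assume i: "i < a"
      have "g (single W a i (S i k \<odot>\<^bsub>W\<^esub> w)) = S i k \<odot>\<^bsub>I\<^esub> g (single W a i w)"
        by (rule lin_smult[OF lin_comp[OF lin_single[OF assms(3)] g(1)]]) (use w assms(5) in \<open>auto simp: mat_def\<close>)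
      then show "g (single W a i (?d ?x i)) = S i k \<odot>\<^bsub>I\<^esub> \<psi> i w"
        using dx[OF i] w by (simp add: \<psi>_def)
    qed
    also have "\<dots> = mact (hom_mod A W I) a (tr S) \<psi> k w"
      unfolding mact_hom_mod[OF w] by (simp add: mact_def tr_def)
    finally show "\<phi> k w = mact (hom_mod A W I) a (tr S) \<psi> k w" .
  qed
  with \<psi> show "\<exists>z. (\<forall>k. z k \<in> carrier (hom_mod A W I)) \<and> (\<forall>k<b. \<phi> k = mact (hom_mod A W I) a (tr S) z k)"
    by blast
qed

section \<open>Rings of finite injective dimension\<close>

lemma sesI:
  assumes "module A X" "module A Y" "module A Z" "lin A X Y i" "lin A Y Z p" "inj_on i (carrier X)"
    "p ` carrier Y = carrier Z" "i ` carrier X = {y \<in> carrier Y. p y = \<zero>\<^bsub>Z\<^esub>}"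
  shows "ses A X Y Z i p"
  using assms by (simp add: ses_def)

text \<open>Left exactness of Hom(W, -) always holds; surjectivity on the right is what
  \<open>lift\<close> supplies, in place of the vanishing of Ext in degree 1 from \<open>W\<close>
  to \<open>X\<close>.\<close>

lemma ses_hom:
  fixes A :: "'a ring"
  assumes ses: "ses A X Y Z i p" and "module A W"
    and lift: "\<And>f. lin A W Z f \<Longrightarrow> \<exists>g. lin A W Y g \<and> (\<forall>w \<in> carrier W. p (g w) = f w)"
  shows "ses A (hom_mod A W X) (hom_mod A W Y) (hom_mod A W Z)
    (\<lambda>f. \<lambda>w\<in>carrier W. i (f w)) (\<lambda>f. \<lambda>w\<in>carrier W. p (f w))"
proof -
  from ses have m: "module A X" "module A Y" "module A Z" and l: "lin A X Y i" "lin A Y Z p"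
    and inj: "inj_on i (carrier X)" and sur: "p ` carrier Y = carrier Z"
    and ker: "i ` carrier X = {y \<in> carrier Y. p y = \<zero>\<^bsub>Z\<^esub>}"
    by (auto simp: ses_def)
  interpret W: amod A W by (rule amod.intro) fact
  interpret X: amod A X by (rule amod.intro) fact
  interpret Y: amod A Y by (rule amod.intro) fact
  interpret Z: amod A Z by (rule amod.intro) fact
  have comp: "(\<lambda>w\<in>carrier W. j (f w)) \<in> mod_hom A W V" if "lin A U V j" "f \<in> mod_hom A W U"
    for U :: "('a, 'u) module" and V :: "('a, 'v) module" and j f
    using lin_restrict[OF lin_comp[OF mod_hom_lin[OF that(2)] that(1)] assms(2)] .
  show ?thesis
  proof (rule sesI)
    show "lin A (hom_mod A W X) (hom_mod A W Y) (\<lambda>f. \<lambda>w\<in>carrier W. i (f w))"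
      using comp[OF l(1)]
      by (intro linI) (auto simp: fun_eq_iff mod_hom_closed lin_add[OF l(1)] lin_smult[OF l(1)])
    show "lin A (hom_mod A W Y) (hom_mod A W Z) (\<lambda>f. \<lambda>w\<in>carrier W. p (f w))"
      using comp[OF l(2)]
      by (intro linI) (auto simp: fun_eq_iff mod_hom_closed lin_add[OF l(2)] lin_smult[OF l(2)])
    show "inj_on (\<lambda>f. \<lambda>w\<in>carrier W. i (f w)) (carrier (hom_mod A W X))"
    proof (rule inj_onI)
      fix f g assume fg: "f \<in> carrier (hom_mod A W X)" "g \<in> carrier (hom_mod A W X)"
        and eq: "(\<lambda>w\<in>carrier W. i (f w)) = (\<lambda>w\<in>carrier W. i (g w))"
      show "f = g"
      proof (rule mod_hom_ext)
        fix w assume w: "w \<in> carrier W"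
        have "i (f w) = i (g w)" using fun_cong[OF eq, of w] w by simp
        then show "f w = g w" using inj fg w by (auto simp: inj_on_def mod_hom_closed)
      qed (use fg in auto)
    qed
    show "(\<lambda>f. \<lambda>w\<in>carrier W. p (f w)) ` carrier (hom_mod A W Y) = carrier (hom_mod A W Z)"
    proof (intro equalityI subsetI)
      fix f assume "f \<in> carrier (hom_mod A W Z)"
      then have f: "f \<in> mod_hom A W Z" by simp
      obtain g where g: "lin A W Y g" "\<forall>w \<in> carrier W. p (g w) = f w"
        using lift[OF mod_hom_lin[OF f]] by blast
      have g': "restrict g (carrier W) \<in> mod_hom A W Y" using lin_restrict[OF g(1) assms(2)] .
      show "f \<in> (\<lambda>f. \<lambda>w\<in>carrier W. p (f w)) ` carrier (hom_mod A W Y)"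
      proof (rule image_eqI)
        show "f = (\<lambda>w\<in>carrier W. p (restrict g (carrier W) w))"
          by (rule mod_hom_ext[OF f comp[OF l(2) g']]) (use g(2) in simp)
      qed (simp only: g' hom_mod_simps)
    qed (use comp[OF l(2)] in auto)
    show "(\<lambda>f. \<lambda>w\<in>carrier W. i (f w)) ` carrier (hom_mod A W X)
      = {f \<in> carrier (hom_mod A W Y). (\<lambda>w\<in>carrier W. p (f w)) = \<zero>\<^bsub>hom_mod A W Z\<^esub>}"
    proof (intro equalityI subsetI)
      fix f assume "f \<in> (\<lambda>f. \<lambda>w\<in>carrier W. i (f w)) ` carrier (hom_mod A W X)"
      then obtain g where g: "g \<in> mod_hom A W X" "f = (\<lambda>w\<in>carrier W. i (g w))" by auto
      have "p (i (g w)) = \<zero>\<^bsub>Z\<^esub>" if "w \<in> carrier W" for w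
        using ker mod_hom_closed[OF g(1) that] by blast
      then show "f \<in> {f \<in> carrier (hom_mod A W Y). (\<lambda>w\<in>carrier W. p (f w)) = \<zero>\<^bsub>hom_mod A W Z\<^esub>}"
        using comp[OF l(1) g(1)] g(2) by (auto intro!: restrict_ext)
    next
      fix f assume "f \<in> {f \<in> carrier (hom_mod A W Y). (\<lambda>w\<in>carrier W. p (f w)) = \<zero>\<^bsub>hom_mod A W Z\<^esub>}"
      then have f: "f \<in> mod_hom A W Y" and 0: "(\<lambda>w\<in>carrier W. p (f w)) = (\<lambda>w\<in>carrier W. \<zero>\<^bsub>Z\<^esub>)" by auto
      have "f w \<in> i ` carrier X" if "w \<in> carrier W" for w
        using fun_cong[OF 0, of w] that mod_hom_closed[OF f that] unfolding ker by simp
      then have "\<forall>w \<in> carrier W. \<exists>x. x \<in> carrier X \<and> i x = f w" by force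
      from bchoice[OF this] obtain g where g: "\<And>w. w \<in> carrier W \<Longrightarrow> g w \<in> carrier X \<and> i (g w) = f w"
        by blast
      have ij: "x = y" if "i x = i y" "x \<in> carrier X" "y \<in> carrier X" for x y
        using inj that by (auto simp: inj_on_def)
      have "lin A W X g"
      proof (rule linI)
        show "g x \<in> carrier X" if "x \<in> carrier W" for x using g[OF that] by simp
        show "g (x \<oplus>\<^bsub>W\<^esub> y) = g x \<oplus>\<^bsub>X\<^esub> g y" if "x \<in> carrier W" "y \<in> carrier W" for x y
          by (rule ij) (use that g lin_add[OF l(1)] lin_add[OF mod_hom_lin[OF f]] in auto)
        show "g (a \<odot>\<^bsub>W\<^esub> x) = a \<odot>\<^bsub>X\<^esub> g x" if "a \<in> carrier A" "x \<in> carrier W" for a x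
          by (rule ij) (use that g lin_smult[OF l(1)] lin_smult[OF mod_hom_lin[OF f]] in auto)
      qed
      then have g': "restrict g (carrier W) \<in> mod_hom A W X" using assms(2) by (rule lin_restrict)
      show "f \<in> (\<lambda>f. \<lambda>w\<in>carrier W. i (f w)) ` carrier (hom_mod A W X)"
      proof (rule image_eqI)
        show "f = (\<lambda>w\<in>carrier W. i (restrict g (carrier W) w))"
          by (rule mod_hom_ext[OF f comp[OF l(1) g']]) (use g in simp)
      qed (simp only: g' hom_mod_simps)
    qed
  qed (use m assms(2) in \<open>auto intro: module_hom_mod\<close>)
qed

lemma exact_at_trivial:
  fixes A :: "'a ring"
  assumes "module A Y" "mat A S" "carrier Y = {\<zero>\<^bsub>Y\<^esub>}"
  shows "exact_at Y a S b T c"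
proof (rule exact_atI)
  interpret Y: amod A Y by (rule amod.intro) fact
  fix y :: "nat \<Rightarrow> _" assume y: "\<And>k. y k \<in> carrier Y"
  have "mact Y a S y k \<in> carrier Y" for k using assms(2) y by simp
  then show "\<exists>z. (\<forall>k. z k \<in> carrier Y) \<and> (\<forall>k<b. y k = mact Y a S z k)"
    using assms(3) y by (intro exI[of _ y]) auto
qed

text \<open>Evaluation at \<open>\<one>\<close> identifies Hom(A, Y) with \<open>Y\<close>. It lets
  a statement about Hom(W, -) be specialised to W = A.\<close>

lemma exact_at_hom_reg:
  fixes A :: "'a ring"
  assumes "module A Y" "mat A S" "mat A T"
  shows "exact_at (hom_mod A (reg_mod A) Y) a S b T c \<longleftrightarrow> exact_at Y a S b T c"
proof -
  interpret Y: amod A Y by (rule amod.intro) fact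
  have mR: "module A (reg_mod A)" using module_reg_mod Y.R.is_cring by blast
  let ?H = "hom_mod A (reg_mod A) Y"
  have l: "lin A ?H Y (\<lambda>f. f \<one>\<^bsub>A\<^esub>)" by (rule linI) (auto simp: mod_hom_closed)
  have eq: "f a = a \<odot>\<^bsub>Y\<^esub> f \<one>\<^bsub>A\<^esub>" if "f \<in> mod_hom A (reg_mod A) Y" "a \<in> carrier A" for f a
    using lin_smult[OF mod_hom_lin[OF that(1)] that(2), of "\<one>\<^bsub>A\<^esub>"] that(2) by simp
  have "bij_betw (\<lambda>f. f \<one>\<^bsub>A\<^esub>) (carrier ?H) (carrier Y)"
  proof (rule bij_betwI')
    fix f g assume fg: "f \<in> carrier ?H" "g \<in> carrier ?H"
    show "(f \<one>\<^bsub>A\<^esub> = g \<one>\<^bsub>A\<^esub>) = (f = g)"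
    proof
      assume 1: "f \<one>\<^bsub>A\<^esub> = g \<one>\<^bsub>A\<^esub>"
      show "f = g"
      proof (rule mod_hom_ext)
        fix a assume "a \<in> carrier (reg_mod A)"
        then show "f a = g a" using eq[of f a] eq[of g a] fg 1 by simp
      qed (use fg in auto)
    qed auto
  next
    fix f assume "f \<in> carrier ?H"
    then show "f \<one>\<^bsub>A\<^esub> \<in> carrier Y" using lin_closed[OF l] by blast
  next
    fix y assume y: "y \<in> carrier Y"
    have "lin A (reg_mod A) Y (\<lambda>a. a \<odot>\<^bsub>Y\<^esub> y)"
      by (rule linI) (use y in \<open>auto simp: Y.smult_l_distr Y.smult_assoc1\<close>)
    then have "restrict (\<lambda>a. a \<odot>\<^bsub>Y\<^esub> y) (carrier (reg_mod A)) \<in> carrier ?H"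
      using lin_restrict[OF _ mR] by simp
    then show "\<exists>f\<in>carrier ?H. y = f \<one>\<^bsub>A\<^esub>" using y by (intro bexI) auto
  qed
  from exact_at_iso[OF module_hom_mod[OF mR assms(1)] assms(1) l this assms(2,3)]
  show ?thesis .
qed

text \<open>The cosyzygies of the module resolved by \<open>I\<close>. The zeroth one is an
  isomorphic copy of that module, and each is the kernel of the map from \<open>I j\<close> onto the
  next.\<close>

definition cosyz :: "(nat \<Rightarrow> ('a, 'p) module) \<Rightarrow> (nat \<Rightarrow> 'p \<Rightarrow> 'p) \<Rightarrow> nat \<Rightarrow> ('a, 'p) module"
  where "cosyz I d j = (I j)\<lparr>carrier := a_kernel (I j) (I (Suc j)) (d j)\<rparr>"

text \<open>Differentials raise the degree: \<open>S i\<close> goes from rank \<open>b i\<close> to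
  rank \<open>b (i + 1)\<close>. Exactness is asked with coefficients in \<open>A\<close> only; for
  other modules it has to be proved.\<close>

definition acyclic_cx :: "'a ring \<Rightarrow> (int \<Rightarrow> nat) \<Rightarrow> (int \<Rightarrow> nat \<Rightarrow> nat \<Rightarrow> 'a) \<Rightarrow> bool"
  where "acyclic_cx A b S \<longleftrightarrow> (\<forall>i. mat A (S i)) \<and>
    (\<forall>i. zprod A (b (i + 2)) (S (i + 1)) (b (i + 1)) (S i) (b i)) \<and>
    (\<forall>i. exact_at (reg_mod A) (b i) (S i) (b (i + 1)) (S (i + 1)) (b (i + 2)))"

locale fin_inj_dim_ring = cring A for A :: "'a ring" (structure) +
  fixes I :: "nat \<Rightarrow> ('a, 'a univ) module" and d :: "nat \<Rightarrow> 'a univ \<Rightarrow> 'a univ" and e :: "'a \<Rightarrow> 'a univ"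
    and n :: nat
  assumes resolution: "right_resolution A (reg_mod A) I d e"
    and injective: "injective_mod A (I i)"
    and trivial: "i > n \<Longrightarrow> zero_mod (I i)"
begin

lemma module_I: "module A (I j)"
  and lin_d: "lin A (I j) (I (Suc j)) (d j)"
  and lin_e: "lin A (reg_mod A) (I 0) e"
  using resolution by (auto simp: right_resolution_def mod_hom_lin)

lemma module_reg: "module A (reg_mod A)"
  using module_reg_mod is_cring by blast

lemma submodule_ker_d: "submodule (a_kernel (I j) (I (Suc j)) (d j)) A (I j)"
  unfolding a_kernel_def' using lin_ker_submodule[OF module_I module_I lin_d] .

lemma module_cosyz: "module A (cosyz I d j)"
  unfolding cosyz_def using submodule_module[OF module_I submodule_ker_d] .

lemma carrier_cosyz: "x \<in> carrier (cosyz I d j) \<longleftrightarrow> x \<in> carrier (I j) \<and> d j x = \<zero>\<^bsub>I (Suc j)\<^esub>"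
  by (simp add: cosyz_def a_kernel_def')

lemma cosyz_simps: "\<zero>\<^bsub>cosyz I d j\<^esub> = \<zero>\<^bsub>I j\<^esub>" "x \<oplus>\<^bsub>cosyz I d j\<^esub> y = x \<oplus>\<^bsub>I j\<^esub> y"
  "a \<odot>\<^bsub>cosyz I d j\<^esub> x = a \<odot>\<^bsub>I j\<^esub> x" "mact (cosyz I d j) m T z k = mact (I j) m T z k"
  "msum (cosyz I d j) f m = msum (I j) f m"
  by (simp_all add: cosyz_def)

lemma ses_cosyz: "ses A (cosyz I d j) (I j) (cosyz I d (Suc j)) (\<lambda>x. x) (d j)"
proof (rule sesI)
  have im: "d j ` carrier (I j) = carrier (cosyz I d (Suc j))"
    using resolution by (simp add: right_resolution_def cosyz_def)
  then show "d j ` carrier (I j) = carrier (cosyz I d (Suc j))" .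
  show "lin A (cosyz I d j) (I j) (\<lambda>x. x)"
    by (rule linI) (auto simp: carrier_cosyz cosyz_simps)
  show "lin A (I j) (cosyz I d (Suc j)) (d j)"
    using lin_d[of j] im by (auto simp: lin_def cosyz_simps)
  show "(\<lambda>x. x) ` carrier (cosyz I d j) = {y \<in> carrier (I j). d j y = \<zero>\<^bsub>cosyz I d (Suc j)\<^esub>}"
    by (auto simp: carrier_cosyz cosyz_simps)
qed (auto simp: module_I module_cosyz)

lemma reg_cosyz: "lin A (reg_mod A) (cosyz I d 0) e" "bij_betw e (carrier (reg_mod A)) (carrier (cosyz I d 0))"
proof -
  have "inj_on e (carrier (reg_mod A))" "e ` carrier (reg_mod A) = carrier (cosyz I d 0)"
    using resolution by (auto simp: right_resolution_def cosyz_def)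
  then show "bij_betw e (carrier (reg_mod A)) (carrier (cosyz I d 0))" by (simp add: bij_betw_def)
  then show "lin A (reg_mod A) (cosyz I d 0) e"
    using lin_e bij_betwE[of e] by (auto simp: lin_def cosyz_simps)
qed

lemma trivial_cosyz: "j > n \<Longrightarrow> carrier (cosyz I d j) = {\<zero>\<^bsub>cosyz I d j\<^esub>}"
  using trivial[of j] module.submoduleE(1)[OF module_I submodule_ker_d[of j]]
    amod.submodule_zero[OF amod.intro[OF module_I] submodule_ker_d[of j]]
  by (auto simp: zero_mod_def cosyz_def)

text \<open>Dimension shifting in the coefficients: Hom into \<open>I j\<close> turns the exact
  complex over \<open>W\<close> into an exact one, so exactness for a cosyzygy follows from
  exactness for the next cosyzygy one spot earlier. After \<open>k\<close> shifts the cosyzygy is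
  zero.\<close>

lemma exact_hom_cosyz:
  fixes W :: "('a, 'w) module" and h :: "(nat \<Rightarrow> 'w) \<Rightarrow> 'a univ"
  assumes "inj h" "module A W"
    and lift: "\<And>j f. lin A W (cosyz I d (Suc j)) f \<Longrightarrow>
        \<exists>g. lin A W (I j) g \<and> (\<forall>w \<in> carrier W. d j (g w) = f w)"
    and E: "\<And>s. mat A (E s)"
    and z: "\<And>s. zprod_res A c E s"
    and ex: "\<And>s. exact_res W c E s"
  shows "j + k > n \<Longrightarrow> s \<ge> k \<Longrightarrow>
    exact_dual (hom_mod A W (cosyz I d j)) c E s"
proof (induction k arbitrary: j s)
  case 0
  have j: "carrier (cosyz I d j) = {\<zero>\<^bsub>cosyz I d j\<^esub>}" using 0 trivial_cosyz by simp
  interpret H: amod A "hom_mod A W (cosyz I d j)"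
    by (rule amod.intro[OF module_hom_mod[OF assms(2) module_cosyz]])
  have "carrier (hom_mod A W (cosyz I d j)) = {\<zero>\<^bsub>hom_mod A W (cosyz I d j)\<^esub>}"
  proof -
    have "f = \<zero>\<^bsub>hom_mod A W (cosyz I d j)\<^esub>" if "f \<in> mod_hom A W (cosyz I d j)" for f
      by (rule mod_hom_ext[OF that]) (use H.zero_closed mod_hom_closed[OF that] j in auto)
    then show ?thesis using H.zero_closed unfolding hom_mod_simps(1) by blast
  qed
  then show ?case
    by (intro exact_at_trivial[OF H.module_axioms]) (use E in auto)
next
  case (Suc k)
  \<comment> \<open>The bound on \<open>s\<close> leaves room for one shift to the left; this is why
    the number of shifts limits the degree from below.\<close>
  then obtain s' where s: "s = Suc s'" "s' \<ge> k" by (cases s) auto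
  have "exact_at (hom_mod A W (cosyz I d (Suc j))) (c s') (tr (E s')) (c (Suc s')) (tr (E (Suc s'))) (c (Suc (Suc s')))"
    using Suc s by simp
  moreover have "exact_at (hom_mod A W (I j)) (c (Suc s')) (tr (E (Suc s'))) (c (Suc (Suc s')))
      (tr (E (Suc (Suc s')))) (c (Suc (Suc (Suc s'))))"
    by (rule exact_at_hom_injective[OF injective assms(1,2) E E ex])
  ultimately show ?case unfolding s(1)
    using ses_exact_left[OF ses_hom[OF ses_cosyz assms(2) lift]] E z zprod_tr[OF is_cring E E]
    by (metis mat_tr)
qed

lemma exact_cosyz:
  assumes E: "\<And>s. mat A (E s)"
    and z: "\<And>s. zprod_res A c E s"
    and ex: "\<And>s. exact_res (reg_mod A) c E s"
    and "s > n"
  shows "exact_dual (cosyz I d j) c E s"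
proof -
  have h: "inj (\<lambda>x :: nat \<Rightarrow> 'a. {x})" by (auto intro: injI)
  have lift: "\<exists>g. lin A (reg_mod A) (I j) g \<and> (\<forall>w \<in> carrier (reg_mod A). d j (g w) = f w)"
    if f: "lin A (reg_mod A) (cosyz I d (Suc j)) f" for j f
  proof -
    interpret I: amod A "I j" by (rule amod.intro[OF module_I])
    have "f \<one> \<in> d j ` carrier (I j)"
      using ses_cosyz[of j] lin_closed[OF f, of "\<one>"] by (simp add: ses_def)
    then obtain y where y: "y \<in> carrier (I j)" "d j y = f \<one>" by auto
    have "lin A (reg_mod A) (I j) (\<lambda>a. a \<odot>\<^bsub>I j\<^esub> y)"
      by (rule linI) (use y in \<open>auto simp: I.smult_l_distr I.smult_assoc1\<close>)
    moreover have "d j (a \<odot>\<^bsub>I j\<^esub> y) = f a" if "a \<in> carrier A" for a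
      using lin_smult[OF lin_d that y(1)] y(2) lin_smult[OF f that, of "\<one>"] that
      by (simp add: cosyz_simps)
    ultimately show ?thesis by auto
  qed
  have "exact_dual (hom_mod A (reg_mod A) (cosyz I d j)) c E s"
    \<comment> \<open>The choice of \<open>s\<close> for the number of shifts meets both bounds for
      every \<open>j\<close>, because \<open>s > n\<close>.\<close>
    by (rule exact_hom_cosyz[where k = s and E = E and c = c, OF h module_reg lift E z ex]) (use assms(4) in auto)
  then show ?thesis using exact_at_hom_reg[OF module_cosyz] E by simp
qed

lemma exact_at_reg_cosyz:
  "mat A S \<Longrightarrow> mat A T \<Longrightarrow> exact_at (reg_mod A) p S q T r \<longleftrightarrow> exact_at (cosyz I d 0) p S q T r"
  by (rule exact_at_iso[OF module_reg module_cosyz reg_cosyz])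

text \<open>Read downwards from any degree, the complex is a free resolution, and its dual is exact
  sufficiently far along that resolution. As the starting degree is free, every degree of the
  complex is sufficiently far from some start.\<close>

lemma acyclic_cx_cosyz:
  assumes "acyclic_cx A b S"
  shows "exact_at (cosyz I d j) (b (i + 2)) (tr (S (i + 1))) (b (i + 1)) (tr (S i)) (b i)"
proof -
  \<comment> \<open>With this start, position \<open>Suc n\<close> of the resolution is the
    differential \<open>S (i + 1)\<close>, and \<open>Suc n\<close> is the first position where
    \<open>exact_cosyz\<close> applies.\<close>
  define q where "q = i + 2 + int n"
  have a: "mat A (S i)" "zprod A (b (i + 2)) (S (i + 1)) (b (i + 1)) (S i) (b i)"
    "exact_at (reg_mod A) (b i) (S i) (b (i + 1)) (S (i + 1)) (b (i + 2))" for i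
    using assms by (auto simp: acyclic_cx_def)
  have "exact_at (cosyz I d j) (b (q - int (Suc n) + 1)) (tr (S (q - int (Suc n)))) (b (q - int (Suc (Suc n)) + 1))
     (tr (S (q - int (Suc (Suc n))))) (b (q - int (Suc (Suc (Suc n))) + 1))"
  proof (rule exact_cosyz)
    fix s
    show "mat A (S (q - int s))" using a(1) .
    show "zprod A (b (q - int s + 1)) (S (q - int s)) (b (q - int (Suc s) + 1)) (S (q - int (Suc s))) (b (q - int (Suc (Suc s)) + 1))"
      using a(2)[of "q - int s - 1"] by (simp add: algebra_simps)
    show "exact_at (reg_mod A) (b (q - int (Suc (Suc s)) + 1)) (S (q - int (Suc s))) (b (q - int (Suc s) + 1)) (S (q - int s)) (b (q - int s + 1))"
      using a(3)[of "q - int s - 1"] by (simp add: algebra_simps)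
  qed simp
  moreover have "q - int (Suc n) = i + 1" "q - int (Suc (Suc n)) = i" "q - int (Suc (Suc (Suc n))) = i - 1"
    by (simp_all add: q_def)
  ultimately show ?thesis by (simp add: algebra_simps)
qed

end

section \<open>Complexes of free modules with exact dual\<close>

text \<open>Adjointness of a matrix and its transpose, for scalars paired with elements of a module.
  It moves a differential from one argument of a pairing to the other.\<close>

lemma (in amod) pairing:
  assumes "mat A T" "\<And>l. l < n \<Longrightarrow> v l \<in> carrier A" "\<And>k. k < m \<Longrightarrow> y k \<in> carrier M"
  shows "msum M (\<lambda>k. mact (reg_mod A) n T v k \<odot>\<^bsub>M\<^esub> y k) m = msum M (\<lambda>l. v l \<odot>\<^bsub>M\<^esub> mact M m (tr T) y l) n"
proof -
  have "msum M (\<lambda>k. mact (reg_mod A) n T v k \<odot>\<^bsub>M\<^esub> y k) m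
      = msum M (\<lambda>k. msum M (\<lambda>l. (T k l \<otimes> v l) \<odot>\<^bsub>M\<^esub> y k) n) m"
    by (rule msum_cong) (use assms in \<open>simp add: mact_def mat_def msum_smult_left\<close>)
  also have "\<dots> = msum M (\<lambda>l. msum M (\<lambda>k. (T k l \<otimes> v l) \<odot>\<^bsub>M\<^esub> y k) m) n"
    by (rule msum_swap) (use assms in \<open>simp add: mat_def\<close>)
  also have "\<dots> = msum M (\<lambda>l. v l \<odot>\<^bsub>M\<^esub> mact M m (tr T) y l) n"
  proof (rule msum_cong)
    fix l assume l: "l < n"
    have "msum M (\<lambda>k. (T k l \<otimes> v l) \<odot>\<^bsub>M\<^esub> y k) m = msum M (\<lambda>k. v l \<odot>\<^bsub>M\<^esub> (T k l \<odot>\<^bsub>M\<^esub> y k)) m"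
      by (rule msum_cong) (use assms l in \<open>simp add: mat_def smult_assoc1[symmetric] R.m_comm\<close>)
    then show "msum M (\<lambda>k. (T k l \<otimes> v l) \<odot>\<^bsub>M\<^esub> y k) m = v l \<odot>\<^bsub>M\<^esub> mact M m (tr T) y l"
      using assms l by (simp add: mact_def tr_def mat_def msum_smult)
  qed
  finally show ?thesis .
qed

text \<open>\<open>mact\<close> returns a total function; restricting it makes the result an element
  of \<open>free_mod A m\<close>.\<close>

definition matmap :: "'a ring \<Rightarrow> nat \<Rightarrow> nat \<Rightarrow> (nat \<Rightarrow> nat \<Rightarrow> 'a) \<Rightarrow> (nat \<Rightarrow> 'a) \<Rightarrow> nat \<Rightarrow> 'a"
  where "matmap A m n T v = (\<lambda>k\<in>{..<m}. mact (reg_mod A) n T v k)"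

lemma lin_matmap:
  fixes A :: "'a ring"
  assumes "cring A" "mat A T"
  shows "lin A (free_mod A n) (free_mod A m) (matmap A m n T)"
  using lin_mact_pow[OF module_reg_mod[OF assms(1)] assms(2), of n m]
  unfolding free_mod_eq matmap_def[abs_def] .

lemma mact_reg_uvec:
  fixes A :: "'a ring"
  assumes "cring A" "mat A T" "j < n"
  shows "mact (reg_mod A) n T (uvec A n j) k = T k j"
proof -
  interpret cring A by fact
  have "mact (reg_mod A) n T (uvec A n j) k = msum (reg_mod A) (\<lambda>l. uvec A n j l \<odot>\<^bsub>reg_mod A\<^esub> T k l) n"
    unfolding mact_def by (rule msum_cong) (use assms in \<open>auto simp: uvec_def mat_def\<close>)
  also have "\<dots> = T k j"
    by (rule of_tuple_uvec) (use assms module_reg_mod in \<open>auto simp: mat_def\<close>)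
  finally show ?thesis .
qed

lemma zprod_matmap:
  fixes A :: "'a ring"
  assumes "cring A" "mat A S" "mat A T" "zprod A c T b S a" "v \<in> carrier (free_mod A a)" "k < c"
  shows "mact (reg_mod A) b T (matmap A b a S v) k = \<zero>\<^bsub>A\<^esub>"
proof -
  interpret cring A by fact
  interpret R: amod A "reg_mod A" by (rule amod.intro[OF module_reg_mod]) fact
  let ?v = "\<lambda>l. if l < a then v l else \<zero>\<^bsub>A\<^esub>"
  have "mact (reg_mod A) b T (matmap A b a S v) k = mact (reg_mod A) b T (mact (reg_mod A) a S ?v) k"
    by (rule mact_cong) (auto simp: matmap_def intro!: mact_cong)
  also have "\<dots> = \<zero>\<^bsub>reg_mod A\<^esub>"
    by (rule R.mact_zprod) (use assms in auto)
  finally show ?thesis by simp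
qed

lemma mact_tr_lin:
  fixes A :: "'a ring"
  assumes "module A Y" "mat A T" "lin A (free_mod A n) Y f" "j < m"
  shows "mact Y n (tr T) (\<lambda>k. f (uvec A n k)) j = f (matmap A n m T (uvec A m j))"
proof -
  interpret Y: amod A Y by (rule amod.intro) fact
  have "matmap A n m T (uvec A m j) \<in> carrier (free_mod A n)"
    using lin_closed[OF lin_matmap[OF Y.R.is_cring assms(2)]] Y.R.is_cring by simp
  from lin_free_eq[OF assms(1,3) this] show ?thesis
    unfolding mact_def
    by (auto simp: tr_def matmap_def mact_def[symmetric] mact_reg_uvec[OF Y.R.is_cring assms(2,4)] intro!: msum_cong)
qed

lemma exact_at_free:
  fixes A :: "'a ring"
  assumes "cring A" "exact_at (reg_mod A) a S b T c" "x \<in> carrier (free_mod A b)"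
    "\<And>k. k < c \<Longrightarrow> mact (reg_mod A) b T x k = \<zero>\<^bsub>A\<^esub>"
  obtains v where "v \<in> carrier (free_mod A a)" "x = matmap A b a S v"
proof -
  interpret cring A by fact
  let ?x = "\<lambda>l. if l < b then x l else \<zero>\<^bsub>A\<^esub>"
  have "mact (reg_mod A) b T ?x k = mact (reg_mod A) b T x k" for k
    by (rule mact_cong) simp
  then have 0: "mact (reg_mod A) b T ?x k = \<zero>\<^bsub>reg_mod A\<^esub>" if "k < c" for k
    using assms(4) that by simp
  have "?x k \<in> carrier (reg_mod A)" for k using assms(3) by auto
  from exact_atE[OF assms(2) this 0]
  obtain z where z: "\<And>k. z k \<in> carrier A" "\<And>k. k < b \<Longrightarrow> ?x k = mact (reg_mod A) a S z k"
    by (metis reg_mod_simps(1))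
  show thesis
  proof
    show "restrict z {..<a} \<in> carrier (free_mod A a)" using z(1) by simp
    have "mact (reg_mod A) a S (restrict z {..<a}) k = mact (reg_mod A) a S z k" for k
      by (rule mact_cong) simp
    then have "x k = matmap A b a S (restrict z {..<a}) k" if "k < b" for k
      using z(2)[OF that] that by (simp add: matmap_def)
    moreover have "matmap A b a S (restrict z {..<a}) \<in> {..<b} \<rightarrow>\<^sub>E UNIV" by (simp add: matmap_def)
    ultimately show "x = matmap A b a S (restrict z {..<a})"
      using assms(3) by (intro tuple_ext) auto
  qed
qed

text \<open>By exactness the image of \<open>T\<close> is the cokernel of \<open>S\<close>, so a map
  out of it is a tuple \<open>y\<close> satisfying the relations given by the columns of
  \<open>S\<close>.\<close>

lemma hom_of_relations:
  fixes A :: "'a ring"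
  assumes "module A Y" "mat A S" "mat A T" "exact_at (reg_mod A) a S b T c"
    and y: "\<And>l. y l \<in> carrier Y" "\<And>m. m < a \<Longrightarrow> mact Y b (tr S) y m = \<zero>\<^bsub>Y\<^esub>"
  obtains g where "lin A ((free_mod A c)\<lparr>carrier := matmap A c b T ` carrier (free_mod A b)\<rparr>) Y g"
    "\<And>v. v \<in> carrier (free_mod A b) \<Longrightarrow> g (matmap A c b T v) = msum Y (\<lambda>l. v l \<odot>\<^bsub>Y\<^esub> y l) b"
proof -
  interpret Y: amod A Y by (rule amod.intro) fact
  note cr = Y.R.is_cring
  have ker: "msum Y (\<lambda>l. v l \<odot>\<^bsub>Y\<^esub> y l) b = \<zero>\<^bsub>Y\<^esub>"
    if v: "v \<in> carrier (free_mod A b)" and 0: "matmap A c b T v = \<zero>\<^bsub>free_mod A c\<^esub>" for v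
  proof -
    have "mact (reg_mod A) b T v k = \<zero>\<^bsub>A\<^esub>" if "k < c" for k
      using fun_cong[OF 0, of k] that by (simp add: matmap_def)
    then obtain u where u: "u \<in> carrier (free_mod A a)" "v = matmap A b a S u"
      using exact_at_free[OF cr assms(4) v] by blast
    have "msum Y (\<lambda>l. v l \<odot>\<^bsub>Y\<^esub> y l) b = msum Y (\<lambda>l. mact (reg_mod A) a S u l \<odot>\<^bsub>Y\<^esub> y l) b"
      by (rule msum_cong) (simp add: u(2) matmap_def)
    also have "\<dots> = msum Y (\<lambda>m. u m \<odot>\<^bsub>Y\<^esub> mact Y b (tr S) y m) a"
      by (rule Y.pairing) (use assms(2) u(1) y in auto)
    also have "\<dots> = \<zero>\<^bsub>Y\<^esub>"
      by (rule Y.msum_zero) (use y(2) u(1) in \<open>simp add: PiE_closed\<close>)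
    finally show ?thesis .
  qed
  show thesis
    using lin_factor[OF module_free_mod[OF cr] module_free_mod[OF cr] assms(1) lin_matmap[OF cr assms(3)]
      lin_of_tuple[OF assms(1) y(1)] ker] that by blast
qed

locale acyclic_complex = fin_inj_dim_ring A I d e n for A :: "'a ring" (structure) and I d e n +
  fixes b :: "int \<Rightarrow> nat" and S :: "int \<Rightarrow> nat \<Rightarrow> nat \<Rightarrow> 'a"
  assumes acyclic: "acyclic_cx A b S"
begin

abbreviation S_map :: "int \<Rightarrow> (nat \<Rightarrow> 'a) \<Rightarrow> nat \<Rightarrow> 'a"
  where "S_map i \<equiv> matmap A (b (i + 1)) (b i) (S i)"

text \<open>The module W of the overview, as an image: it is the kernel of \<open>S (i + 1)\<close>
  and, equally, the cokernel of \<open>S (i - 1)\<close>. Both descriptions are used.\<close>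

definition im_mod :: "int \<Rightarrow> ('a, nat \<Rightarrow> 'a) module"
  where "im_mod i = (free_mod A (b (i + 1)))\<lparr>carrier := S_map i ` carrier (free_mod A (b i))\<rparr>"

lemma mat_S: "mat A (S i)"
  and zprod_S: "zprod A (b (i + 2)) (S (i + 1)) (b (i + 1)) (S i) (b i)"
  and exact_S: "exact_at (reg_mod A) (b i) (S i) (b (i + 1)) (S (i + 1)) (b (i + 2))"
  using acyclic by (auto simp: acyclic_cx_def)

lemma zprod_S': "zprod A (b (i + 1)) (S i) (b i) (S (i - 1)) (b (i - 1))"
  using zprod_S[of "i - 1"] by (simp add: algebra_simps)

lemma exact_S': "exact_at (reg_mod A) (b (i - 1)) (S (i - 1)) (b i) (S i) (b (i + 1))"
  using exact_S[of "i - 1"] by (simp add: algebra_simps)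

lemma dual_exact: "exact_at (cosyz I d j) (b (i + 1)) (tr (S i)) (b i) (tr (S (i - 1))) (b (i - 1))"
  using acyclic_cx_cosyz[OF acyclic, of j "i - 1"] by (simp add: algebra_simps)

lemma module_free: "module A (free_mod A m)"
  using module_free_mod is_cring by blast

lemma lin_S: "lin A (free_mod A (b i)) (free_mod A (b (i + 1))) (S_map i)"
  using lin_matmap[OF is_cring mat_S] .

lemma submodule_im: "submodule (S_map i ` carrier (free_mod A (b i))) A (free_mod A (b (i + 1)))"
  using lin_image_submodule[OF module_free module_free lin_S] module.carrier_is_submodule[OF module_free] by blast

lemma module_im: "module A (im_mod i)"
  unfolding im_mod_def using submodule_module[OF module_free submodule_im] .

lemma im_mod_simps [simp]: "\<zero>\<^bsub>im_mod i\<^esub> = \<zero>\<^bsub>free_mod A (b (i + 1))\<^esub>"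
  "x \<oplus>\<^bsub>im_mod i\<^esub> y = x \<oplus>\<^bsub>free_mod A (b (i + 1))\<^esub> y"
  "a \<odot>\<^bsub>im_mod i\<^esub> x = a \<odot>\<^bsub>free_mod A (b (i + 1))\<^esub> x"
  "mact (im_mod i) m T z k = mact (free_mod A (b (i + 1))) m T z k"
  by (simp_all add: im_mod_def)

lemma im_mod_carrier: "carrier (im_mod i) = S_map i ` carrier (free_mod A (b i))"
  by (simp add: im_mod_def)

lemma im_mod_iff: "w \<in> carrier (im_mod i) \<longleftrightarrow> w \<in> carrier (free_mod A (b (i + 1))) \<and>
    (\<forall>k < b (i + 2). mact (reg_mod A) (b (i + 1)) (S (i + 1)) w k = \<zero>)"
proof (intro iffI conjI allI impI)
  assume "w \<in> carrier (im_mod i)"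
  then obtain v where v: "v \<in> carrier (free_mod A (b i))" "w = S_map i v"
    by (auto simp: im_mod_carrier)
  then show "w \<in> carrier (free_mod A (b (i + 1)))" using lin_closed[OF lin_S] by blast
  show "mact (reg_mod A) (b (i + 1)) (S (i + 1)) w k = \<zero>" if "k < b (i + 2)" for k
    unfolding v(2) by (rule zprod_matmap[OF is_cring mat_S mat_S zprod_S v(1) that])
next
  assume w: "w \<in> carrier (free_mod A (b (i + 1))) \<and>
    (\<forall>k < b (i + 2). mact (reg_mod A) (b (i + 1)) (S (i + 1)) w k = \<zero>)"
  then obtain v where "v \<in> carrier (free_mod A (b i))" "w = S_map i v"
    using exact_at_free[OF is_cring exact_S] by metis
  then show "w \<in> carrier (im_mod i)" by (simp add: im_mod_carrier)
qed

lemma lin_im: "lin A (free_mod A (b i)) (im_mod i) (S_map i)"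
  unfolding im_mod_def using lin_codomain[OF lin_S] by blast

lemma matmap_matmap: "v \<in> carrier (free_mod A (b (i - 1))) \<Longrightarrow>
    S_map i (matmap A (b i) (b (i - 1)) (S (i - 1)) v) = \<zero>\<^bsub>free_mod A (b (i + 1))\<^esub>"
  using zprod_matmap[OF is_cring mat_S mat_S zprod_S'] by (auto simp: matmap_def fun_eq_iff)

lemma hom_im_relation:
  assumes "module A Y" "lin A (im_mod i) Y f" "m < b (i - 1)"
  shows "mact Y (b i) (tr (S (i - 1))) (\<lambda>l. f (S_map i (uvec A (b i) l))) m = \<zero>\<^bsub>Y\<^esub>"
proof -
  have "mact Y (b i) (tr (S (i - 1))) (\<lambda>l. f (S_map i (uvec A (b i) l))) m
      = f (S_map i (matmap A (b i) (b (i - 1)) (S (i - 1)) (uvec A (b (i - 1)) m)))"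
    by (rule mact_tr_lin[OF assms(1) mat_S lin_comp[OF lin_im assms(2)] assms(3)])
  also have "\<dots> = f \<zero>\<^bsub>im_mod i\<^esub>"
    using is_cring by (subst matmap_matmap) simp_all
  finally show ?thesis using lin_zero[OF module_im assms(1,2)] by simp
qed

lemma hom_im_expand:
  assumes "module A Y" "lin A (im_mod i) Y f" "v \<in> carrier (free_mod A (b i))"
  shows "f (S_map i v)
    = msum Y (\<lambda>l. v l \<odot>\<^bsub>Y\<^esub> f (S_map i (uvec A (b i) l))) (b i)"
  by (rule lin_free_eq[OF assms(1) lin_comp[OF lin_im assms(2)] assms(3)])

text \<open>This says that Ext in degree 1 from the image module to \<open>cosyz I d j\<close>
  vanishes. A map is given by a tuple \<open>y\<close> satisfying the relations; an arbitrary lift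
  of \<open>y\<close> to \<open>I j\<close> violates them by a cocycle of the dual complex with
  values in \<open>cosyz I d j\<close>, and that cocycle is a coboundary.\<close>

lemma im_mod_lift:
  assumes f: "lin A (im_mod i) (cosyz I d (Suc j)) f"
  shows "\<exists>g. lin A (im_mod i) (I j) g \<and> (\<forall>w \<in> carrier (im_mod i). d j (g w) = f w)"
proof -
  interpret I: amod A "I j" by (rule amod.intro[OF module_I])
  interpret C': amod A "cosyz I d (Suc j)" by (rule amod.intro[OF module_cosyz])
  from ses_cosyz[of j] have ld: "lin A (I j) (cosyz I d (Suc j)) (d j)"
    and sur: "d j ` carrier (I j) = carrier (cosyz I d (Suc j))" by (auto simp: ses_def)
  let ?P = "S_map i"
  define y where "y l = f (?P (uvec A (b i) l))" for l
  have y: "y l \<in> carrier (cosyz I d (Suc j))" for l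
    unfolding y_def by (rule lin_closed[OF f], rule lin_closed[OF lin_im]) (simp add: is_cring)
  have y0: "mact (cosyz I d (Suc j)) (b i) (tr (S (i - 1))) y m = \<zero>\<^bsub>cosyz I d (Suc j)\<^esub>" if "m < b (i - 1)" for m
    unfolding y_def by (rule hom_im_relation[OF module_cosyz f that])
  have "\<forall>l. \<exists>x. x \<in> carrier (I j) \<and> d j x = y l" using y sur by (metis imageE)
  then obtain x where x: "\<And>l. x l \<in> carrier (I j)" "\<And>l. d j (x l) = y l" by metis
  \<comment> \<open>The defect of the lift \<open>x\<close>. It lies in the cosyzygy because
    \<open>y\<close> itself satisfies the relations.\<close>
  define u where "u m = (if m < b (i - 1) then mact (I j) (b i) (tr (S (i - 1))) x m else \<zero>\<^bsub>I j\<^esub>)" for m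
  have u: "u m \<in> carrier (cosyz I d j)" for m
    using x y0 lin_mact[where y = x and k = m and n = "b i" and T = "tr (S (i - 1))", OF module_I module_cosyz ld x(1)] mat_S
      lin_zero[OF module_I module_cosyz ld]
    by (auto simp: u_def carrier_cosyz cosyz_simps)
  have "mact (cosyz I d j) (b (i - 1)) (tr (S (i - 2))) u k = \<zero>\<^bsub>cosyz I d j\<^esub>" if k: "k < b (i - 2)" for k
  proof -
    have "mact (I j) (b (i - 1)) (tr (S (i - 2))) u k
        = mact (I j) (b (i - 1)) (tr (S (i - 2))) (mact (I j) (b i) (tr (S (i - 1))) x) k"
      by (rule mact_cong) (simp add: u_def)
    also have "\<dots> = \<zero>\<^bsub>I j\<^esub>"
    proof (rule I.mact_zprod)
      show "zprod A (b (i - 2)) (tr (S (i - 2))) (b (i - 1)) (tr (S (i - 1))) (b i)"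
        unfolding zprod_tr[OF is_cring mat_S mat_S] using zprod_S'[of "i - 1"] by simp
    qed (use x mat_S k in auto)
    finally show ?thesis by (simp add: cosyz_simps)
  qed
  moreover have "exact_at (cosyz I d j) (b i) (tr (S (i - 1))) (b (i - 1)) (tr (S (i - 2))) (b (i - 2))"
    using dual_exact[of j "i - 1"] by simp
  ultimately obtain z where z: "\<And>k. z k \<in> carrier (cosyz I d j)"
    "\<And>k. k < b (i - 1) \<Longrightarrow> u k = mact (cosyz I d j) (b i) (tr (S (i - 1))) z k"
    using exact_atE[of "cosyz I d j" "b i" "tr (S (i - 1))" "b (i - 1)" "tr (S (i - 2))" "b (i - 2)" u] u by blast
  have zI: "z k \<in> carrier (I j)" "d j (z k) = \<zero>\<^bsub>I (Suc j)\<^esub>" for k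
    using z(1)[of k] by (auto simp: carrier_cosyz)
  \<comment> \<open>Since \<open>d j\<close> kills \<open>z\<close>, the corrected tuple still lifts
    \<open>y\<close>, and now the relations hold in \<open>I j\<close>.\<close>
  define x' where "x' l = x l \<ominus>\<^bsub>I j\<^esub> z l" for l
  have x': "x' l \<in> carrier (I j)" "d j (x' l) = y l" for l
    using x zI y by (auto simp: x'_def lin_minus[OF module_I module_cosyz ld] cosyz_simps(1)[symmetric])
  have x'0: "mact (I j) (b i) (tr (S (i - 1))) x' m = \<zero>\<^bsub>I j\<^esub>" if "m < b (i - 1)" for m
    using z(2)[OF that] that x(1) zI(1) mat_S by (simp add: x'_def[abs_def] I.mact_diff u_def cosyz_simps)
  obtain g where g: "lin A ((free_mod A (b (i + 1)))\<lparr>carrier := ?P ` carrier (free_mod A (b i))\<rparr>) (I j) g"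
    "\<And>v. v \<in> carrier (free_mod A (b i)) \<Longrightarrow> g (?P v) = msum (I j) (\<lambda>l. v l \<odot>\<^bsub>I j\<^esub> x' l) (b i)"
    using hom_of_relations[OF module_I mat_S mat_S exact_S' x'(1) x'0] by blast
  show ?thesis
  proof (intro exI conjI ballI)
    show "lin A (im_mod i) (I j) g" using g(1) by (simp add: im_mod_def)
    fix w assume "w \<in> carrier (im_mod i)"
    then obtain v where v: "v \<in> carrier (free_mod A (b i))" "w = ?P v" by (auto simp: im_mod_carrier)
    have "d j (g w) = msum (cosyz I d (Suc j)) (\<lambda>l. d j (v l \<odot>\<^bsub>I j\<^esub> x' l)) (b i)"
      unfolding v(2) g(2)[OF v(1)] by (rule lin_msum[OF module_I module_cosyz ld]) (use v x' in auto)
    also have "\<dots> = msum (cosyz I d (Suc j)) (\<lambda>l. v l \<odot>\<^bsub>cosyz I d (Suc j)\<^esub> y l) (b i)"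
      by (rule msum_cong) (use v x' lin_smult[OF ld] in \<open>simp add: PiE_closed\<close>)
    also have "\<dots> = f w"
      unfolding v(2) y_def using hom_im_expand[OF module_cosyz f v(1)] by simp
    finally show "d j (g w) = f w" .
  qed
qed

text \<open>A functional on the image is a tuple \<open>y\<close> on the source that satisfies the
  relations, hence a cocycle of the dual complex. Exactness of the dual gives \<open>y\<close> as
  the transpose of \<open>S i\<close> applied to some \<open>x\<close>, and pairing with
  \<open>x\<close> extends the functional to the ambient free module.\<close>

lemma im_mod_dual:
  assumes f: "lin A (im_mod i) (reg_mod A) f"
  obtains x where "x \<in> carrier (free_mod A (b (i + 1)))"
    "\<And>w. w \<in> carrier (im_mod i) \<Longrightarrow> f w = msum (reg_mod A) (\<lambda>k. w k \<otimes> x k) (b (i + 1))"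
proof -
  interpret R: amod A "reg_mod A" by (rule amod.intro[OF module_reg])
  let ?P = "S_map i"
  define y where "y l = f (?P (uvec A (b i) l))" for l
  have y: "y l \<in> carrier (reg_mod A)" for l
    unfolding y_def by (rule lin_closed[OF f], rule lin_closed[OF lin_im]) (simp add: is_cring)
  have y0: "mact (reg_mod A) (b i) (tr (S (i - 1))) y m = \<zero>\<^bsub>reg_mod A\<^esub>" if "m < b (i - 1)" for m
    unfolding y_def by (rule hom_im_relation[OF module_reg f that])
  have "exact_at (reg_mod A) (b (i + 1)) (tr (S i)) (b i) (tr (S (i - 1))) (b (i - 1))"
    using exact_at_reg_cosyz[of "tr (S i)" "tr (S (i - 1))"] mat_S dual_exact by simp
  then obtain x where x: "\<And>k. x k \<in> carrier A" "\<And>k. k < b i \<Longrightarrow> y k = mact (reg_mod A) (b (i + 1)) (tr (S i)) x k"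
    using exact_atE[of "reg_mod A" "b (i + 1)" "tr (S i)" "b i" "tr (S (i - 1))" "b (i - 1)" y] y y0 by auto
  show thesis
  proof
    show "restrict x {..<b (i + 1)} \<in> carrier (free_mod A (b (i + 1)))" using x by simp
    fix w assume "w \<in> carrier (im_mod i)"
    then obtain v where v: "v \<in> carrier (free_mod A (b i))" "w = ?P v" by (auto simp: im_mod_carrier)
    have "f w = msum (reg_mod A) (\<lambda>l. v l \<odot>\<^bsub>reg_mod A\<^esub> y l) (b i)"
      unfolding v(2) y_def by (rule hom_im_expand[OF module_reg f v(1)])
    also have "\<dots> = msum (reg_mod A) (\<lambda>l. v l \<odot>\<^bsub>reg_mod A\<^esub> mact (reg_mod A) (b (i + 1)) (tr (S i)) x l) (b i)"
      by (rule msum_cong) (simp add: x(2))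
    also have "\<dots> = msum (reg_mod A) (\<lambda>k. mact (reg_mod A) (b i) (S i) v k \<odot>\<^bsub>reg_mod A\<^esub> x k) (b (i + 1))"
      by (rule R.pairing[symmetric]) (use mat_S v x in auto)
    also have "\<dots> = msum (reg_mod A) (\<lambda>k. w k \<otimes> restrict x {..<b (i + 1)} k) (b (i + 1))"
      by (rule msum_cong) (simp add: v(2) matmap_def)
    finally show "f w = msum (reg_mod A) (\<lambda>k. w k \<otimes> restrict x {..<b (i + 1)} k) (b (i + 1))" .
  qed
qed

end

text \<open>An isomorphism is a short exact sequence whose third module is zero, and for that module
  lifting is trivial; so \<open>ses_hom\<close> applies.\<close>

lemma hom_mod_iso:
  fixes A :: "'a ring"
  assumes "module A W" "module A Y" "module A Z" "lin A Y Z f" "bij_betw f (carrier Y) (carrier Z)"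
  shows "lin A (hom_mod A W Y) (hom_mod A W Z) (\<lambda>g. \<lambda>w\<in>carrier W. f (g w))"
    "bij_betw (\<lambda>g. \<lambda>w\<in>carrier W. f (g w)) (carrier (hom_mod A W Y)) (carrier (hom_mod A W Z))"
proof -
  interpret Z: amod A Z by (rule amod.intro) fact
  let ?Z0 = "Z\<lparr>carrier := {\<zero>\<^bsub>Z\<^esub>}\<rparr>"
  have m0: "module A ?Z0"
    by (rule submodule_module[OF assms(3)], rule Z.submoduleI) auto
  have "ses A Y Z ?Z0 f (\<lambda>_. \<zero>\<^bsub>Z\<^esub>)"
    using assms(5) Z.zero_closed
    by (intro sesI assms m0) (auto simp: bij_betw_def lin_def)
  then have s: "ses A (hom_mod A W Y) (hom_mod A W Z) (hom_mod A W ?Z0)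
    (\<lambda>g. \<lambda>w\<in>carrier W. f (g w)) (\<lambda>g. \<lambda>w\<in>carrier W. \<zero>\<^bsub>Z\<^esub>)"
  proof (rule ses_hom[OF _ assms(1)])
    fix g assume g: "lin A W ?Z0 g"
    have "lin A W Z (\<lambda>_. \<zero>\<^bsub>Z\<^esub>)" by (rule linI) auto
    moreover have "\<forall>w\<in>carrier W. \<zero>\<^bsub>Z\<^esub> = g w" using lin_closed[OF g] by auto
    ultimately show "\<exists>h. lin A W Z h \<and> (\<forall>w\<in>carrier W. \<zero>\<^bsub>Z\<^esub> = g w)" by blast
  qed
  then show "lin A (hom_mod A W Y) (hom_mod A W Z) (\<lambda>g. \<lambda>w\<in>carrier W. f (g w))"
    by (simp add: ses_def)
  from s show "bij_betw (\<lambda>g. \<lambda>w\<in>carrier W. f (g w)) (carrier (hom_mod A W Y)) (carrier (hom_mod A W Z))"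
    by (auto simp: ses_def bij_betw_def)
qed

text \<open>The image of \<delta> in \<open>P s\<close>, hence the syzygy of order
  \<open>Suc s\<close>; the index is that of the module in which it lies.\<close>

definition res_syz :: "(nat \<Rightarrow> ('a, 'p) module) \<Rightarrow> (nat \<Rightarrow> 'p \<Rightarrow> 'p) \<Rightarrow> nat \<Rightarrow> ('a, 'p) module"
  where "res_syz P \<delta> s = (P s)\<lparr>carrier := \<delta> s ` carrier (P (Suc s))\<rparr>"

lemma left_resolution_ses:
  fixes A :: "'a ring"
  assumes "left_resolution A X P \<delta> \<epsilon>" "module A X"
  shows "module A (res_syz P \<delta> s)"
    and "ses A (res_syz P \<delta> 0) (P 0) X (\<lambda>x. x) \<epsilon>"
    and "ses A (res_syz P \<delta> (Suc s)) (P (Suc s)) (res_syz P \<delta> s) (\<lambda>x. x) (\<delta> s)"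
proof -
  from assms have m: "module A (P s)" and l: "lin A (P (Suc s)) (P s) (\<delta> s)" and le: "lin A (P 0) X \<epsilon>"
    and im: "\<epsilon> ` carrier (P 0) = carrier X"
    and k0: "\<delta> 0 ` carrier (P (Suc 0)) = {x \<in> carrier (P 0). \<epsilon> x = \<zero>\<^bsub>X\<^esub>}"
    and k: "\<delta> (Suc s) ` carrier (P (Suc (Suc s))) = {x \<in> carrier (P (Suc s)). \<delta> s x = \<zero>\<^bsub>P s\<^esub>}" for s
    by (auto simp: left_resolution_def mod_hom_lin a_kernel_def')
  show ms: "module A (res_syz P \<delta> s)" for s
    unfolding res_syz_def
    by (rule submodule_module[OF m lin_image_submodule[OF m m l module.carrier_is_submodule[OF m]]])
  have i: "lin A (res_syz P \<delta> s) (P s) (\<lambda>x. x)" for s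
    using lin_closed[OF l[of s]] by (auto simp: lin_def res_syz_def)
  show "ses A (res_syz P \<delta> 0) (P 0) X (\<lambda>x. x) \<epsilon>"
    by (rule sesI[OF ms m assms(2) i le]) (use im k0 in \<open>auto simp: res_syz_def\<close>)
  have p: "lin A (P (Suc s)) (res_syz P \<delta> s) (\<delta> s)"
    unfolding res_syz_def using lin_codomain[OF l] by blast
  show "ses A (res_syz P \<delta> (Suc s)) (P (Suc s)) (res_syz P \<delta> s) (\<lambda>x. x) (\<delta> s)"
    by (rule sesI[OF ms m ms i p]) (use k in \<open>auto simp: res_syz_def\<close>)
qed

section \<open>Cohomology of the acyclic complex with varying coefficients\<close>

context acyclic_complex
begin

text \<open>The spot tested is \<open>i + 1\<close>: this is vanishing of the cohomology of
  \<open>S\<close> with coefficients \<open>Y\<close> in degree \<open>i + 1\<close>.\<close>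

definition ex_at :: "('a, 'y) module \<Rightarrow> int \<Rightarrow> bool"
  where "ex_at Y i \<longleftrightarrow> exact_at Y (b i) (S i) (b (i + 1)) (S (i + 1)) (b (i + 2))"

definition ex_all :: "('a, 'y) module \<Rightarrow> bool"
  where "ex_all Y \<longleftrightarrow> (\<forall>i. ex_at Y i)"

lemma ex_at_left:
  assumes "ses A X Y Z p q" "ex_at Z i" "ex_at Y (i + 1)"
  shows "ex_at X (i + 1)"
proof -
  have "exact_at X (b (i + 1)) (S (i + 1)) (b (i + 2)) (S (i + 2)) (b (i + 3))"
    by (rule ses_exact_left[OF assms(1) mat_S mat_S mat_S zprod_S])
      (use assms(2,3) in \<open>simp_all add: ex_at_def algebra_simps\<close>)
  then show ?thesis by (simp add: ex_at_def algebra_simps)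
qed

lemma ex_at_right:
  assumes "ses A X Y Z p q" "ex_at X (i + 1)" "ex_at Y i"
  shows "ex_at Z i"
proof -
  have "zprod A (b (i + 3)) (S (i + 2)) (b (i + 2)) (S (i + 1)) (b (i + 1))"
    using zprod_S[of "i + 1"] by (simp add: algebra_simps)
  then show ?thesis unfolding ex_at_def
    by (rule ses_exact_right[OF assms(1) mat_S mat_S mat_S])
      (use assms(2,3) in \<open>simp_all add: ex_at_def algebra_simps\<close>)
qed

lemma ex_at_middle:
  assumes "ses A X Y Z p q" "ex_at X i" "ex_at Z i"
  shows "ex_at Y i"
  using ses_exact_middle[OF assms(1) mat_S mat_S zprod_S] assms(2,3) by (simp add: ex_at_def)

lemma ex_all_left: "ses A X Y Z p q \<Longrightarrow> ex_all Z \<Longrightarrow> ex_all Y \<Longrightarrow> ex_all X"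
  unfolding ex_all_def using ex_at_left[of X Y Z p q "i - 1" for i] by (metis diff_add_cancel)

lemma ex_all_right: "ses A X Y Z p q \<Longrightarrow> ex_all X \<Longrightarrow> ex_all Y \<Longrightarrow> ex_all Z"
  unfolding ex_all_def using ex_at_right by blast

lemma ex_at_iso:
  assumes "module A X" "module A Y" "lin A X Y f" "bij_betw f (carrier X) (carrier Y)"
  shows "ex_at X i \<longleftrightarrow> ex_at Y i"
  unfolding ex_at_def by (rule exact_at_iso[OF assms mat_S mat_S])

lemma ex_all_free: "ex_all (free_mod A m)"
  unfolding ex_all_def ex_at_def using exact_at_free_mod[OF is_cring mat_S mat_S exact_S] by blast

lemma ex_all_syz:
  assumes "left_resolution A X (\<lambda>s. free_mod A (c s)) \<delta> \<epsilon>" "module A X" "ex_all X"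
  shows "ex_all (res_syz (\<lambda>s. free_mod A (c s)) \<delta> s)"
  by (induction s) (use left_resolution_ses[OF assms(1,2)] assms(3) ex_all_left ex_all_free in blast)+

text \<open>This is the vanishing of Tor between \<open>X\<close> and the image module, by an
  exchange in a double complex. A cycle \<open>y\<close> is an array with entries in
  \<open>A\<close>; its other reading is a tuple in a syzygy of \<open>X\<close> killed by
  \<open>S (i + 1)\<close>. Vanishing with coefficients in that syzygy makes it the image of a tuple
  \<open>z\<close> under \<open>S i\<close>, and lifting \<open>z\<close> along the resolution gives
  the bounding tuple in the image module.\<close>

lemma exact_im_mod:
  assumes res: "left_resolution A X (\<lambda>s. free_mod A (c s)) \<delta> \<epsilon>" and "module A X" "ex_all X"
  defines "E \<equiv> \<lambda>s. free_mat A (c s) (c (Suc s)) (\<delta> s)"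
  shows "exact_res (im_mod i) c E s"
proof (rule exact_atI)
  interpret R: amod A "reg_mod A" by (rule amod.intro[OF module_reg])
  from res have l\<delta>: "lin A (free_mod A (c (Suc s))) (free_mod A (c s)) (\<delta> s)"
    and ker: "\<delta> (Suc s) ` carrier (free_mod A (c (Suc (Suc s))))
      = {x \<in> carrier (free_mod A (c (Suc s))). \<delta> s x = \<zero>\<^bsub>free_mod A (c s)\<^esub>}" for s
    by (auto simp: left_resolution_def mod_hom_lin a_kernel_def')
  have mE: "mat A (E s)" for s unfolding E_def using mat_free_mat[OF is_cring l\<delta>] .
  have \<delta>: "\<delta> s x k = mact (reg_mod A) (c (Suc s)) (E s) x k" if "x \<in> carrier (free_mod A (c (Suc s)))" "k < c s" for s x k
    unfolding E_def by (rule free_mat_eq[OF is_cring l\<delta> that])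
  let ?b = "b (i + 1)" and ?c = "c (Suc s)" and ?O = "res_syz (\<lambda>s. free_mod A (c s)) \<delta> (Suc s)"
  fix y assume y: "\<And>k. y k \<in> carrier (im_mod i)" and y0: "\<And>k. k < c s \<Longrightarrow> mact (im_mod i) ?c (E s) y k = \<zero>\<^bsub>im_mod i\<^esub>"
  have yc: "y k p \<in> carrier A" if "p < ?b" for k p
    using y[of k] that by (auto simp: im_mod_iff)
  \<comment> \<open>Transposition of the array: the entry index and the coordinate in the ambient
    free module trade places. The cycle condition puts each \<open>row p\<close> in the syzygy, and
    membership of \<open>y l\<close> in \<open>im_mod i\<close> makes \<open>row\<close> a cocycle
    for \<open>S (i + 1)\<close>.\<close>
  define row where "row p = (if p < ?b then (\<lambda>l\<in>{..<?c}. y l p) else \<zero>\<^bsub>free_mod A ?c\<^esub>)" for p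
  have rowF: "row p \<in> carrier (free_mod A ?c)" for p
    using yc by (auto simp: row_def)
  have Oc: "carrier ?O = {x \<in> carrier (free_mod A ?c). \<delta> s x = \<zero>\<^bsub>free_mod A (c s)\<^esub>}"
    using ker[of s] by (simp add: res_syz_def)
  have "\<delta> s (row p) = \<zero>\<^bsub>free_mod A (c s)\<^esub>" for p
  proof (cases "p < ?b")
    case True
    have "\<delta> s (row p) k = \<zero>" if k: "k < c s" for k
    proof -
      have "\<delta> s (row p) k = mact (reg_mod A) ?c (E s) (\<lambda>l. y l p) k"
        unfolding \<delta>[OF rowF k] by (rule mact_cong) (simp add: row_def True)
      also have "\<dots> = mact (free_mod A ?b) ?c (E s) y k p"
        unfolding free_mod_eq by (rule mact_pow_mod[OF True, symmetric])
      also have "\<dots> = \<zero>" using y0[OF k] True by simp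
      finally show ?thesis .
    qed
    then show ?thesis
      using lin_closed[OF l\<delta> rowF] by (intro tuple_ext[of _ "c s" "carrier A" _ "carrier A"]) auto
  next
    case False
    then show ?thesis using lin_zero[OF module_free module_free l\<delta>] by (simp add: row_def)
  qed
  then have rowO: "row p \<in> carrier ?O" for p using rowF by (simp add: Oc)
  have "mact ?O ?b (S (i + 1)) row q = \<zero>\<^bsub>?O\<^esub>" if q: "q < b (i + 2)" for q
  proof -
    interpret F: amod A "free_mod A ?c" by (rule amod.intro[OF module_free])
    have "mact (free_mod A ?c) ?b (S (i + 1)) row q = \<zero>\<^bsub>free_mod A ?c\<^esub>"
    proof (rule tuple_ext)
      show "mact (free_mod A ?c) ?b (S (i + 1)) row q \<in> {..<?c} \<rightarrow>\<^sub>E carrier A"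
        using F.mact_closed[OF mat_S rowF] by simp
      show "\<zero>\<^bsub>free_mod A ?c\<^esub> \<in> {..<?c} \<rightarrow>\<^sub>E carrier A" by simp
      fix l assume l: "l < ?c"
      have "mact (free_mod A ?c) ?b (S (i + 1)) row q l = mact (reg_mod A) ?b (S (i + 1)) (\<lambda>p. row p l) q"
        unfolding free_mod_eq by (rule mact_pow_mod[OF l])
      also have "\<dots> = mact (reg_mod A) ?b (S (i + 1)) (y l) q"
        by (rule mact_cong) (simp add: row_def l)
      also have "\<dots> = \<zero>" using y[of l] q by (simp add: im_mod_iff)
      finally show "mact (free_mod A ?c) ?b (S (i + 1)) row q l = \<zero>\<^bsub>free_mod A ?c\<^esub> l" using l by simp
    qed
    then show ?thesis by (simp add: res_syz_def)
  qed
  moreover have "exact_at ?O (b i) (S i) ?b (S (i + 1)) (b (i + 2))"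
    using ex_all_syz[OF assms(1-3), of "Suc s"] by (simp add: ex_all_def ex_at_def)
  ultimately obtain z where z: "\<And>k. z k \<in> carrier ?O" "\<And>k. k < ?b \<Longrightarrow> row k = mact ?O (b i) (S i) z k"
    using exact_atE[of ?O "b i" "S i" ?b "S (i + 1)" "b (i + 2)" row] rowO by blast
  have "\<forall>k. \<exists>u. u \<in> carrier (free_mod A (c (Suc (Suc s)))) \<and> \<delta> (Suc s) u = z k"
    using z(1) by (auto simp: res_syz_def image_iff) metis
  then obtain u where u: "\<And>k. u k \<in> carrier (free_mod A (c (Suc (Suc s))))" "\<And>k. \<delta> (Suc s) (u k) = z k"
    by metis
  \<comment> \<open>Transposing back: \<open>S i\<close> is applied to the \<open>l\<close>-th
    coordinates of the lifts \<open>u\<close>, so the result lies in \<open>im_mod i\<close> by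
    construction.\<close>
  define y' where "y' l = matmap A ?b (b i) (S i) (\<lambda>p\<in>{..<b i}. if l < c (Suc (Suc s)) then u p l else \<zero>)" for l
  have uc: "u p l \<in> carrier A" if "l < c (Suc (Suc s))" for p l using u(1)[of p] that by auto
  have y': "y' l \<in> carrier (im_mod i)" for l
    unfolding y'_def im_mod_carrier using uc by (intro imageI) (simp add: PiE_iff extensional_def)
  have "y l = mact (im_mod i) (c (Suc (Suc s))) (E (Suc s)) y' l" if l: "l < ?c" for l
  proof (rule tuple_ext)
    interpret W: amod A "im_mod i" by (rule amod.intro[OF module_im])
    show "y l \<in> {..<?b} \<rightarrow>\<^sub>E carrier A" using y[of l] by (simp add: im_mod_iff)
    show "mact (im_mod i) (c (Suc (Suc s))) (E (Suc s)) y' l \<in> {..<?b} \<rightarrow>\<^sub>E carrier A"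
      using W.mact_closed[where y = y' and k = l, OF mE y'] unfolding im_mod_iff by simp
    fix q assume q: "q < ?b"
    have "y l q = row q l" using l q by (simp add: row_def)
    also have "\<dots> = mact (free_mod A ?c) (b i) (S i) z q l" using z(2)[OF q] by (simp add: res_syz_def)
    also have "\<dots> = mact (reg_mod A) (b i) (S i) (\<lambda>p. z p l) q"
      unfolding free_mod_eq by (rule mact_pow_mod[OF l])
    also have "\<dots> = mact (reg_mod A) (b i) (S i) (\<lambda>p. mact (reg_mod A) (c (Suc (Suc s))) (E (Suc s)) (u p) l) q"
      using \<delta>[OF u(1) l] u(2) by simp
    \<comment> \<open>The two differentials act on different indices of \<open>u\<close> and
      therefore commute; concretely, the two sums are interchanged.\<close>
    also have "\<dots> = msum (reg_mod A) (\<lambda>p. msum (reg_mod A) (\<lambda>m. S i q p \<otimes> (E (Suc s) l m \<otimes> u p m)) (c (Suc (Suc s)))) (b i)"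
      unfolding mact_def
      by (rule msum_cong, subst R.msum_smult) (use mat_S mE uc in \<open>auto simp: mat_def\<close>)
    also have "\<dots> = msum (reg_mod A) (\<lambda>m. msum (reg_mod A) (\<lambda>p. S i q p \<otimes> (E (Suc s) l m \<otimes> u p m)) (b i)) (c (Suc (Suc s)))"
      by (rule R.msum_swap) (use mat_S mE uc in \<open>auto simp: mat_def\<close>)
    also have "\<dots> = msum (reg_mod A) (\<lambda>m. E (Suc s) l m \<otimes> y' m q) (c (Suc (Suc s)))"
    proof (rule msum_cong)
      fix m assume m: "m < c (Suc (Suc s))"
      have "y' m q = msum (reg_mod A) (\<lambda>p. S i q p \<odot>\<^bsub>reg_mod A\<^esub> u p m) (b i)"
        unfolding y'_def matmap_def mact_def using q m by (auto intro: msum_cong)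
      then have "E (Suc s) l m \<otimes> y' m q = msum (reg_mod A) (\<lambda>p. E (Suc s) l m \<odot>\<^bsub>reg_mod A\<^esub> (S i q p \<odot>\<^bsub>reg_mod A\<^esub> u p m)) (b i)"
        using R.msum_smult[of "E (Suc s) l m" "b i" "\<lambda>p. S i q p \<odot>\<^bsub>reg_mod A\<^esub> u p m"] mE mat_S uc m
        by (simp add: mat_def)
      also have "\<dots> = msum (reg_mod A) (\<lambda>p. S i q p \<otimes> (E (Suc s) l m \<otimes> u p m)) (b i)"
        by (rule msum_cong) (use mE mat_S uc m in \<open>simp add: mat_def m_lcomm\<close>)
      finally show "msum (reg_mod A) (\<lambda>p. S i q p \<otimes> (E (Suc s) l m \<otimes> u p m)) (b i) = E (Suc s) l m \<otimes> y' m q" ..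
    qed
    also have "\<dots> = mact (reg_mod A) (c (Suc (Suc s))) (E (Suc s)) (\<lambda>m. y' m q) l"
      by (simp add: mact_def)
    also have "\<dots> = mact (im_mod i) (c (Suc (Suc s))) (E (Suc s)) y' l q"
      unfolding im_mod_simps free_mod_eq by (rule mact_pow_mod[OF q, symmetric])
    finally show "y l q = mact (im_mod i) (c (Suc (Suc s))) (E (Suc s)) y' l q" .
  qed
  with y' show "\<exists>z. (\<forall>k. z k \<in> carrier (im_mod i)) \<and> (\<forall>k<?c. y k = mact (im_mod i) (c (Suc (Suc s))) (E (Suc s)) z k)"
    by blast
qed

end

section \<open>Minimal free resolutions\<close>

text \<open>Generation by a tuple, phrased as surjectivity of a map from a free module, so that
  covers can be read off from it.\<close>

definition gen_by :: "'a ring \<Rightarrow> ('a, 'm) module \<Rightarrow> nat \<Rightarrow> (nat \<Rightarrow> 'm) \<Rightarrow> bool"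
  where "gen_by A Y m y \<longleftrightarrow> (\<forall>l < m. y l \<in> carrier Y) \<and>
    (\<lambda>x. msum Y (\<lambda>l. x l \<odot>\<^bsub>Y\<^esub> y l) m) ` carrier (free_mod A m) = carrier Y"

lemma submodule_combinations:
  fixes A :: "'a ring"
  assumes "module A Y" "\<And>l. l < m \<Longrightarrow> y l \<in> carrier Y"
  shows "submodule ((\<lambda>x. msum Y (\<lambda>l. x l \<odot>\<^bsub>Y\<^esub> y l) m) ` carrier (free_mod A m)) A Y" (is "submodule ?H A Y")
    and "\<And>i. i < m \<Longrightarrow> y i \<in> (\<lambda>x. msum Y (\<lambda>l. x l \<odot>\<^bsub>Y\<^esub> y l) m) ` carrier (free_mod A m)"
proof -
  interpret Y: amod A Y by (rule amod.intro) fact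
  note F = module_free_mod[OF Y.R.is_cring]
  show "submodule ?H A Y"
    by (rule lin_image_submodule[OF F assms(1) lin_of_tuple module.carrier_is_submodule[OF F]])
      (use assms in auto)
  show "y i \<in> ?H" if "i < m" for i
    by (rule image_eqI[of _ _ "uvec A m i"]) (use of_tuple_uvec[OF assms that] Y.R.is_cring in auto)
qed

lemma combinations_subset:
  fixes A :: "'a ring"
  assumes "module A Y" "submodule H A Y" "\<And>l. l < m \<Longrightarrow> y l \<in> H"
  shows "(\<lambda>x. msum Y (\<lambda>l. x l \<odot>\<^bsub>Y\<^esub> y l) m) ` carrier (free_mod A m) \<subseteq> H"
proof -
  interpret Y: amod A Y by (rule amod.intro) fact
  show ?thesis
    using assms(3) Y.submoduleE(4)[OF assms(2)] by (auto intro!: Y.submodule_msum[OF assms(2)])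
qed

lemma gen_byI:
  fixes A :: "'a ring"
  assumes "module A Y" "\<And>l. l < m \<Longrightarrow> y l \<in> carrier Y"
    "\<And>H. submodule H A Y \<Longrightarrow> (\<And>l. l < m \<Longrightarrow> y l \<in> H) \<Longrightarrow> carrier Y \<subseteq> H"
  shows "gen_by A Y m y"
  unfolding gen_by_def
proof (intro conjI allI impI equalityI)
  show "(\<lambda>x. msum Y (\<lambda>l. x l \<odot>\<^bsub>Y\<^esub> y l) m) ` carrier (free_mod A m) \<subseteq> carrier Y"
    by (rule combinations_subset[OF assms(1) module.carrier_is_submodule[OF assms(1)] assms(2)])
  show "carrier Y \<subseteq> (\<lambda>x. msum Y (\<lambda>l. x l \<odot>\<^bsub>Y\<^esub> y l) m) ` carrier (free_mod A m)"
    by (rule assms(3)[OF submodule_combinations(1)[OF assms(1,2)] submodule_combinations(2)[OF assms(1,2)]])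
qed (rule assms(2))

lemma fin_gen_gen_by:
  fixes A :: "'a ring"
  assumes "module A Y" "fin_gen A Y"
  obtains m y where "gen_by A Y m y"
proof -
  obtain S where S: "S \<subseteq> carrier Y" "finite S" "mod_span A Y S = carrier Y"
    using assms(2) by (auto simp: fin_gen_def)
  obtain xs where xs: "set xs = S" using finite_list[OF S(2)] by blast
  have "gen_by A Y (length xs) ((!) xs)"
  proof (rule gen_byI[OF assms(1)])
    show "xs ! l \<in> carrier Y" if "l < length xs" for l using that xs S(1) by auto
    fix H assume H: "submodule H A Y" "\<And>l. l < length xs \<Longrightarrow> xs ! l \<in> H"
    then have "S \<subseteq> H" using xs by (metis in_set_conv_nth subsetI)
    with H(1) show "carrier Y \<subseteq> H" unfolding S(3)[symmetric] mod_span_def by auto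
  qed
  then show thesis using that by blast
qed

lemma (in amod) msum_split:
  assumes "i < n" "\<And>l. l < n \<Longrightarrow> f l \<in> carrier M"
  shows "msum M f n = msum M (\<lambda>l. if l = i then \<zero>\<^bsub>M\<^esub> else f l) n \<oplus>\<^bsub>M\<^esub> f i"
proof -
  have "msum M f n = msum M (\<lambda>l. (if l = i then \<zero>\<^bsub>M\<^esub> else f l) \<oplus>\<^bsub>M\<^esub> (if l = i then f i else \<zero>\<^bsub>M\<^esub>)) n"
    by (rule msum_cong) (use assms in auto)
  also have "\<dots> = msum M (\<lambda>l. if l = i then \<zero>\<^bsub>M\<^esub> else f l) n \<oplus>\<^bsub>M\<^esub> msum M (\<lambda>l. if l = i then f i else \<zero>\<^bsub>M\<^esub>) n"
    by (rule msum_add) (use assms in auto)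
  finally show ?thesis using msum_delta[of "f i" i n] assms by simp
qed

locale noeth_local_ring = cring A for A :: "'a ring" (structure) +
  assumes local_ring: "local_ring A" and noetherian: "noetherian_ring A"
begin

lemma maximalideal_max_ideal: "maximalideal (max_ideal A) A"
  unfolding max_ideal_def using local_ring unfolding local_ring_def by (metis theI')

text \<open>A non-unit lies in a proper ideal; an ideal maximal among those containing
  \<open>a\<close> but not \<open>\<one>\<close> is a maximal ideal, hence the only one.\<close>

lemma unit_if_not_max_ideal:
  assumes "a \<in> carrier A" "a \<notin> max_ideal A"
  shows "a \<in> Units A"
proof (rule ccontr)
  assume nu: "a \<notin> Units A"
  define J where "J = {I. ideal I A \<and> a \<in> I \<and> \<one> \<notin> I}"
  have "PIdl a \<in> J"
  proof -
    have "\<one> \<notin> PIdl a"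
    proof
      assume "\<one> \<in> PIdl a"
      then obtain x where "x \<in> carrier A" "\<one> = x \<otimes> a" by (auto simp: cgenideal_def)
      then show False using nu assms(1) m_comm unfolding Units_def by auto
    qed
    then show ?thesis
      using cgenideal_ideal[OF assms(1)] cgenideal_self[OF assms(1)] by (simp add: J_def)
  qed
  have "\<exists>M \<in> J. \<forall>X \<in> J. M \<subseteq> X \<longrightarrow> X = M"
  proof (rule subset_Zorn)
    fix C assume C: "subset.chain J C"
    show "\<exists>U \<in> J. \<forall>X \<in> C. X \<subseteq> U"
    proof (cases "C = {}")
      case True
      with \<open>PIdl a \<in> J\<close> show ?thesis by auto
    next
      case False
      have "subset.chain {I. ideal I A} C" using C by (auto simp: pred_on.chain_def J_def)
      \<comment> \<open>The Noetherian property makes the union of a nonempty chain one of its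
        members, so that member is the upper bound.\<close>
      then have "\<Union>C \<in> C" using noetherian_ring.ideal_chain_is_trivial[OF noetherian False] by simp
      then show ?thesis using C by (auto simp: pred_on.chain_def)
    qed
  qed
  then obtain M where M: "M \<in> J" "\<And>X. X \<in> J \<Longrightarrow> M \<subseteq> X \<Longrightarrow> X = M" by blast
  have "maximalideal M A"
  proof (rule maximalidealI)
    show "ideal M A" using M(1) by (simp add: J_def)
    show "carrier A \<noteq> M" using M(1) by (auto simp: J_def)
    fix X assume X: "ideal X A" "M \<subseteq> X" "X \<subseteq> carrier A"
    show "X = M \<or> X = carrier A"
    proof (cases "\<one> \<in> X")
      case True
      then show ?thesis using ideal.one_imp_carrier[OF X(1)] by simp
    next
      case False
      then have "X \<in> J" using X M(1) by (auto simp: J_def)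
      then show ?thesis using M(2) X(2) by blast
    qed
  qed
  then have "M = max_ideal A"
    using local_ring maximalideal_max_ideal unfolding local_ring_def by blast
  then show False using M(1) assms(2) by (simp add: J_def)
qed

text \<open>In a generating tuple of minimal length no relation has a unit coefficient.\<close>

lemma minimal_generators:
  assumes Y: "module A Y" and "gen_by A Y m0 y0"
  obtains m y where "gen_by A Y m y"
    "\<And>x i. x \<in> carrier (free_mod A m) \<Longrightarrow> msum Y (\<lambda>l. x l \<odot>\<^bsub>Y\<^esub> y l) m = \<zero>\<^bsub>Y\<^esub> \<Longrightarrow> i < m \<Longrightarrow> x i \<in> max_ideal A"
proof -
  interpret Y: amod A Y by (rule amod.intro) fact
  define m where "m = (LEAST m. \<exists>y. gen_by A Y m y)"
  obtain y where y: "gen_by A Y m y"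
    using LeastI[of "\<lambda>m. \<exists>y. gen_by A Y m y" m0] assms(2) by (auto simp: m_def)
  have least: "m \<le> m'" if "gen_by A Y m' y'" for m' y'
    unfolding m_def by (rule Least_le) (use that in blast)
  have yc: "y l \<in> carrier Y" if "l < m" for l using y that by (simp add: gen_by_def)
  show thesis
  proof
    show "gen_by A Y m y" by fact
    fix x i assume x: "x \<in> carrier (free_mod A m)" and 0: "msum Y (\<lambda>l. x l \<odot>\<^bsub>Y\<^esub> y l) m = \<zero>\<^bsub>Y\<^esub>" and i: "i < m"
    show "x i \<in> max_ideal A"
    proof (rule ccontr)
      assume "x i \<notin> max_ideal A"
      then have u: "x i \<in> Units A" using unit_if_not_max_ideal x i by auto
      have xc: "x l \<in> carrier A" if "l < m" for l using x that by auto
      define y' where "y' l = (if l < i then y l else y (Suc l))" for l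
      have "gen_by A Y (m - 1) y'"
      proof (rule gen_byI[OF Y])
        show "y' l \<in> carrier Y" if "l < m - 1" for l using that yc by (auto simp: y'_def)
        fix H assume H: "submodule H A Y" and y'H: "\<And>l. l < m - 1 \<Longrightarrow> y' l \<in> H"
        have yH: "y l \<in> H" if l: "l < m" "l \<noteq> i" for l
        proof (cases "l < i")
          case True
          then show ?thesis using y'H[of l] i by (simp add: y'_def)
        next
          case False
          then obtain l' where "l = Suc l'" "i \<le> l'" using l(2) by (cases l) auto
          then show ?thesis using y'H[of l'] l(1) by (simp add: y'_def)
        qed
        let ?s = "msum Y (\<lambda>l. if l = i then \<zero>\<^bsub>Y\<^esub> else x l \<odot>\<^bsub>Y\<^esub> y l) m"
        have s: "?s \<in> H"
          by (rule Y.submodule_msum[OF H]) (use Y.submodule_zero[OF H] Y.submoduleE(4)[OF H] xc yH in auto)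
        then have sc: "?s \<in> carrier Y" using Y.submoduleE(1)[OF H] by blast
        \<comment> \<open>The relation is solved for the generator with unit coefficient, which
          shows that the shorter tuple \<open>y'\<close> still generates.\<close>
        have "?s \<oplus>\<^bsub>Y\<^esub> x i \<odot>\<^bsub>Y\<^esub> y i = \<zero>\<^bsub>Y\<^esub>"
          using Y.msum_split[of i m "\<lambda>l. x l \<odot>\<^bsub>Y\<^esub> y l"] i xc yc 0 by simp
        then have "x i \<odot>\<^bsub>Y\<^esub> y i = \<ominus>\<^bsub>Y\<^esub> ?s"
          using sc xc[OF i] yc[OF i] by (metis Y.M.add.inv_equality Y.M.a_comm Y.smult_closed)
        then have "x i \<odot>\<^bsub>Y\<^esub> y i \<in> H" using Y.submoduleE(3)[OF H s] by simp
        then have "inv x i \<odot>\<^bsub>Y\<^esub> (x i \<odot>\<^bsub>Y\<^esub> y i) \<in> H" using Y.submoduleE(4)[OF H] u by simp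
        then have "y i \<in> H"
          using u xc[OF i] yc[OF i] by (simp add: Y.smult_assoc1[symmetric])
        then have "y l \<in> H" if "l < m" for l using yH that by blast
        from combinations_subset[where y = y and m = m, OF Y H this] show "carrier Y \<subseteq> H"
          using y by (simp add: gen_by_def)
      qed
      from least[OF this] i show False by simp
    qed
  qed
qed

lemma submodule_reg_ideal:
  assumes H: "submodule H A (reg_mod A)"
  shows "ideal H A"
proof (rule idealI)
  interpret R: amod A "reg_mod A" by (rule amod.intro[OF module_reg_mod[OF is_cring]])
  note E = R.submoduleE[OF H]
  have sub: "H \<subseteq> carrier A" using E(1) by simp
  show "subgroup H (add_monoid A)"
  proof (rule add.subgroupI)
    fix a assume a: "a \<in> H"
    then have "\<ominus> a = (\<ominus> \<one>) \<otimes> a" using sub by (auto simp: l_minus)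
    then show "\<ominus> a \<in> H" using E(4)[of "\<ominus> \<one>" a] a by simp
  qed (use E in auto)
  show l: "x \<otimes> a \<in> H" if "a \<in> H" "x \<in> carrier A" for a x using E(4) that by auto
  show "a \<otimes> x \<in> H" if "a \<in> H" "x \<in> carrier A" for a x
    using l[OF that] m_comm[of a x] sub that by auto
qed (rule ring_axioms)

lemma ideal_gen_by:
  assumes "ideal J A"
  obtains m :: nat and y where "\<And>l. l < m \<Longrightarrow> y l \<in> J"
    "\<And>H. submodule H A (reg_mod A) \<Longrightarrow> (\<And>l. l < m \<Longrightarrow> y l \<in> H) \<Longrightarrow> J \<subseteq> H"
proof -
  obtain S where S: "S \<subseteq> carrier A" "finite S" "J = Idl S"
    using noetherian_ring.finetely_gen[OF noetherian assms] by blast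
  obtain xs where xs: "set xs = S" using finite_list[OF S(2)] by blast
  show thesis
  proof (rule that[of "length xs" "(!) xs"])
    show "xs ! l \<in> J" if "l < length xs" for l
      using that xs S(3) genideal_self[OF S(1)] by auto
    fix H assume H: "submodule H A (reg_mod A)" "\<And>l. l < length xs \<Longrightarrow> xs ! l \<in> H"
    have "ideal H A" using submodule_reg_ideal[OF H(1)] .
    moreover have "S \<subseteq> H" using H(2) xs by (metis in_set_conv_nth subsetI)
    ultimately show "J \<subseteq> H" unfolding S(3) by (rule genideal_minimal)
  qed
qed

text \<open>Submodules of a free module over a Noetherian ring are finitely generated, by induction
  on the number of coordinates that may be nonzero. The values of the last such coordinate form an
  ideal; lifts of its generators, together with generators of the submodule where that coordinate
  vanishes, suffice.\<close>

lemma submodule_free_gen_by: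
  assumes "k \<le> n" "submodule H A (free_mod A n)" "\<And>x i. x \<in> H \<Longrightarrow> k \<le> i \<Longrightarrow> i < n \<Longrightarrow> x i = \<zero>"
  shows "\<exists>m y. gen_by A ((free_mod A n)\<lparr>carrier := H\<rparr>) m y"
  using assms
proof (induction k arbitrary: H)
  case 0
  note mF = module_free_mod[OF is_cring]
  interpret F: amod A "free_mod A n" by (rule amod.intro[OF mF])
  have H0: "x = \<zero>\<^bsub>free_mod A n\<^esub>" if "x \<in> H" for x
    by (rule tuple_ext[of _ n "carrier A" _ "carrier A"]) (use that 0 F.submoduleE(1)[OF 0(2)] in auto)
  have mH: "module A ((free_mod A n)\<lparr>carrier := H\<rparr>)" by (rule submodule_module[OF mF 0(2)])
  have "gen_by A ((free_mod A n)\<lparr>carrier := H\<rparr>) 0 y" for y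
  proof (rule gen_byI[OF mH])
    fix L assume "submodule L A ((free_mod A n)\<lparr>carrier := H\<rparr>)"
    then have "\<zero>\<^bsub>free_mod A n\<^esub> \<in> L" using amod.submodule_zero[OF amod.intro[OF mH]] by auto
    then show "carrier ((free_mod A n)\<lparr>carrier := H\<rparr>) \<subseteq> L" using H0 by auto
  qed simp
  then show ?case by blast
next
  case (Suc k)
  note mF = module_free_mod[OF is_cring]
  interpret F: amod A "free_mod A n" by (rule amod.intro[OF mF])
  let ?FH = "(free_mod A n)\<lparr>carrier := H\<rparr>"
  have mH: "module A ?FH" using submodule_module[OF mF Suc(3)] .
  note E = F.submoduleE[OF Suc(3)]
  have k: "k < n" using Suc(2) by simp
  have lk: "lin A (free_mod A n) (reg_mod A) (\<lambda>x. x k)" by (rule linI) (use k in auto)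
  have lkH: "lin A ?FH (reg_mod A) (\<lambda>x. x k)" by (rule lin_subset[OF lk E(1)])
  interpret R: amod A "reg_mod A" by (rule amod.intro[OF module_reg_mod[OF is_cring]])
  define J where "J = (\<lambda>x. x k) ` H"
  have sJ: "submodule J A (reg_mod A)"
    unfolding J_def using lin_image_submodule[OF mF R.module_axioms lk Suc(3)] .
  have "ideal J A" using submodule_reg_ideal[OF sJ] .
  from ideal_gen_by[OF this] obtain m1 :: nat and y1 where y1: "\<And>l. l < m1 \<Longrightarrow> y1 l \<in> J"
    "\<And>H. submodule H A (reg_mod A) \<Longrightarrow> (\<And>l. l < m1 \<Longrightarrow> y1 l \<in> H) \<Longrightarrow> J \<subseteq> H"
    by blast
  have "\<forall>l. \<exists>x. l < m1 \<longrightarrow> x \<in> H \<and> x k = y1 l" using y1(1) unfolding J_def by (metis imageE)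
  then obtain x1 where x1: "\<And>l. l < m1 \<Longrightarrow> x1 l \<in> H \<and> x1 l k = y1 l" by metis
  define H' where "H' = {x \<in> carrier ?FH. x k = \<zero>\<^bsub>reg_mod A\<^esub>}"
  have "submodule H' A ?FH" unfolding H'_def
    by (rule lin_ker_submodule[OF mH R.module_axioms lkH])
  then have sH': "submodule H' A (free_mod A n)"
    using F.module_incl_imp_submodule[of H'] submodule_module[OF mH] E(1) by (auto simp: H'_def)
  have "x i = \<zero>" if "x \<in> H'" "k \<le> i" "i < n" for x i
    using that Suc(4)[of x i] by (cases "i = k") (auto simp: H'_def)
  then obtain m2 y2 where y2: "gen_by A ((free_mod A n)\<lparr>carrier := H'\<rparr>) m2 y2"
    using Suc(1)[of H'] sH' k by auto
  have y2c: "y2 l \<in> H'" if "l < m2" for l using y2 that by (simp add: gen_by_def)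
  define y where "y l = (if l < m1 then x1 l else y2 (l - m1))" for l
  have "gen_by A ?FH (m1 + m2) y"
  proof (rule gen_byI[OF mH])
    show "y l \<in> carrier ?FH" if "l < m1 + m2" for l
      using that x1[of l] y2c[of "l - m1"] by (auto simp: y_def H'_def)
    fix L assume L: "submodule L A ?FH" and yL: "\<And>l. l < m1 + m2 \<Longrightarrow> y l \<in> L"
    interpret FH: amod A ?FH by (rule amod.intro[OF mH])
    note EL = FH.submoduleE[OF L]
    have sL: "submodule L A (free_mod A n)"
      using F.module_incl_imp_submodule[of L] submodule_module[OF mH L] EL(1) E(1) by auto
    have "y2 l \<in> L" if "l < m2" for l using yL[of "m1 + l"] that by (simp add: y_def)
    then have "(\<lambda>x. msum (free_mod A n) (\<lambda>l. x l \<odot>\<^bsub>free_mod A n\<^esub> y2 l) m2) ` carrier (free_mod A m2) \<subseteq> L"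
      by (rule combinations_subset[OF mF sL])
    then have H'L: "H' \<subseteq> L" using y2 by (simp add: gen_by_def del: free_mod_simps)
    have "submodule ((\<lambda>x. x k) ` L) A (reg_mod A)"
      using lin_image_submodule[OF mF R.module_axioms lk sL] .
    moreover have "y1 l \<in> (\<lambda>x. x k) ` L" if "l < m1" for l
      using yL[of l] x1[OF that] that by (intro image_eqI[of _ _ "x1 l"]) (simp_all add: y_def)
    ultimately have JL: "J \<subseteq> (\<lambda>x. x k) ` L" by (rule y1(2))
    show "carrier ?FH \<subseteq> L"
    proof
      fix x assume "x \<in> carrier ?FH"
      then have x: "x \<in> H" by simp
      then have "x k \<in> J" by (simp add: J_def)
      with JL obtain z where z: "z \<in> L" "x k = z k" by auto
      have zH: "z \<in> H" using EL(1) z(1) by auto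
      have xc: "x \<in> carrier (free_mod A n)" and zc: "z \<in> carrier (free_mod A n)" using E(1) x zH by auto
      have d: "x \<ominus>\<^bsub>free_mod A n\<^esub> z \<in> H" using F.submodule_minus[OF Suc(3) x zH] .
      have zk: "z k \<in> carrier (reg_mod A)" using lin_closed[OF lk zc] .
      have "(x \<ominus>\<^bsub>free_mod A n\<^esub> z) k = \<zero>\<^bsub>reg_mod A\<^esub>"
        using lin_minus[OF mF R.module_axioms lk xc zc] z(2) R.minus_self[OF zk] by simp
      with d have "x \<ominus>\<^bsub>free_mod A n\<^esub> z \<in> L" using H'L by (auto simp: H'_def)
      then have "(x \<ominus>\<^bsub>free_mod A n\<^esub> z) \<oplus>\<^bsub>free_mod A n\<^esub> z \<in> L"
        using F.submoduleE(5)[OF sL] z(1) by blast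
      then show "x \<in> L" using F.minus_add_cancel'[OF xc zc] by simp
    qed
  qed
  then show ?case by blast
qed

lemma minimal_cover:
  assumes "module A Y" "gen_by A Y m0 y0"
  obtains m p where "p \<in> mod_hom A (free_mod A m) Y" "p ` carrier (free_mod A m) = carrier Y"
    "\<And>x i. x \<in> carrier (free_mod A m) \<Longrightarrow> p x = \<zero>\<^bsub>Y\<^esub> \<Longrightarrow> i < m \<Longrightarrow> x i \<in> max_ideal A"
proof -
  obtain m y where y: "gen_by A Y m y"
    "\<And>x i. x \<in> carrier (free_mod A m) \<Longrightarrow> msum Y (\<lambda>l. x l \<odot>\<^bsub>Y\<^esub> y l) m = \<zero>\<^bsub>Y\<^esub> \<Longrightarrow> i < m \<Longrightarrow> x i \<in> max_ideal A"
    using minimal_generators[OF assms] by blast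
  define p where "p = restrict (\<lambda>x. msum Y (\<lambda>l. x l \<odot>\<^bsub>Y\<^esub> y l) m) (carrier (free_mod A m))"
  have c: "y l \<in> carrier Y" if "l < m" for l using y(1) that by (simp add: gen_by_def)
  show thesis
  proof
    show "p \<in> mod_hom A (free_mod A m) Y"
      unfolding p_def by (rule lin_restrict[OF lin_of_tuple[OF assms(1) c] module_free_mod[OF is_cring]])
    show "p ` carrier (free_mod A m) = carrier Y"
      using y(1) by (simp add: p_def gen_by_def del: free_mod_simps)
    show "x i \<in> max_ideal A" if "x \<in> carrier (free_mod A m)" "p x = \<zero>\<^bsub>Y\<^esub>" "i < m" for x i
      using y(2)[OF that(1) _ that(3)] that(1,2) by (simp add: p_def del: free_mod_simps)
  qed
qed

lemma exists_minimal_free_resolution: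
  assumes "module A X" "gen_by A X m0 y0"
  shows "\<exists>F. is_minimal_free_resolution A X F"
proof -
  note mF = module_free_mod[OF is_cring]
  obtain c0 \<epsilon> where e: "\<epsilon> \<in> mod_hom A (free_mod A c0) X" "\<epsilon> ` carrier (free_mod A c0) = carrier X"
    "\<And>x i. x \<in> carrier (free_mod A c0) \<Longrightarrow> \<epsilon> x = \<zero>\<^bsub>X\<^esub> \<Longrightarrow> i < c0 \<Longrightarrow> x i \<in> max_ideal A"
    by (rule minimal_cover[OF assms]) blast
  \<comment> \<open>The resolution is built by dependent choice on pairs of a rank and the submodule
    still to be covered. Minimality is carried as an invariant: that submodule has all coordinates
    in the maximal ideal.\<close>
  define good where "good s \<longleftrightarrow> submodule (snd s) A (free_mod A (fst s)) \<and>
    (\<forall>x \<in> snd s. \<forall>i < fst s. x i \<in> max_ideal A)" for s :: "nat \<times> (nat \<Rightarrow> 'a) set"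
  define step where "step s s' \<longleftrightarrow> (\<exists>\<delta> \<in> mod_hom A (free_mod A (fst s')) (free_mod A (fst s)).
    \<delta> ` carrier (free_mod A (fst s')) = snd s \<and>
    snd s' = {x \<in> carrier (free_mod A (fst s')). \<delta> x = \<zero>\<^bsub>free_mod A (fst s)\<^esub>})"
    for s s' :: "nat \<times> (nat \<Rightarrow> 'a) set"
  define s0 where "s0 = (c0, {x \<in> carrier (free_mod A c0). \<epsilon> x = \<zero>\<^bsub>X\<^esub>})"
  have good0: "good s0"
    unfolding good_def s0_def using lin_ker_submodule[OF mF assms(1) mod_hom_lin[OF e(1)]] e(3) by auto
  have next_step: "\<exists>s'. good s' \<and> step s s'" if "good s" for s
  proof -
    let ?Y = "(free_mod A (fst s))\<lparr>carrier := snd s\<rparr>"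
    have sub: "submodule (snd s) A (free_mod A (fst s))" using that by (simp add: good_def)
    have mY: "module A ?Y" using submodule_module[OF mF sub] .
    have "\<exists>m y. gen_by A ?Y m y"
      by (rule submodule_free_gen_by[OF le_refl sub]) simp
    then obtain m1 y1 where g: "gen_by A ?Y m1 y1" by blast
    obtain c \<delta> where d: "\<delta> \<in> mod_hom A (free_mod A c) ?Y" "\<delta> ` carrier (free_mod A c) = carrier ?Y"
      "\<And>x i. x \<in> carrier (free_mod A c) \<Longrightarrow> \<delta> x = \<zero>\<^bsub>?Y\<^esub> \<Longrightarrow> i < c \<Longrightarrow> x i \<in> max_ideal A"
      by (rule minimal_cover[OF mY g]) blast
    have ld: "lin A (free_mod A c) (free_mod A (fst s)) \<delta>"
      using lin_codomain'[OF mod_hom_lin[OF d(1)] module.submoduleE(1)[OF mF sub]] .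
    have hd: "\<delta> \<in> mod_hom A (free_mod A c) (free_mod A (fst s))"
      using ld d(1) by (simp add: mod_hom_iff)
    let ?s' = "(c, {x \<in> carrier (free_mod A c). \<delta> x = \<zero>\<^bsub>free_mod A (fst s)\<^esub>})"
    have "good ?s'" unfolding good_def using lin_ker_submodule[OF mF mF ld] d(3) by simp
    moreover have "step s ?s'" unfolding step_def using hd d(2) by (intro bexI[of _ \<delta>]) auto
    ultimately show ?thesis by blast
  qed
  obtain f where f: "f 0 = s0" "\<And>n. good (f n)" "\<And>n. step (f n) (f (Suc n))"
    using dependent_nat_choice[of "\<lambda>n s. good s \<and> (n = 0 \<longrightarrow> s = s0)" "\<lambda>n. step"] good0 next_step
    by (metis nat.distinct(1))
  define c where "c n = fst (f n)" for n
  have "\<forall>n. \<exists>\<delta>. \<delta> \<in> mod_hom A (free_mod A (c (Suc n))) (free_mod A (c n)) \<and>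
    \<delta> ` carrier (free_mod A (c (Suc n))) = snd (f n) \<and>
    snd (f (Suc n)) = {x \<in> carrier (free_mod A (c (Suc n))). \<delta> x = \<zero>\<^bsub>free_mod A (c n)\<^esub>}"
    using f(3) unfolding step_def c_def by blast
  from choice[OF this] obtain \<delta> where \<delta>: "\<And>n. \<delta> n \<in> mod_hom A (free_mod A (c (Suc n))) (free_mod A (c n))"
    "\<And>n. \<delta> n ` carrier (free_mod A (c (Suc n))) = snd (f n)"
    "\<And>n. snd (f (Suc n)) = {x \<in> carrier (free_mod A (c (Suc n))). \<delta> n x = \<zero>\<^bsub>free_mod A (c n)\<^esub>}"
    by blast
  have c0: "c 0 = c0" and s0: "snd (f 0) = {x \<in> carrier (free_mod A c0). \<epsilon> x = \<zero>\<^bsub>X\<^esub>}"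
    by (simp_all add: c_def f(1) s0_def)
  have "left_resolution A X (\<lambda>n. free_mod A (c n)) \<delta> \<epsilon>"
    unfolding left_resolution_def a_kernel_def' using mF \<delta> e c0 s0 by (simp del: free_mod_simps)
  moreover have "\<forall>n. \<forall>x \<in> carrier (free_mod A (c (Suc n))). \<forall>i < c n. \<delta> n x i \<in> max_ideal A"
    using f(2) \<delta>(2) unfolding good_def c_def by (metis imageI)
  ultimately have "is_minimal_free_resolution A X (c, \<delta>, \<epsilon>)"
    by (simp add: is_minimal_free_resolution_def del: free_mod_simps)
  then show ?thesis by blast
qed

end

section \<open>Reducible complexity\<close>

lemma submodule_abelian_subgroup:
  fixes A :: "'a ring" and M :: "('a, 'm) module"
  assumes "module A M" "submodule H A M"
  shows "abelian_subgroup H M"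
  using assms by (auto intro!: abelian_subgroupI3 additive_subgroup.intro dest: module.axioms submodule.axioms)

lemma coset_mem:
  fixes A :: "'a ring" and M :: "('a, 'm) module"
  assumes "module A M" "submodule H A M" "x \<in> carrier M"
  shows "z \<in> H +>\<^bsub>M\<^esub> x \<longleftrightarrow> z \<in> carrier M \<and> z \<ominus>\<^bsub>M\<^esub> x \<in> H"
proof -
  interpret H: abelian_subgroup H M by (rule submodule_abelian_subgroup) fact+
  show ?thesis
    using H.a_rcos_module[OF assms(3), of z] H.a_elemrcos_carrier[OF assms(3), of z] by (auto simp: a_minus_def)
qed

lemma coset_eq:
  fixes A :: "'a ring" and M :: "('a, 'm) module"
  assumes "module A M" "submodule H A M" "x \<in> carrier M" "y \<in> carrier M"
  shows "H +>\<^bsub>M\<^esub> x = H +>\<^bsub>M\<^esub> y \<longleftrightarrow> x \<ominus>\<^bsub>M\<^esub> y \<in> H"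
proof -
  interpret H: abelian_subgroup H M by (rule submodule_abelian_subgroup) fact+
  have "H +>\<^bsub>M\<^esub> x = H +>\<^bsub>M\<^esub> y \<longleftrightarrow> x \<in> H +>\<^bsub>M\<^esub> y"
    using H.a_repr_independence'[of x y] H.a_rcos_self[OF assms(3)] assms(4) by blast
  then show ?thesis using coset_mem[OF assms(1,2,4)] assms(3) by simp
qed

lemma quot_mod_carrier: "carrier (quot_mod M H) = (\<lambda>x. H +>\<^bsub>M\<^esub> x) ` carrier M"
  by (auto simp: quot_mod_def A_RCOSETS_def')

lemma lin_quot_mod:
  fixes A :: "'a ring" and M :: "('a, 'm) module"
  assumes M: "module A M" and H: "submodule H A M"
  shows "lin A M (quot_mod M H) (\<lambda>x. H +>\<^bsub>M\<^esub> x)"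
proof (rule linI)
  interpret H: abelian_subgroup H M by (rule submodule_abelian_subgroup) fact+
  show "H +>\<^bsub>M\<^esub> x \<in> carrier (quot_mod M H)" if "x \<in> carrier M" for x
    using that by (simp add: quot_mod_carrier)
  show "H +>\<^bsub>M\<^esub> (x \<oplus>\<^bsub>M\<^esub> y) = (H +>\<^bsub>M\<^esub> x) \<oplus>\<^bsub>quot_mod M H\<^esub> (H +>\<^bsub>M\<^esub> y)"
    if "x \<in> carrier M" "y \<in> carrier M" for x y
    using H.a_rcos_sum[OF that] by (simp add: quot_mod_def)
next
  interpret M: amod A M by (rule amod.intro) fact
  note E = M.submoduleE[OF H]
  fix a x assume a: "a \<in> carrier A" and x: "x \<in> carrier M"
  have eq: "H +>\<^bsub>M\<^esub> (a \<odot>\<^bsub>M\<^esub> c) = H +>\<^bsub>M\<^esub> (a \<odot>\<^bsub>M\<^esub> x)" if c: "c \<in> H +>\<^bsub>M\<^esub> x" for c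
  proof -
    have c': "c \<in> carrier M" "c \<ominus>\<^bsub>M\<^esub> x \<in> H" using c coset_mem[OF M H x] by auto
    then have "a \<odot>\<^bsub>M\<^esub> c \<ominus>\<^bsub>M\<^esub> a \<odot>\<^bsub>M\<^esub> x \<in> H" using E(4)[OF a c'(2)] a x M.smult_minus_r by simp
    then show ?thesis using coset_eq[OF M H] a x c' by simp
  qed
  have x': "x \<in> H +>\<^bsub>M\<^esub> x" using coset_mem[OF M H x] x M.submodule_zero[OF H] by simp
  have "(\<Union>c\<in>H +>\<^bsub>M\<^esub> x. H +>\<^bsub>M\<^esub> (a \<odot>\<^bsub>M\<^esub> c)) = H +>\<^bsub>M\<^esub> (a \<odot>\<^bsub>M\<^esub> x)"
  proof (intro equalityI subsetI)
    fix z assume "z \<in> (\<Union>c\<in>H +>\<^bsub>M\<^esub> x. H +>\<^bsub>M\<^esub> (a \<odot>\<^bsub>M\<^esub> c))"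
    then obtain c where "c \<in> H +>\<^bsub>M\<^esub> x" "z \<in> H +>\<^bsub>M\<^esub> (a \<odot>\<^bsub>M\<^esub> c)" by blast
    then show "z \<in> H +>\<^bsub>M\<^esub> (a \<odot>\<^bsub>M\<^esub> x)" using eq by metis
  qed (use x' in blast)
  then show "H +>\<^bsub>M\<^esub> (a \<odot>\<^bsub>M\<^esub> x) = a \<odot>\<^bsub>quot_mod M H\<^esub> (H +>\<^bsub>M\<^esub> x)"
    by (simp add: quot_mod_def)
qed

text \<open>\<open>K\<close> is only an isomorphic copy of the quotient, as in the definition of
  \<open>red_cx\<close>; the projection is therefore followed by the inverse of the
  isomorphism.\<close>

lemma quot_iso_ses:
  fixes A :: "'a ring" and M :: "('a, 'm) module"
  assumes M: "module A M" and H: "submodule H A M" and K: "module A K" and iso: "mod_iso A K (quot_mod M H)"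
  obtains q where "ses A (M\<lparr>carrier := H\<rparr>) M K (\<lambda>x. x) q"
proof -
  interpret M: amod A M by (rule amod.intro) fact
  interpret K: amod A K by (rule amod.intro) fact
  note E = M.submoduleE[OF H]
  obtain g where g: "lin A K (quot_mod M H) g" "bij_betw g (carrier K) (carrier (quot_mod M H))"
    using iso mod_hom_lin unfolding mod_iso_def by blast
  note c = lin_quot_mod[OF M H]
  define q where "q v = inv_into (carrier K) g (H +>\<^bsub>M\<^esub> v)" for v
  have q: "q v \<in> carrier K" "g (q v) = H +>\<^bsub>M\<^esub> v" if "v \<in> carrier M" for v
    using lin_closed[OF c that] g(2) unfolding q_def
    by (auto simp: bij_betw_def inv_into_into f_inv_into_f)
  have inj: "x = y" if "g x = g y" "x \<in> carrier K" "y \<in> carrier K" for x y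
    using g(2) that by (auto simp: bij_betw_def inj_on_def)
  have lq: "lin A M K q"
  proof (rule linI)
    show "q x \<in> carrier K" if "x \<in> carrier M" for x using q that by simp
    show "q (x \<oplus>\<^bsub>M\<^esub> y) = q x \<oplus>\<^bsub>K\<^esub> q y" if "x \<in> carrier M" "y \<in> carrier M" for x y
      by (rule inj) (use that q lin_add[OF g(1)] lin_add[OF c] in auto)
    show "q (a \<odot>\<^bsub>M\<^esub> x) = a \<odot>\<^bsub>K\<^esub> q x" if "a \<in> carrier A" "x \<in> carrier M" for a x
      by (rule inj) (use that q lin_smult[OF g(1)] lin_smult[OF c] in auto)
  qed
  have onto: "q ` carrier M = carrier K"
  proof (intro equalityI subsetI)
    fix k assume k: "k \<in> carrier K"
    then have "g k \<in> carrier (quot_mod M H)" using lin_closed[OF g(1)] by blast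
    then obtain v where v: "v \<in> carrier M" "g k = H +>\<^bsub>M\<^esub> v" by (auto simp: quot_mod_carrier)
    then have "q v = k" using inj q k by metis
    then show "k \<in> q ` carrier M" using v(1) by blast
  qed (use q in auto)
  have ker: "q v = \<zero>\<^bsub>K\<^esub> \<longleftrightarrow> v \<in> H" if v: "v \<in> carrier M" for v
  proof -
    have 0: "q \<zero>\<^bsub>M\<^esub> = \<zero>\<^bsub>K\<^esub>" by (rule lin_zero[OF M K lq])
    have "q v = q \<zero>\<^bsub>M\<^esub> \<longleftrightarrow> H +>\<^bsub>M\<^esub> v = H +>\<^bsub>M\<^esub> \<zero>\<^bsub>M\<^esub>"
      using inj q v by (metis M.zero_closed)
    also have "\<dots> \<longleftrightarrow> v \<in> H" using coset_eq[OF M H v, of "\<zero>\<^bsub>M\<^esub>"] v by simp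
    finally show ?thesis using 0 by simp
  qed
  have "ses A (M\<lparr>carrier := H\<rparr>) M K (\<lambda>x. x) q"
    by (rule sesI[OF submodule_module[OF M H] M K _ lq])
      (use onto ker E(1) in \<open>auto simp: lin_def\<close>)
  then show thesis using that by blast
qed

context noeth_local_ring
begin

lemma minimal_resolution:
  assumes "fg_module A X"
  shows "left_resolution A X (res_mod A X) (res_diff A X) (snd (snd (minimal_free_resolution A X)))"
proof -
  have X: "module A X" "fin_gen A X" using assms by (auto simp: fg_module_def)
  obtain m y where "gen_by A X m y" using fin_gen_gen_by[OF X] by blast
  then have "\<exists>F. is_minimal_free_resolution A X F" by (rule exists_minimal_free_resolution[OF X(1)])
  then have "is_minimal_free_resolution A X (minimal_free_resolution A X)"
    unfolding minimal_free_resolution_def by (rule someI_ex)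
  then show ?thesis
    by (auto simp: is_minimal_free_resolution_def res_mod_def[abs_def] res_diff_def[abs_def] split_beta)
qed

lemma res_facts:
  assumes "fg_module A X"
  shows "module A (res_mod A X s)"
    and "lin A (res_mod A X (Suc s)) (res_mod A X s) (res_diff A X s)"
    and "res_image A X (Suc s) = {x \<in> carrier (res_mod A X (Suc s)). res_diff A X s x = \<zero>\<^bsub>res_mod A X s\<^esub>}"
    and "submodule (res_image A X s) A (res_mod A X s)"
proof -
  show m: "module A (res_mod A X s)" for s unfolding res_mod_def using module_free_mod is_cring by blast
  show l: "lin A (res_mod A X (Suc s)) (res_mod A X s) (res_diff A X s)" for s
    using minimal_resolution[OF assms] by (auto simp: left_resolution_def mod_hom_lin)
  show "res_image A X (Suc s) = {x \<in> carrier (res_mod A X (Suc s)). res_diff A X s x = \<zero>\<^bsub>res_mod A X s\<^esub>}"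
    using minimal_resolution[OF assms] by (auto simp: left_resolution_def res_image_def a_kernel_def')
  show "submodule (res_image A X s) A (res_mod A X s)"
    unfolding res_image_def by (rule lin_image_submodule[OF m m l module.carrier_is_submodule[OF m]])
qed

text \<open>\<open>K_mod\<close> chooses a representative with \<open>SOME\<close>, so existence
  must be shown. A cocycle in the class kills the image of the next differential and hence descends
  to the syzygy.\<close>

lemma exists_representative:
  fixes X :: "('a, 'm) module" and Y :: "('a, 'n) module"
  assumes X: "fg_module A X" and Y: "module A Y" and \<eta>: "\<eta> \<in> carrier (Ext A (Suc n) X Y)"
  shows "\<exists>f. represents A X Y (Suc n) \<eta> f"
proof -
  interpret Y: amod A Y by (rule amod.intro) fact
  note F = res_facts[OF X]
  let ?F = "res_mod A X (Suc n)" and ?I = "res_image A X (Suc n)"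
  let ?M = "(hom_mod A ?F Y)\<lparr>carrier := ext_cocycles A (Suc n) X Y\<rparr>"
  interpret Fn: amod A ?F by (rule amod.intro[OF F(1)])
  obtain g where g: "g \<in> ext_cocycles A (Suc n) X Y" "\<eta> = ext_coboundaries A (Suc n) X Y +>\<^bsub>?M\<^esub> g"
    using \<eta> by (auto simp: Ext_def quot_mod_carrier)
  have gh: "g \<in> mod_hom A ?F Y" and g0: "\<And>x. x \<in> ?I \<Longrightarrow> g x = \<zero>\<^bsub>Y\<^esub>"
    using g(1) by (auto simp: ext_cocycles_def res_image_def)
  note lg = mod_hom_lin[OF gh]
  \<comment> \<open>The zero map is a coboundary, so the coset of \<open>g\<close> contains
    \<open>g\<close> itself.\<close>
  have "(\<lambda>x\<in>carrier (res_mod A X n). \<zero>\<^bsub>Y\<^esub>) \<in> mod_hom A (res_mod A X n) Y"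
    by (rule lin_restrict[OF _ F(1)]) (auto simp: lin_def)
  then have "compose (carrier ?F) (\<lambda>x\<in>carrier (res_mod A X n). \<zero>\<^bsub>Y\<^esub>) (res_diff A X n) \<in> ext_coboundaries A (Suc n) X Y"
    by (simp only: ext_coboundaries.simps) (rule imageI)
  moreover have "compose (carrier ?F) (\<lambda>x\<in>carrier (res_mod A X n). \<zero>\<^bsub>Y\<^esub>) (res_diff A X n) = (\<lambda>x\<in>carrier ?F. \<zero>\<^bsub>Y\<^esub>)"
    using lin_closed[OF F(2)] by (auto simp: compose_def fun_eq_iff)
  ultimately have "(\<lambda>x\<in>carrier ?F. \<zero>\<^bsub>Y\<^esub>) \<in> ext_coboundaries A (Suc n) X Y" by simp
  moreover have "(\<lambda>x\<in>carrier ?F. (\<lambda>x\<in>carrier ?F. \<zero>\<^bsub>Y\<^esub>) x \<oplus>\<^bsub>Y\<^esub> g x) = g"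
    by (rule extensionalityI[of _ "carrier ?F"]) (use gh lin_closed[OF lg] in \<open>auto simp: mod_hom_iff\<close>)
  ultimately have g\<eta>: "g \<in> \<eta>"
    unfolding g(2) a_r_coset_def' by (intro UN_I[of "\<lambda>x\<in>carrier ?F. \<zero>\<^bsub>Y\<^esub>"]) auto
  let ?S = "syzygy A X (Suc n)"
  have S: "?S = quot_mod ?F ?I" by (simp add: syzygy_def)
  define c where "c x = ?I +>\<^bsub>?F\<^esub> x" for x
  have lc: "lin A ?F ?S c" unfolding S c_def using lin_quot_mod[OF F(1) F(4)] .
  have Sc: "carrier ?S = c ` carrier ?F" unfolding S c_def by (rule quot_mod_carrier)
  define f where "f = (\<lambda>C\<in>carrier ?S. g (SOME x. x \<in> carrier ?F \<and> C = c x))"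
  have fc: "f (c x) = g x" if x: "x \<in> carrier ?F" for x
  proof -
    define x' where "x' = (SOME x'. x' \<in> carrier ?F \<and> c x = c x')"
    have x': "x' \<in> carrier ?F" "c x = c x'"
      using someI_ex[of "\<lambda>x'. x' \<in> carrier ?F \<and> c x = c x'"] x by (auto simp: x'_def)
    then have "g (x \<ominus>\<^bsub>?F\<^esub> x') = \<zero>\<^bsub>Y\<^esub>"
      using coset_eq[OF F(1) F(4) x x'(1)] g0 by (simp add: c_def)
    then have "g x = g x'"
      using lin_minus[OF F(1) Y lg x x'(1)] Y.minus_zero_iff lin_closed[OF lg] x x'(1) by simp
    moreover have "c x \<in> carrier ?S" using lin_closed[OF lc x] .
    ultimately show ?thesis by (simp add: f_def x'_def)
  qed
  have "f \<in> mod_hom A ?S Y"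
    unfolding mod_hom_iff
  proof
    show "f \<in> extensional (carrier ?S)" by (simp add: f_def)
    show "lin A ?S Y f"
    proof (rule linI)
      show "f C \<in> carrier Y" if "C \<in> carrier ?S" for C
        using that lin_closed[OF lg] fc by (auto simp: Sc)
      fix C D assume "C \<in> carrier ?S" "D \<in> carrier ?S"
      then obtain x y where x: "x \<in> carrier ?F" "C = c x" and y: "y \<in> carrier ?F" "D = c y" by (auto simp: Sc)
      then show "f (C \<oplus>\<^bsub>?S\<^esub> D) = f C \<oplus>\<^bsub>Y\<^esub> f D"
        using fc[of "x \<oplus>\<^bsub>?F\<^esub> y"] fc by (simp add: lin_add[OF lc, symmetric] lin_add[OF lg])
    next
      fix a C assume a: "a \<in> carrier A" "C \<in> carrier ?S"
      then obtain x where x: "x \<in> carrier ?F" "C = c x" by (auto simp: Sc)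
      then show "f (a \<odot>\<^bsub>?S\<^esub> C) = a \<odot>\<^bsub>Y\<^esub> f C"
        using fc[of "a \<odot>\<^bsub>?F\<^esub> x"] fc a(1) by (simp add: lin_smult[OF lc, symmetric] lin_smult[OF lg])
    qed
  qed
  moreover have "(\<lambda>x\<in>carrier ?F. f (?I +>\<^bsub>?F\<^esub> x)) = g"
    by (rule extensionalityI[of _ "carrier ?F"]) (use gh fc in \<open>auto simp: mod_hom_iff c_def\<close>)
  ultimately show ?thesis using g\<eta> unfolding represents_def by auto
qed

end

context noeth_local_ring
begin

text \<open>A pushout is a cokernel: \<open>K\<close> is the quotient of X + F by a copy of the
  syzygy of order \<open>Suc n\<close>. This sequence is preferred to the one ending in the syzygy
  of order \<open>n\<close>, as it is what the definition of the pushout gives; the free summand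
  \<open>F\<close> does not affect the cohomology of \<open>S\<close>.\<close>

lemma K_mod_ses:
  fixes X :: "('a, 'm) module" and K :: "('a, 'k) module"
  assumes X: "fg_module A X" and \<eta>: "\<eta> \<in> carrier (Ext A (Suc n) X X)"
    and K: "module A K" and iso: "mod_iso A K (K_mod A X X (Suc n) \<eta>)"
  defines "F \<equiv> res_mod A X n"
  obtains H q g where "submodule H A (prod_mod X F)"
    "ses A ((prod_mod X F)\<lparr>carrier := H\<rparr>) (prod_mod X F) K (\<lambda>x. x) q"
    "lin A ((prod_mod X F)\<lparr>carrier := H\<rparr>) (res_syz (res_mod A X) (res_diff A X) n) g"
    "bij_betw g H (carrier (res_syz (res_mod A X) (res_diff A X) n))"
proof -
  note R = res_facts[OF X]
  have mX: "module A X" using X by (simp add: fg_module_def)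
  have mF: "module A F" unfolding F_def by (rule R)
  interpret X: amod A X by (rule amod.intro[OF mX])
  interpret F: amod A F by (rule amod.intro[OF mF])
  let ?F1 = "res_mod A X (Suc n)" and ?I = "res_image A X (Suc n)" and ?\<delta> = "res_diff A X n"
  interpret F1: amod A ?F1 by (rule amod.intro[OF R(1)])
  have l\<delta>: "lin A ?F1 F ?\<delta>" unfolding F_def by (rule R)
  let ?S = "syzygy A X (Suc n)" and ?P = "prod_mod X F"
  define c where "c x = ?I +>\<^bsub>?F1\<^esub> x" for x
  have lc: "lin A ?F1 ?S c" unfolding syzygy_def c_def using lin_quot_mod[OF R(1) R(4)] .
  have Sc: "carrier ?S = c ` carrier ?F1" unfolding syzygy_def c_def by (rule quot_mod_carrier)
  define f where "f = (SOME f. represents A X X (Suc n) \<eta> f)"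
  have "represents A X X (Suc n) \<eta> f"
    unfolding f_def using exists_representative[OF X mX \<eta>] by (rule someI_ex)
  then have lf: "lin A ?S X f" by (auto simp: represents_def mod_hom_lin)
  have l\<phi>: "lin A ?F1 X (\<lambda>x. f (c x))" by (rule lin_comp[OF lc lf])
  have incl: "syzygy_incl A X (Suc n) (c x) = ?\<delta> x" if x: "x \<in> carrier ?F1" for x
  proof -
    have const: "?\<delta> y = ?\<delta> x" if "y \<in> c x" for y
    proof -
      have y: "y \<in> carrier ?F1" "y \<ominus>\<^bsub>?F1\<^esub> x \<in> ?I"
        using that coset_mem[OF R(1) R(4) x] by (auto simp: c_def)
      have "?\<delta> (y \<ominus>\<^bsub>?F1\<^esub> x) = \<zero>\<^bsub>F\<^esub>" using y(2) by (simp add: R(3) F_def)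
      then have "?\<delta> y \<ominus>\<^bsub>F\<^esub> ?\<delta> x = \<zero>\<^bsub>F\<^esub>" using lin_minus[OF R(1) mF l\<delta> y(1) x] by simp
      then show ?thesis using F.minus_zero_iff lin_closed[OF l\<delta>] y(1) x by simp
    qed
    have xc: "x \<in> c x"
      using coset_mem[OF R(1) R(4) x] x F1.submodule_zero[OF R(4)] by (simp add: c_def)
    have "(THE y. \<exists>z\<in>c x. y = ?\<delta> z) = ?\<delta> x"
      by (rule the_equality) (use xc const in blast)+
    then show ?thesis using lin_closed[OF lc x] by (simp add: syzygy_incl_def)
  qed
  \<comment> \<open>The relations are parametrised by the free module above the syzygy, so no map
    out of a module of cosets has to be handled; the sign is that of \<open>pushout\<close>.\<close>
  define \<theta> where "\<theta> x = (f (c x), \<ominus>\<^bsub>F\<^esub> ?\<delta> x)" for x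
  have l\<theta>: "lin A ?F1 ?P \<theta>"
    by (rule linI)
      (auto simp: \<theta>_def lin_closed[OF l\<phi>] lin_closed[OF l\<delta>] lin_add[OF l\<phi>] lin_add[OF l\<delta>] lin_smult[OF l\<phi>]
        lin_smult[OF l\<delta>] F.M.minus_add F.smult_r_minus)
  define H where "H = \<theta> ` carrier ?F1"
  have mP: "module A ?P" by (rule module_prod_mod[OF mX mF])
  have sH: "submodule H A ?P"
    unfolding H_def by (rule lin_image_submodule[OF R(1) mP l\<theta> module.carrier_is_submodule[OF R(1)]])
  have "(\<lambda>z. (f z, \<ominus>\<^bsub>F\<^esub> syzygy_incl A X (Suc n) z)) ` carrier ?S = H"
    unfolding Sc H_def image_image by (rule image_cong) (auto simp: incl \<theta>_def)
  then have "K_mod A X X (Suc n) \<eta> = quot_mod ?P H"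
    by (simp add: K_mod_def pushout_def f_def F_def)
  with iso obtain q where q: "ses A (?P\<lparr>carrier := H\<rparr>) ?P K (\<lambda>x. x) q"
    using quot_iso_ses[OF mP sH K] by metis
  let ?O = "res_syz (res_mod A X) (res_diff A X) n"
  have Oc: "carrier ?O = ?\<delta> ` carrier ?F1" by (simp add: res_syz_def)
  define g where "g h = \<ominus>\<^bsub>F\<^esub> snd h" for h :: "'m \<times> (nat \<Rightarrow> 'a)"
  have g\<theta>: "g (\<theta> x) = ?\<delta> x" if "x \<in> carrier ?F1" for x
    using lin_closed[OF l\<delta> that] by (simp add: g_def \<theta>_def)
  have "lin A ?P F g"
    by (rule linI) (auto simp: g_def F.M.minus_add F.smult_r_minus)
  then have "lin A (?P\<lparr>carrier := H\<rparr>) F g" by (rule lin_subset) (use module.submoduleE(1)[OF mP sH] in simp)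
  moreover have gH: "g ` H = carrier ?O" unfolding H_def image_image Oc by (rule image_cong) (auto simp: g\<theta>)
  ultimately have lg: "lin A (?P\<lparr>carrier := H\<rparr>) ?O g"
    unfolding res_syz_def F_def using Oc by (intro lin_codomain) (auto simp: res_syz_def)
  \<comment> \<open>The second coordinate determines the first: equal values under the differential
    mean equal cosets, and \<open>f\<close> depends on the coset only.\<close>
  have "inj_on g H"
  proof (rule inj_onI)
    fix h h' assume "h \<in> H" "h' \<in> H" and eq: "g h = g h'"
    then obtain x y where x: "x \<in> carrier ?F1" "h = \<theta> x" and y: "y \<in> carrier ?F1" "h' = \<theta> y"
      by (auto simp: H_def)
    have "?\<delta> (x \<ominus>\<^bsub>?F1\<^esub> y) = \<zero>\<^bsub>F\<^esub>"
      using eq x y g\<theta> lin_closed[OF l\<delta> y(1)] by (simp add: lin_minus[OF R(1) mF l\<delta>])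
    then have "x \<ominus>\<^bsub>?F1\<^esub> y \<in> ?I" using x(1) y(1) by (simp add: R(3) F_def)
    then have "c x = c y" using coset_eq[OF R(1) R(4) x(1) y(1)] by (simp add: c_def)
    moreover have "?\<delta> x = ?\<delta> y" using eq x y g\<theta> by simp
    ultimately show "h = h'" using x y by (simp add: \<theta>_def)
  qed
  then have "bij_betw g H (carrier ?O)" using gH by (simp add: bij_betw_def)
  with that sH q lg show thesis by blast
qed

end

section \<open>Coefficient modules with vanishing cohomology, and induction along a
  reduction\<close>

context acyclic_complex
begin

text \<open>Lifting the identity of \<open>P\<close> through a map from a free module onto
  \<open>P\<close> makes \<open>P\<close> a retract of that free module.\<close>

lemma ex_all_projective:
  assumes "fin_gen A P" "projective_mod A P"
  shows "ex_all P"
proof -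
  have mP: "module A P" using assms(2) by (simp add: projective_mod_def)
  interpret P: amod A P by (rule amod.intro[OF mP])
  obtain m y where y: "gen_by A P m y" using fin_gen_gen_by[OF mP assms(1)] by blast
  let ?F = "free_mod A m" and ?h = "\<lambda>x :: nat \<Rightarrow> 'a. {x}"
  let ?p = "\<lambda>x. msum P (\<lambda>l. x l \<odot>\<^bsub>P\<^esub> y l) m"
  have h: "inj ?h" by (auto intro: injI)
  have lp: "lin A ?F P ?p" by (rule lin_of_tuple[OF mP]) (use y in \<open>simp add: gen_by_def\<close>)
  \<comment> \<open>Projectivity only speaks about modules on \<open>'a univ\<close>, so the free
    module is copied there before lifting.\<close>
  let ?C = "copy_mod ?h ?F"
  have mC: "module A ?C" by (rule module_copy_mod[OF module_free h])
  have li: "lin A ?C ?F (inv_into UNIV ?h)" by (rule lin_inv_copy_mod[OF h module_free])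
  define g where "g = restrict (\<lambda>x. ?p (inv_into UNIV ?h x)) (carrier ?C)"
  have g: "g \<in> mod_hom A ?C P" unfolding g_def by (rule lin_restrict[OF lin_comp[OF li lp] mC])
  have "g ` carrier ?C = carrier P"
  proof -
    have "g ` carrier ?C = ?p ` carrier ?F"
      unfolding g_def copy_mod_simps image_image by (rule image_cong) (auto simp: inv_f_f[OF h])
    then show ?thesis using y by (simp add: gen_by_def del: free_mod_simps)
  qed
  moreover have "restrict (\<lambda>x. x) (carrier P) \<in> mod_hom A P P" by (rule lin_restrict[OF lin_id mP])
  ultimately obtain l where l: "l \<in> mod_hom A P ?C" "\<forall>x \<in> carrier P. g (l x) = restrict (\<lambda>x. x) (carrier P) x"
    using assms(2) mC mP g unfolding projective_mod_def by meson
  have "?p (inv_into UNIV ?h (l x)) = x" if x: "x \<in> carrier P" for x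
    using bspec[OF l(2) x] x mod_hom_closed[OF l(1) x] by (simp add: g_def del: free_mod_simps copy_mod_simps)
  then have "exact_at P a S' b' T' c" if "mat A S'" "mat A T'" "exact_at ?F a S' b' T' c" for a S' b' T' c
    using exact_at_retract[OF mP module_free lin_comp[OF mod_hom_lin[OF l(1)] li] lp _ that] by blast
  then show ?thesis using ex_all_free[of m] mat_S unfolding ex_all_def ex_at_def by blast
qed

text \<open>Descending induction over the syzygies: those of index at least \<open>m\<close> are
  zero, and each cokernel inherits vanishing from the two modules to its left.\<close>

lemma ex_all_finite_proj_dim:
  fixes X :: "('a, 'm) module"
  assumes "module A X" "finite_proj_dim A X"
  shows "ex_all X"
proof -
  obtain P :: "nat \<Rightarrow> ('a, 'a univ) module" and \<delta> \<epsilon> m where res: "left_resolution A X P \<delta> \<epsilon>"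
    and P: "\<And>i. fin_gen A (P i)" "\<And>i. projective_mod A (P i)" and 0: "\<And>i. i > m \<Longrightarrow> zero_mod (P i)"
    using assms(2) unfolding finite_proj_dim_def by blast
  note s = left_resolution_ses[OF res assms(1)]
  have eP: "ex_all (P i)" for i by (rule ex_all_projective[OF P])
  have "ex_all (res_syz P \<delta> i)" if "i + k \<ge> m" for i k
    using that
  proof (induction k arbitrary: i)
    case 0
    interpret Y: amod A "res_syz P \<delta> i" by (rule amod.intro[OF s(1)])
    have "zero_mod (P (Suc i))" using 0 \<open>\<And>i. i > m \<Longrightarrow> zero_mod (P i)\<close> by simp
    then have "carrier (res_syz P \<delta> i) = {\<delta> i \<zero>\<^bsub>P (Suc i)\<^esub>}" by (simp add: res_syz_def zero_mod_def)
    then have "carrier (res_syz P \<delta> i) = {\<zero>\<^bsub>res_syz P \<delta> i\<^esub>}" using Y.zero_closed by simp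
    then show ?case unfolding ex_all_def ex_at_def
      by (intro allI exact_at_trivial[OF s(1) mat_S])
  next
    case (Suc k)
    then show ?case using ex_all_right[OF s(3)] eP by simp
  qed
  from this[of 0 m] show ?thesis using ex_all_right[OF s(2)] eP by simp
qed

lemma ses_prod:
  assumes "module A X" "module A Y"
  shows "ses A X (prod_mod X Y) Y (\<lambda>x. (x, \<zero>\<^bsub>Y\<^esub>)) snd"
proof -
  interpret X: amod A X by (rule amod.intro) fact
  interpret Y: amod A Y by (rule amod.intro) fact
  show ?thesis
  proof (rule sesI[OF assms(1) module_prod_mod[OF assms] assms(2)])
    show "snd ` carrier (prod_mod X Y) = carrier Y"
      using X.zero_closed by (auto simp: image_iff intro!: bexI[of _ "(\<zero>\<^bsub>X\<^esub>, _)"])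
  qed (auto simp: lin_def inj_on_def image_iff)
qed

end

locale gorenstein_complex = acyclic_complex A I d e n b S + noeth_local_ring A
  for A :: "'a ring" (structure) and I d e n b S
begin

text \<open>Dimension shifting through free modules, which have no cohomology in any degree. The
  shift is \<open>Suc s\<close> because \<open>res_syz\<close> with index \<open>s\<close> is the
  syzygy of that order.\<close>

lemma ex_at_res_syz:
  assumes "fg_module A X"
  shows "ex_at (res_syz (res_mod A X) (res_diff A X) s) (i + int (Suc s)) \<longleftrightarrow> ex_at X i"
proof -
  have mX: "module A X" using assms by (simp add: fg_module_def)
  note s = left_resolution_ses[OF minimal_resolution[OF assms] mX]
  have F: "ex_at (res_mod A X s) i" for s i using ex_all_free by (simp add: res_mod_def ex_all_def)
  show ?thesis
  proof (induction s)
    case 0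
    then show ?case using ex_at_left[OF s(2)] ex_at_right[OF s(2)] F by auto
  next
    case (Suc s)
    have "ex_at (res_syz (res_mod A X) (res_diff A X) (Suc s)) (i + int (Suc s) + 1)
      \<longleftrightarrow> ex_at (res_syz (res_mod A X) (res_diff A X) s) (i + int (Suc s))"
      using ex_at_left[OF s(3)] ex_at_right[OF s(3)] F by blast
    then show ?case using Suc by (simp add: algebra_simps)
  qed
qed

text \<open>In \<open>K_mod_ses\<close> the middle term has the cohomology of \<open>X\<close>, and
  the left term has that of \<open>X\<close> shifted by the degree of \<eta>. Only these two facts
  enter the induction.\<close>

lemma reduction_ses:
  fixes X :: "('a, 'm) module" and K :: "('a, 'k) module"
  assumes X: "fg_module A X" and "\<eta> \<in> carrier (Ext A (Suc m) X X)"
    and "module A K" and "mod_iso A K (K_mod A X X (Suc m) \<eta>)"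
  obtains H P :: "('a, 'm \<times> (nat \<Rightarrow> 'a)) module" and q where "ses A H P K (\<lambda>x. x) q"
    "\<And>i. ex_at P i \<longleftrightarrow> ex_at X i" "\<And>i. ex_at H (i + int (Suc m)) \<longleftrightarrow> ex_at X i"
proof -
  let ?F = "res_mod A X m" and ?O = "res_syz (res_mod A X) (res_diff A X) m"
  have mX: "module A X" using X by (simp add: fg_module_def)
  have mF: "module A ?F" by (rule res_facts[OF X])
  have F: "ex_at ?F i" for i using ex_all_free by (simp add: res_mod_def ex_all_def)
  obtain H q g where H: "submodule H A (prod_mod X ?F)"
    "ses A ((prod_mod X ?F)\<lparr>carrier := H\<rparr>) (prod_mod X ?F) K (\<lambda>x. x) q"
    "lin A ((prod_mod X ?F)\<lparr>carrier := H\<rparr>) ?O g" "bij_betw g H (carrier ?O)"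
    using K_mod_ses[OF assms] by blast
  have mO: "module A ?O" by (rule left_resolution_ses(1)[OF minimal_resolution[OF X] mX])
  have "ex_at (prod_mod X ?F) j \<longleftrightarrow> ex_at X j" for j
    using ex_at_left[OF ses_prod[OF mX mF], of "j - 1"] ex_at_middle[OF ses_prod[OF mX mF]] F by auto
  moreover have "ex_at ((prod_mod X ?F)\<lparr>carrier := H\<rparr>) j \<longleftrightarrow> ex_at ?O j" for j
    by (rule ex_at_iso[OF submodule_module[OF module_prod_mod[OF mX mF] H(1)] mO H(3)]) (use H(4) in simp)
  ultimately show thesis using that[OF H(2)] ex_at_res_syz[OF X] by simp
qed

text \<open>Along the reduction only the exact sequence of \<open>K\<^sub>\<eta>\<close> matters: vanishing in large degrees is
  propagated to all degrees by periodicity.\<close>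

lemma red_cx_ex_all:
  assumes "red_cx A X" "\<And>i. i \<ge> i0 \<Longrightarrow> ex_at X i"
  shows "ex_all X"
  using assms
proof (induction arbitrary: i0)
  case (finite_pd X)
  then show ?case by (intro ex_all_finite_proj_dim) (simp_all add: fg_module_def)
next
  case (reduce X m \<eta> K)
  obtain m' where m: "m = Suc m'" using \<open>0 < m\<close> by (cases m) auto
  have fgK: "module A K" using \<open>red_cx A K\<close> by cases (auto simp: fg_module_def)
  obtain H P :: "('a, (nat \<Rightarrow> 'a) set \<times> (nat \<Rightarrow> 'a)) module" and q where s: "ses A H P K (\<lambda>x. x) q"
    and P: "\<And>i. ex_at P i \<longleftrightarrow> ex_at X i" and H: "\<And>i. ex_at H (i + int m) \<longleftrightarrow> ex_at X i"
    using reduction_ses[OF \<open>fg_module A X\<close> _ fgK] reduce(5,8) unfolding m by blast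
  \<comment> \<open>The degree of \<eta> is added to the bound because \<open>H\<close> at
    \<open>i + 1\<close> corresponds to \<open>X\<close> at \<open>i + 1 - int m\<close>.\<close>
  have "ex_at K i" if i: "i \<ge> i0 + int m" for i
  proof (rule ex_at_right[OF s])
    show "ex_at P i" using P reduce.prems i by simp
    show "ex_at H (i + 1)" using H[of "i + 1 - int m"] reduce.prems i by simp
  qed
  then have "ex_all K" by (rule reduce.IH)
  then have K: "ex_at K i" for i by (simp add: ex_all_def)
  \<comment> \<open>Once \<open>K\<close> has no cohomology at all, \<open>P\<close> and
    \<open>H\<close> agree in every degree, which is periodicity of \<open>X\<close> with period
    \<open>m\<close>.\<close>
  have "ex_at P i \<longleftrightarrow> ex_at H i" for i
    using ex_at_left[OF s, of "i - 1"] ex_at_middle[OF s] K by auto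
  then have per: "ex_at X (i + int m) \<longleftrightarrow> ex_at X i" for i
    using P H by simp
  have "ex_at X i" if "i + int k * int m \<ge> i0" for i k
    using that
  proof (induction k arbitrary: i)
    case 0
    then show ?case using reduce.prems by simp
  next
    case (Suc k)
    then have "ex_at X (i + int m)" by (simp add: algebra_simps)
    then show ?case using per by simp
  qed
  \<comment> \<open>As \<open>m\<close> is at least 1, \<open>i0 - i\<close> periods suffice to
    climb from \<open>i\<close> to the range where vanishing is assumed.\<close>
  moreover have "i + int (nat (i0 - i)) * int m \<ge> i0" for i
  proof -
    have "int (nat (i0 - i)) * 1 \<le> int (nat (i0 - i)) * int m"
      by (rule mult_left_mono) (use m in auto)
    then show ?thesis by linarith
  qed
  ultimately show ?case unfolding ex_all_def by blast
qed

end

section \<open>Vanishing of Ext\<close>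

lemma lin_eq_matmap:
  fixes A :: "'a ring"
  assumes "cring A" "lin A (free_mod A n) (free_mod A m) d" "x \<in> carrier (free_mod A n)"
  shows "d x = matmap A m n (free_mat A m n d) x"
proof (rule tuple_ext)
  show "d x \<in> {..<m} \<rightarrow>\<^sub>E carrier A" using lin_closed[OF assms(2,3)] by simp
  show "matmap A m n (free_mat A m n d) x \<in> {..<m} \<rightarrow>\<^sub>E carrier A"
    using lin_closed[OF lin_matmap[OF assms(1) mat_free_mat[OF assms(1,2)]] assms(3)] by simp
  show "d x k = matmap A m n (free_mat A m n d) x k" if "k < m" for k
    using free_mat_eq[OF assms that] that by (simp add: matmap_def)
qed

lemma free_maps_exact:
  fixes A :: "'a ring"
  assumes A: "cring A" and S: "mat A S" and T: "mat A T"
    and p: "\<And>x. x \<in> carrier (free_mod A a) \<Longrightarrow> p x = matmap A b a S x"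
    and q: "\<And>x. x \<in> carrier (free_mod A b) \<Longrightarrow> q x = matmap A c b T x"
    and ker: "p ` carrier (free_mod A a) = {x \<in> carrier (free_mod A b). q x = \<zero>\<^bsub>free_mod A c\<^esub>}"
  shows "zprod A c T b S a" and "exact_at (reg_mod A) a S b T c"
proof -
  interpret cring A by fact
  show "zprod A c T b S a"
    unfolding zprod_def
  proof (intro allI impI)
    fix k j assume k: "k < c" and j: "j < a"
    have u: "uvec A a j \<in> carrier (free_mod A a)" using A by simp
    have x: "p (uvec A a j) \<in> carrier (free_mod A b)" "q (p (uvec A a j)) = \<zero>\<^bsub>free_mod A c\<^esub>"
      using ker u by blast+
    have "mact (reg_mod A) b T (p (uvec A a j)) k = \<zero>\<^bsub>A\<^esub>"
      using fun_cong[OF x(2), of k] k unfolding q[OF x(1)] by (simp add: matmap_def)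
    moreover have "mact (reg_mod A) b T (p (uvec A a j)) k
        = msum (reg_mod A) (\<lambda>l. T k l \<otimes>\<^bsub>A\<^esub> S l j) b"
      unfolding mact_def p[OF u] by (rule msum_cong) (simp add: matmap_def mact_reg_uvec[OF A S j])
    ultimately show "msum (reg_mod A) (\<lambda>l. T k l \<otimes>\<^bsub>A\<^esub> S l j) b = \<zero>\<^bsub>A\<^esub>" by simp
  qed
  show "exact_at (reg_mod A) a S b T c"
  proof (rule exact_atI)
    fix y assume y: "\<And>k. y k \<in> carrier (reg_mod A)"
      and 0: "\<And>k. k < c \<Longrightarrow> mact (reg_mod A) b T y k = \<zero>\<^bsub>reg_mod A\<^esub>"
    let ?x = "restrict y {..<b}"
    have x: "?x \<in> carrier (free_mod A b)" using y by simp
    have "mact (reg_mod A) b T ?x k = mact (reg_mod A) b T y k" for k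
      by (rule mact_cong) simp
    then have "q ?x = \<zero>\<^bsub>free_mod A c\<^esub>"
      unfolding q[OF x] using 0 by (auto simp: matmap_def intro!: restrict_ext)
    then obtain v where v: "v \<in> carrier (free_mod A a)" "?x = p v" using ker x by blast
    let ?z = "\<lambda>l. if l < a then v l else \<zero>\<^bsub>A\<^esub>"
    have "y k = mact (reg_mod A) a S ?z k" if k: "k < b" for k
    proof -
      have "y k = mact (reg_mod A) a S v k"
        using fun_cong[OF v(2), of k] k unfolding p[OF v(1)] by (simp add: matmap_def)
      also have "\<dots> = mact (reg_mod A) a S ?z k" by (rule mact_cong) simp
      finally show ?thesis .
    qed
    moreover have "?z k \<in> carrier (reg_mod A)" for k using v(1) by auto
    ultimately show "\<exists>z. (\<forall>k. z k \<in> carrier (reg_mod A)) \<and> (\<forall>k<b. y k = mact (reg_mod A) a S z k)"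
      by (intro exI[of _ ?z]) blast
  qed
qed

lemma free_resolution_matrices:
  fixes A :: "'a ring"
  assumes A: "cring A" and res: "left_resolution A X (\<lambda>s. free_mod A (c s)) \<delta> \<epsilon>"
  defines "E \<equiv> \<lambda>s. free_mat A (c s) (c (Suc s)) (\<delta> s)"
  shows "mat A (E s)"
    and "x \<in> carrier (free_mod A (c (Suc s))) \<Longrightarrow> \<delta> s x = matmap A (c s) (c (Suc s)) (E s) x"
    and "zprod_res A c E s"
    and "exact_res (reg_mod A) c E s"
proof -
  from res have l: "lin A (free_mod A (c (Suc s))) (free_mod A (c s)) (\<delta> s)"
    and ker: "\<delta> (Suc s) ` carrier (free_mod A (c (Suc (Suc s))))
      = {x \<in> carrier (free_mod A (c (Suc s))). \<delta> s x = \<zero>\<^bsub>free_mod A (c s)\<^esub>}" for s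
    by (auto simp: left_resolution_def mod_hom_lin a_kernel_def')
  show mE: "mat A (E s)" for s unfolding E_def by (rule mat_free_mat[OF A l])
  show \<delta>: "\<delta> s x = matmap A (c s) (c (Suc s)) (E s) x" if x: "x \<in> carrier (free_mod A (c (Suc s)))" for s x
    unfolding E_def by (rule lin_eq_matmap[OF A l x])
  show "zprod_res A c E s"
    by (rule free_maps_exact(1)[OF A mE mE \<delta> \<delta> ker])
  show "exact_res (reg_mod A) c E s"
    by (rule free_maps_exact(2)[OF A mE mE \<delta> \<delta> ker])
qed

text \<open>Maps out of a free module are tuples of values on unit vectors, under which cocycles
  become the kernel and coboundaries the image of transposed matrices.\<close>

lemma (in noeth_local_ring) zero_Ext_iff:
  fixes X :: "('a, 'm) module" and Y :: "('a, 'n) module"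
  assumes X: "fg_module A X" and Y: "module A Y"
  defines "c \<equiv> fst (minimal_free_resolution A X)"
  defines "E \<equiv> \<lambda>s. free_mat A (c s) (c (Suc s)) (res_diff A X s)"
  shows "zero_mod (Ext A (Suc n) X Y) \<longleftrightarrow>
    exact_dual Y c E n"
proof -
  interpret Y: amod A Y by (rule amod.intro) fact
  have F: "res_mod A X = (\<lambda>s. free_mod A (c s))" by (simp add: res_mod_def[abs_def] c_def)
  note R = res_facts[OF X, unfolded F]
  note l = R(2)
  let ?F1 = "free_mod A (c (Suc n))" and ?F0 = "free_mod A (c n)" and ?F2 = "free_mod A (c (Suc (Suc n)))"
  let ?\<delta> = "res_diff A X"
  define Z where "Z = ext_cocycles A (Suc n) X Y"
  define B where "B = ext_coboundaries A (Suc n) X Y"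
  have Z: "f \<in> Z \<longleftrightarrow> f \<in> mod_hom A ?F1 Y \<and> (\<forall>x \<in> carrier ?F2. f (?\<delta> (Suc n) x) = \<zero>\<^bsub>Y\<^esub>)" for f
    by (simp add: Z_def ext_cocycles_def F)
  have B: "f \<in> B \<longleftrightarrow> f \<in> mod_hom A ?F1 Y \<and> (\<exists>g \<in> mod_hom A ?F0 Y. \<forall>x \<in> carrier ?F1. f x = g (?\<delta> n x))" for f
  proof -
    have comp: "compose (carrier ?F1) g (?\<delta> n) \<in> mod_hom A ?F1 Y" if "g \<in> mod_hom A ?F0 Y" for g
      unfolding compose_def by (rule lin_restrict[OF lin_comp[OF l mod_hom_lin[OF that]] R(1)])
    show ?thesis
    proof
      assume "f \<in> B"
      then obtain g where g: "g \<in> mod_hom A ?F0 Y" "f = compose (carrier ?F1) g (?\<delta> n)"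
        unfolding B_def ext_coboundaries.simps F by blast
      have "\<forall>x \<in> carrier ?F1. f x = g (?\<delta> n x)" unfolding g(2) by (simp add: compose_def)
      then show "f \<in> mod_hom A ?F1 Y \<and> (\<exists>g \<in> mod_hom A ?F0 Y. \<forall>x \<in> carrier ?F1. f x = g (?\<delta> n x))"
        using comp[OF g(1)] g by blast
    next
      assume "f \<in> mod_hom A ?F1 Y \<and> (\<exists>g \<in> mod_hom A ?F0 Y. \<forall>x \<in> carrier ?F1. f x = g (?\<delta> n x))"
      then obtain g where f: "f \<in> mod_hom A ?F1 Y" and g: "g \<in> mod_hom A ?F0 Y" "\<forall>x \<in> carrier ?F1. f x = g (?\<delta> n x)"
        by blast
      have "f = compose (carrier ?F1) g (?\<delta> n)"
        by (rule mod_hom_ext[OF f comp[OF g(1)]]) (use g(2) in \<open>simp add: compose_def\<close>)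
      then show "f \<in> B" unfolding B_def ext_coboundaries.simps F using g(1) by blast
    qed
  qed
  have d0: "?\<delta> n (?\<delta> (Suc n) x) = \<zero>\<^bsub>?F0\<^esub>" if "x \<in> carrier ?F2" for x
    using R(3)[of n] that unfolding res_image_def F by blast
  have BZ: "B \<subseteq> Z"
  proof
    fix f assume "f \<in> B"
    then obtain g where g: "f \<in> mod_hom A ?F1 Y" "g \<in> mod_hom A ?F0 Y" "\<And>x. x \<in> carrier ?F1 \<Longrightarrow> f x = g (?\<delta> n x)"
      by (auto simp: B simp del: free_mod_simps)
    have "f (?\<delta> (Suc n) x) = \<zero>\<^bsub>Y\<^esub>" if "x \<in> carrier ?F2" for x
      using g(3)[OF lin_closed[OF l that]] d0[OF that] lin_zero[OF R(1) Y mod_hom_lin[OF g(2)]] by simp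
    with g(1) show "f \<in> Z" by (simp add: Z)
  qed
  interpret Hm: amod A "hom_mod A ?F1 Y" by (rule amod.intro[OF module_hom_mod[OF R(1) Y]])
  have sB: "submodule B A (hom_mod A ?F1 Y)"
  proof -
    have "lin A (hom_mod A ?F0 Y) (hom_mod A ?F1 Y) (\<lambda>g. compose (carrier ?F1) g (?\<delta> n))"
    proof (rule linI)
      show "compose (carrier ?F1) g (?\<delta> n) \<in> carrier (hom_mod A ?F1 Y)" if "g \<in> carrier (hom_mod A ?F0 Y)" for g
        unfolding compose_def hom_mod_simps
        by (rule lin_restrict[OF lin_comp[OF l mod_hom_lin] R(1)]) (use that in simp)
    qed (use lin_closed[OF l] in \<open>auto simp: compose_def fun_eq_iff simp del: free_mod_simps\<close>)
    from lin_image_submodule[OF module_hom_mod[OF R(1) Y] Hm.module_axioms this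
        module.carrier_is_submodule[OF module_hom_mod[OF R(1) Y]]]
    show ?thesis by (simp add: B_def F)
  qed
  have lin0: "\<zero>\<^bsub>hom_mod A ?F1 Y\<^esub> \<in> B" by (rule Hm.submodule_zero[OF sB])
  let ?M = "(hom_mod A ?F1 Y)\<lparr>carrier := Z\<rparr>"
  have "zero_mod (Ext A (Suc n) X Y) \<longleftrightarrow> (\<lambda>f. B +>\<^bsub>?M\<^esub> f) ` Z = {B}"
  proof -
    have "carrier (Ext A (Suc n) X Y) = (\<lambda>f. B +>\<^bsub>?M\<^esub> f) ` Z"
      by (simp add: Ext_def quot_mod_carrier F Z_def B_def)
    moreover have "\<zero>\<^bsub>Ext A (Suc n) X Y\<^esub> = B" by (simp add: Ext_def quot_mod_def B_def)
    ultimately show ?thesis by (simp add: zero_mod_def)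
  qed
  also have "(\<lambda>f. B +>\<^bsub>?M\<^esub> f) = (\<lambda>f. B +>\<^bsub>hom_mod A ?F1 Y\<^esub> f)"
    by (simp add: fun_eq_iff a_r_coset_def')
  \<comment> \<open>The quotient is zero iff every cocycle has the coset of zero.\<close>
  also have "(\<lambda>f. B +>\<^bsub>hom_mod A ?F1 Y\<^esub> f) ` Z = {B} \<longleftrightarrow> Z \<subseteq> B"
  proof -
    have cos: "B +>\<^bsub>hom_mod A ?F1 Y\<^esub> f = B \<longleftrightarrow> f \<in> B" if f: "f \<in> Z" for f
    proof -
      have fc: "f \<in> carrier (hom_mod A ?F1 Y)" using f by (simp add: Z)
      have "B +>\<^bsub>hom_mod A ?F1 Y\<^esub> \<zero>\<^bsub>hom_mod A ?F1 Y\<^esub> = B"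
        by (rule Hm.a_coset_add_zero[OF Hm.submoduleE(1)[OF sB]])
      then show ?thesis
        using coset_eq[OF Hm.module_axioms sB fc Hm.M.zero_closed] Hm.minus_zero_right[OF fc] by metis
    qed
    have "Z \<noteq> {}" using BZ lin0 by blast
    then show ?thesis using cos by (auto simp: image_iff)
  qed
  also have "Z \<subseteq> B \<longleftrightarrow> exact_dual Y c E n"
  proof
    assume ZB: "Z \<subseteq> B"
    show "exact_dual Y c E n"
    proof (rule exact_atI)
      fix y assume y: "\<And>k. y k \<in> carrier Y"
        and 0: "\<And>k. k < c (Suc (Suc n)) \<Longrightarrow> mact Y (c (Suc n)) (tr (E (Suc n))) y k = \<zero>\<^bsub>Y\<^esub>"
      define f where "f = restrict (\<lambda>x. msum Y (\<lambda>l. x l \<odot>\<^bsub>Y\<^esub> y l) (c (Suc n))) (carrier ?F1)"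
      have f: "f \<in> mod_hom A ?F1 Y" unfolding f_def by (rule lin_restrict[OF lin_of_tuple[OF Y y] R(1)])
      have fu: "f (uvec A (c (Suc n)) k) = y k" if "k < c (Suc n)" for k
        using of_tuple_uvec[OF Y y that] is_cring by (simp add: f_def)
      have "f (?\<delta> (Suc n) x) = \<zero>\<^bsub>Y\<^esub>" if x: "x \<in> carrier ?F2" for x
      proof -
        have "f (?\<delta> (Suc n) x) = msum Y (\<lambda>j. x j \<odot>\<^bsub>Y\<^esub> f (?\<delta> (Suc n) (uvec A (c (Suc (Suc n))) j))) (c (Suc (Suc n)))"
          by (rule lin_free_eq[OF Y lin_comp[OF l mod_hom_lin[OF f]] x])
        also have "\<dots> = \<zero>\<^bsub>Y\<^esub>"
        proof (rule Y.msum_zero)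
          fix j assume j: "j < c (Suc (Suc n))"
          have "f (?\<delta> (Suc n) (uvec A (c (Suc (Suc n))) j)) = mact Y (c (Suc n)) (tr (E (Suc n))) (\<lambda>k. f (uvec A (c (Suc n)) k)) j"
            unfolding E_def by (rule comp_free_mat[OF Y l mod_hom_lin[OF f] j])
          also have "\<dots> = mact Y (c (Suc n)) (tr (E (Suc n))) y j" by (rule mact_cong) (rule fu)
          finally show "x j \<odot>\<^bsub>Y\<^esub> f (?\<delta> (Suc n) (uvec A (c (Suc (Suc n))) j)) = \<zero>\<^bsub>Y\<^esub>"
            using 0[OF j] x j by (simp add: PiE_closed)
        qed
        finally show ?thesis .
      qed
      then have "f \<in> Z" using f unfolding Z by blast
      then have "f \<in> B" using ZB by blast
      then obtain g where g: "g \<in> mod_hom A ?F0 Y" "\<And>x. x \<in> carrier ?F1 \<Longrightarrow> f x = g (?\<delta> n x)"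
        unfolding B by blast
      have "y k = mact Y (c n) (tr (E n)) (\<lambda>j. g (uvec A (c n) j)) k" if k: "k < c (Suc n)" for k
      proof -
        have "y k = g (?\<delta> n (uvec A (c (Suc n)) k))" using fu[OF k] g(2) is_cring by simp
        then show ?thesis unfolding E_def using comp_free_mat[OF Y l mod_hom_lin[OF g(1)] k] by simp
      qed
      moreover have "g (uvec A (c n) j) \<in> carrier Y" for j using mod_hom_closed[OF g(1)] is_cring by simp
      ultimately show "\<exists>z. (\<forall>k. z k \<in> carrier Y) \<and> (\<forall>k<c (Suc n). y k = mact Y (c n) (tr (E n)) z k)"
        by (intro exI[of _ "\<lambda>j. g (uvec A (c n) j)"]) blast
    qed
  next
    assume ex: "exact_dual Y c E n"
    show "Z \<subseteq> B"
    proof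
      fix f assume "f \<in> Z"
      then have f: "f \<in> mod_hom A ?F1 Y" and f0: "\<And>x. x \<in> carrier ?F2 \<Longrightarrow> f (?\<delta> (Suc n) x) = \<zero>\<^bsub>Y\<^esub>"
        by (auto simp: Z simp del: free_mod_simps)
      let ?y = "\<lambda>k. f (uvec A (c (Suc n)) k)"
      have y: "?y k \<in> carrier Y" for k using mod_hom_closed[OF f] is_cring by simp
      have "mact Y (c (Suc n)) (tr (E (Suc n))) ?y j = \<zero>\<^bsub>Y\<^esub>" if j: "j < c (Suc (Suc n))" for j
        unfolding E_def comp_free_mat[OF Y l mod_hom_lin[OF f] j, symmetric]
        by (rule f0) (use is_cring in simp)
      then obtain z where z: "\<And>k. z k \<in> carrier Y" "\<And>k. k < c (Suc n) \<Longrightarrow> ?y k = mact Y (c n) (tr (E n)) z k"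
        using exact_atE[OF ex, of ?y] y by blast
      define g where "g = restrict (\<lambda>x. msum Y (\<lambda>l. x l \<odot>\<^bsub>Y\<^esub> z l) (c n)) (carrier ?F0)"
      have g: "g \<in> mod_hom A ?F0 Y" unfolding g_def by (rule lin_restrict[OF lin_of_tuple[OF Y z(1)] R(1)])
      have gu: "g (uvec A (c n) k) = z k" if "k < c n" for k
        using of_tuple_uvec[OF Y z(1) that] is_cring by (simp add: g_def)
      have gd: "g (?\<delta> n (uvec A (c (Suc n)) k)) = ?y k" if k: "k < c (Suc n)" for k
      proof -
        have "g (?\<delta> n (uvec A (c (Suc n)) k)) = mact Y (c n) (tr (E n)) (\<lambda>j. g (uvec A (c n) j)) k"
          unfolding E_def by (rule comp_free_mat[OF Y l mod_hom_lin[OF g] k])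
        also have "\<dots> = mact Y (c n) (tr (E n)) z k" by (rule mact_cong) (rule gu)
        finally show ?thesis using z(2)[OF k] by simp
      qed
      have "f x = g (?\<delta> n x)" if x: "x \<in> carrier ?F1" for x
      proof -
        have "g (?\<delta> n x) = msum Y (\<lambda>k. x k \<odot>\<^bsub>Y\<^esub> g (?\<delta> n (uvec A (c (Suc n)) k))) (c (Suc n))"
          by (rule lin_free_eq[OF Y lin_comp[OF l mod_hom_lin[OF g]] x])
        also have "\<dots> = msum Y (\<lambda>k. x k \<odot>\<^bsub>Y\<^esub> ?y k) (c (Suc n))"
          by (rule msum_cong) (simp add: gd)
        also have "\<dots> = f x" by (rule lin_free_eq[OF Y mod_hom_lin[OF f] x, symmetric])
        finally show ?thesis ..
      qed
      with f g show "f \<in> B" unfolding B by blast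
    qed
  qed
  finally show ?thesis .
qed

text \<open>Every functional on the image module is pairing with some vector \<open>x\<close>, and
  the functional is zero exactly when \<open>D\<close> kills \<open>x\<close>: \<open>rows\<close>
  gives one direction, \<open>ker\<close> the other. So Hom(W, A) is the ambient free module modulo
  the kernel of \<open>D\<close>, that is, the image of \<open>D\<close>.\<close>

lemma (in acyclic_complex) dual_im_iso:
  assumes D: "mat A D"
    and rows: "\<And>r. r < q \<Longrightarrow> (\<lambda>k\<in>{..<b (i + 1)}. D r k) \<in> carrier (im_mod i)"
    and ker: "\<And>x w. x \<in> carrier (free_mod A (b (i + 1))) \<Longrightarrow> matmap A q (b (i + 1)) D x = \<zero>\<^bsub>free_mod A q\<^esub> \<Longrightarrow>
      w \<in> carrier (im_mod i) \<Longrightarrow> msum (reg_mod A) (\<lambda>k. w k \<otimes> x k) (b (i + 1)) = \<zero>"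
  obtains F where
    "lin A ((free_mod A q)\<lparr>carrier := matmap A q (b (i + 1)) D ` carrier (free_mod A (b (i + 1)))\<rparr>)
      (hom_mod A (im_mod i) (reg_mod A)) F"
    "bij_betw F (matmap A q (b (i + 1)) D ` carrier (free_mod A (b (i + 1)))) (carrier (hom_mod A (im_mod i) (reg_mod A)))"
proof -
  let ?W = "im_mod i" and ?b = "b (i + 1)"
  let ?F = "free_mod A ?b" and ?p = "matmap A q ?b D" and ?H = "hom_mod A ?W (reg_mod A)"
  interpret F: amod A ?F by (rule amod.intro[OF module_free])
  interpret H: amod A ?H by (rule amod.intro[OF module_hom_mod[OF module_im module_reg]])
  define dot where "dot w x = msum (reg_mod A) (\<lambda>k. w k \<otimes> x k) ?b" for w x
  have dot_r: "lin A ?F (reg_mod A) (\<lambda>x. dot w x)" if w: "w \<in> carrier ?F" for w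
  proof -
    have l: "lin A ?F (reg_mod A) (\<lambda>x. msum (reg_mod A) (\<lambda>l. x l \<odot>\<^bsub>reg_mod A\<^esub> w l) ?b)"
      by (rule lin_of_tuple[OF module_reg]) (use w in auto)
    have eq: "msum (reg_mod A) (\<lambda>l. x l \<odot>\<^bsub>reg_mod A\<^esub> w l) ?b = dot w x" if "x \<in> carrier ?F" for x
      unfolding dot_def by (rule msum_cong) (use w that in \<open>simp add: PiE_closed m_comm\<close>)
    show ?thesis by (rule lin_cong[OF eq module_free l])
  qed
  have dot_l: "lin A ?F (reg_mod A) (\<lambda>w. dot w x)" if x: "x \<in> carrier ?F" for x
    unfolding dot_def using lin_of_tuple[OF module_reg, of ?b x] x by (simp add: PiE_closed)
  have WF: "carrier ?W \<subseteq> carrier ?F" using im_mod_iff by blast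
  define \<psi> where "\<psi> x = (\<lambda>w\<in>carrier ?W. dot w x)" for x
  have \<psi>: "\<psi> x \<in> mod_hom A ?W (reg_mod A)" if "x \<in> carrier ?F" for x
    unfolding \<psi>_def im_mod_def[of i]
    by (rule lin_restrict[OF lin_subset[OF dot_l[OF that]] module_im[of i, unfolded im_mod_def]])
      (use WF in \<open>simp add: im_mod_def\<close>)
  have l\<psi>: "lin A ?F ?H \<psi>"
  proof (rule linI)
    show "\<psi> x \<in> carrier ?H" if "x \<in> carrier ?F" for x using \<psi>[OF that] by simp
    show "\<psi> (x \<oplus>\<^bsub>?F\<^esub> y) = \<psi> x \<oplus>\<^bsub>?H\<^esub> \<psi> y" if "x \<in> carrier ?F" "y \<in> carrier ?F" for x y
      using lin_add[OF dot_r that] WF by (auto simp: \<psi>_def fun_eq_iff simp del: free_mod_simps)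
    show "\<psi> (a \<odot>\<^bsub>?F\<^esub> x) = a \<odot>\<^bsub>?H\<^esub> \<psi> x" if "a \<in> carrier A" "x \<in> carrier ?F" for a x
      using lin_smult[OF dot_r that] WF by (auto simp: \<psi>_def fun_eq_iff simp del: free_mod_simps)
  qed
  have lp: "lin A ?F (free_mod A q) ?p" by (rule lin_matmap[OF is_cring D])
  have k1: "\<psi> x = \<zero>\<^bsub>?H\<^esub>" if "x \<in> carrier ?F" "?p x = \<zero>\<^bsub>free_mod A q\<^esub>" for x
    using ker[OF that] by (auto simp: \<psi>_def dot_def)
  obtain G where G: "lin A ((free_mod A q)\<lparr>carrier := ?p ` carrier ?F\<rparr>) ?H G"
    "\<And>x. x \<in> carrier ?F \<Longrightarrow> G (?p x) = \<psi> x"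
    using lin_factor[OF module_free module_free H.module_axioms lp l\<psi> k1] by blast
  have inj: "?p x = ?p y" if x: "x \<in> carrier ?F" and y: "y \<in> carrier ?F" and eq: "\<psi> x = \<psi> y" for x y
  proof (rule tuple_ext)
    \<comment> \<open>Each row of \<open>D\<close> is an element of the image module, so each
      coordinate of \<open>?p x\<close> is a value of the functional \<psi> at
      \<open>x\<close>.\<close>
    show "?p x \<in> {..<q} \<rightarrow>\<^sub>E carrier A" "?p y \<in> {..<q} \<rightarrow>\<^sub>E carrier A"
      using lin_closed[OF lp] x y by auto
    fix r assume r: "r < q"
    let ?w = "\<lambda>k\<in>{..<?b}. D r k"
    have "?p z r = dot ?w z" for z
      unfolding dot_def matmap_def mact_def using r by (auto intro: msum_cong)
    moreover have "dot ?w x = dot ?w y" using fun_cong[OF eq, of ?w] rows[OF r] by (simp add: \<psi>_def)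
    ultimately show "?p x r = ?p y r" by simp
  qed
  have "bij_betw G (?p ` carrier ?F) (carrier ?H)"
    unfolding bij_betw_def
  proof
    show "inj_on G (?p ` carrier ?F)"
    proof (rule inj_onI)
      fix u v assume "u \<in> ?p ` carrier ?F" "v \<in> ?p ` carrier ?F" and eq: "G u = G v"
      then obtain x y where x: "x \<in> carrier ?F" "u = ?p x" and y: "y \<in> carrier ?F" "v = ?p y" by blast
      then have "\<psi> x = \<psi> y" using eq G(2)[OF x(1)] G(2)[OF y(1)] by simp
      then show "u = v" unfolding x(2) y(2) by (rule inj[OF x(1) y(1)])
    qed
    have onto: "f \<in> \<psi> ` carrier ?F" if f: "f \<in> carrier ?H" for f
    proof -
      have f: "f \<in> mod_hom A ?W (reg_mod A)" using f by simp
      obtain x where x: "x \<in> carrier ?F" "\<And>w. w \<in> carrier ?W \<Longrightarrow> f w = dot w x"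
        unfolding dot_def using im_mod_dual[OF mod_hom_lin[OF f]] by blast
      have "f = \<psi> x" by (rule mod_hom_ext[OF f \<psi>[OF x(1)]]) (simp add: x(2) \<psi>_def)
      then show ?thesis using x(1) by blast
    qed
    have im: "G ` (?p ` carrier ?F) = \<psi> ` carrier ?F"
      unfolding image_image by (rule image_cong) (auto simp: G(2))
    show "G ` (?p ` carrier ?F) = carrier ?H"
      unfolding im by (intro equalityI subsetI onto) (use lin_closed[OF l\<psi>] in blast)+
  qed
  with G(1) that show thesis by blast
qed

text \<open>Exactness over the image module is dualised along the injective resolution of
  \<open>A\<close>; the cosyzygy of index 0 is \<open>A\<close>.\<close>

lemma (in acyclic_complex) exact_hom_im:
  assumes "left_resolution A X (\<lambda>s. free_mod A (c s)) \<delta> \<epsilon>" "module A X" "ex_all X" "s > n"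
  defines "E \<equiv> \<lambda>s. free_mat A (c s) (c (Suc s)) (\<delta> s)"
  shows "exact_dual (hom_mod A (im_mod i) (reg_mod A)) c E s"
proof -
  note M = free_resolution_matrices[OF is_cring assms(1)]
  have M1: "mat A (E s)" for s unfolding E_def by (rule M(1))
  have M3: "zprod_res A c E s" for s
    unfolding E_def by (rule M(3))
  have ex: "exact_res (im_mod i) c E s" for s
    unfolding E_def by (rule exact_im_mod[OF assms(1-3)])
  \<comment> \<open>Tuples of elements of the image module have type
    \<open>nat \<Rightarrow> nat \<Rightarrow> 'a\<close>; the pairing function flattens them, and a
    singleton reaches \<open>'a univ\<close>.\<close>
  let ?h = "\<lambda>g :: nat \<Rightarrow> nat \<Rightarrow> 'a. {\<lambda>m. g (fst (prod_decode m)) (snd (prod_decode m))}"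
  have h: "inj ?h"
  proof (rule injI, rule ext, rule ext)
    fix f g :: "nat \<Rightarrow> nat \<Rightarrow> 'a" and p q assume "?h f = ?h g"
    then have eq: "(\<lambda>m. f (fst (prod_decode m)) (snd (prod_decode m))) = (\<lambda>m. g (fst (prod_decode m)) (snd (prod_decode m)))"
      by simp
    show "f p q = g p q" using fun_cong[OF eq, of "prod_encode (p, q)"] by simp
  qed
  have mE: "mat A (tr (E s))" for s using M1 by simp
  have "exact_dual (hom_mod A (im_mod i) (cosyz I d 0)) c E s"
    by (rule exact_hom_cosyz[where k = s and E = E and c = c, OF h module_im im_mod_lift M1 M3 ex])
      (use assms(4) in auto)
  then show ?thesis
    using exact_at_iso[OF module_hom_mod[OF module_im module_reg] module_hom_mod[OF module_im module_cosyz]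
        hom_mod_iso[OF module_im module_reg module_cosyz reg_cosyz] mE mE] by simp
qed

section \<open>Complete resolutions and the exchange of the two arguments of Ext\<close>

locale gorenstein_ring = fin_inj_dim_ring A I d e n + noeth_local_ring A
  for A :: "'a ring" (structure) and I d e n
begin

text \<open>Ext of any resolved module into \<open>A\<close> vanishes beyond the length of the
  injective resolution: the case of the cosyzygy of index 0, which is \<open>A\<close>.\<close>

lemma exact_reg_dual:
  assumes "left_resolution A X (\<lambda>s. free_mod A (c s)) \<delta> \<epsilon>" "s > n"
  defines "E \<equiv> \<lambda>s. free_mat A (c s) (c (Suc s)) (\<delta> s)"
  shows "exact_dual (reg_mod A) c E s"
proof -
  note M = free_resolution_matrices[OF is_cring assms(1)]
  have "exact_dual (cosyz I d 0) c E s"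
    unfolding E_def
    by (rule exact_cosyz[where E = "\<lambda>s. free_mat A (c s) (c (Suc s)) (\<delta> s)" and c = c, OF M(1) M(3) M(4) assms(2)])
  then show ?thesis
    using exact_at_reg_cosyz[of "tr (E s)" "tr (E (Suc s))"] M(1) by (simp add: E_def)
qed

text \<open>The transposed resolution of \<open>X\<close> is exact in large degrees; a free resolution of a kernel
  continues it to the left.\<close>

lemma complete_resolution:
  assumes res: "left_resolution A X (\<lambda>s. free_mod A (c s)) \<delta> \<epsilon>"
  obtains b S where "acyclic_cx A b S" "\<And>j. j > n \<Longrightarrow> b (int j) = c j"
    "\<And>j. j > n \<Longrightarrow> S (int j) = tr (free_mat A (c j) (c (Suc j)) (\<delta> j))"
proof -
  define E where "E s = free_mat A (c s) (c (Suc s)) (\<delta> s)" for s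
  note M = free_resolution_matrices[OF is_cring res, folded E_def]
  note mF = module_free_mod[OF is_cring]
  \<comment> \<open>The first index at which the transposed resolution is known to be exact; the two
    halves are joined here.\<close>
  define t where "t = Suc n"
  let ?F = "free_mod A (c t)" and ?P = "matmap A (c (Suc t)) (c t) (tr (E t))"
  have mE: "mat A (tr (E s))" for s using M(1) by simp
  have lP: "lin A ?F (free_mod A (c (Suc t))) ?P" by (rule lin_matmap[OF is_cring mE])
  \<comment> \<open>What must be covered from the left to make the transposed resolution exact at
    the spot of rank \<open>c t\<close>.\<close>
  define V where "V = {x \<in> carrier ?F. ?P x = \<zero>\<^bsub>free_mod A (c (Suc t))\<^esub>}"
  have sV: "submodule V A ?F" unfolding V_def by (rule lin_ker_submodule[OF mF mF lP])
  let ?V = "?F\<lparr>carrier := V\<rparr>"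
  have mV: "module A ?V" by (rule submodule_module[OF mF sV])
  have "\<exists>m y. gen_by A ?V m y" by (rule submodule_free_gen_by[OF le_refl sV]) simp
  then obtain F where "is_minimal_free_resolution A ?V F" using exists_minimal_free_resolution[OF mV] by blast
  then obtain c' \<delta>' \<epsilon>' where res': "left_resolution A ?V (\<lambda>s. free_mod A (c' s)) \<delta>' \<epsilon>'"
    by (cases F) (auto simp: is_minimal_free_resolution_def)
  define R where "R s = free_mat A (c' s) (c' (Suc s)) (\<delta>' s)" for s
  note M' = free_resolution_matrices[OF is_cring res', folded R_def]
  have le': "lin A (free_mod A (c' 0)) ?V \<epsilon>'" and onto: "\<epsilon>' ` carrier (free_mod A (c' 0)) = V"
    and k0: "\<delta>' 0 ` carrier (free_mod A (c' (Suc 0))) = {x \<in> carrier (free_mod A (c' 0)). \<epsilon>' x = \<zero>\<^bsub>?F\<^esub>}"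
    using res' by (auto simp: left_resolution_def mod_hom_lin a_kernel_def')
  \<comment> \<open>Regarded as a map into the ambient free module, the augmentation of the
    resolution of \<open>V\<close> is the differential joining the two halves: its image is the
    kernel of the next one, and its own kernel is already resolved.\<close>
  have le: "lin A (free_mod A (c' 0)) ?F \<epsilon>'"
    by (rule lin_codomain'[OF le' module.submoduleE(1)[OF mF sV]])
  define Q where "Q = free_mat A (c t) (c' 0) \<epsilon>'"
  have mQ: "mat A Q" unfolding Q_def by (rule mat_free_mat[OF is_cring le])
  have Q: "\<epsilon>' x = matmap A (c t) (c' 0) Q x" if "x \<in> carrier (free_mod A (c' 0))" for x
    unfolding Q_def by (rule lin_eq_matmap[OF is_cring le that])
  note zTQ = free_maps_exact(1)[where q = ?P, OF is_cring mQ mE Q refl onto[unfolded V_def]]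
    and exQ = free_maps_exact(2)[where q = ?P, OF is_cring mQ mE Q refl onto[unfolded V_def]]
  note zQR = free_maps_exact(1)[OF is_cring M'(1) mQ M'(2) Q k0]
    and exR = free_maps_exact(2)[OF is_cring M'(1) mQ M'(2) Q k0]
  \<comment> \<open>From \<open>t\<close> on stands the transposed resolution; below
    \<open>t\<close> the resolution of \<open>V\<close> runs backwards, so its degree 0 is placed at
    \<open>int t - 1\<close>, where \<open>Q\<close> starts.\<close>
  define b where "b i = (if i \<ge> int t then c (nat i) else c' (nat (int t - 1 - i)))" for i
  define S where "S i = (if i \<ge> int t then tr (E (nat i)) else if i = int t - 1 then Q else R (nat (int t - 2 - i)))" for i
  have "mat A (S i) \<and> zprod A (b (i + 2)) (S (i + 1)) (b (i + 1)) (S i) (b i) \<and>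
    exact_at (reg_mod A) (b i) (S i) (b (i + 1)) (S (i + 1)) (b (i + 2))" for i
  proof -
    consider "i \<ge> int t" | "i = int t - 1" | "i = int t - 2" | "i \<le> int t - 3" by linarith
    then show ?thesis
    proof cases
      case 1
      define s where "s = nat i"
      have i: "i = int s" "s \<ge> t" using 1 by (auto simp: s_def)
      have "b i = c s" "b (i + 1) = c (Suc s)" "b (i + 2) = c (Suc (Suc s))" "S i = tr (E s)" "S (i + 1) = tr (E (Suc s))"
        using i by (simp_all add: b_def S_def nat_add_distrib)
      moreover have "exact_dual (reg_mod A) c E s"
        unfolding E_def by (rule exact_reg_dual[OF res]) (use i t_def in simp)
      moreover have "zprod A (c (Suc (Suc s))) (tr (E (Suc s))) (c (Suc s)) (tr (E s)) (c s)"
        using M(3) zprod_tr[OF is_cring M(1) M(1)] by blast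
      ultimately show ?thesis using mE by simp
    next
      case 2
      have "b i = c' 0" "b (i + 1) = c t" "b (i + 2) = c (Suc t)" "S i = Q" "S (i + 1) = tr (E t)"
        using 2 by (simp_all add: b_def S_def nat_add_distrib)
      then show ?thesis using mQ zTQ exQ by simp
    next
      case 3
      have "b i = c' (Suc 0)" "b (i + 1) = c' 0" "b (i + 2) = c t" "S i = R 0" "S (i + 1) = Q"
        using 3 by (simp_all add: b_def S_def)
      then show ?thesis using M'(1) zQR exR by simp
    next
      case 4
      define s where "s = nat (int t - 3 - i)"
      have i: "i = int t - 3 - int s" using 4 by (simp add: s_def)
      have n: "nat (int t - 1 - i) = Suc (Suc s)" "nat (int t - 1 - (i + 1)) = Suc s" "nat (int t - 1 - (i + 2)) = s"
        "nat (int t - 2 - i) = Suc s" "nat (int t - 2 - (i + 1)) = s"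
        using i by linarith+
      have "b i = c' (Suc (Suc s))" "b (i + 1) = c' (Suc s)" "b (i + 2) = c' s" "S i = R (Suc s)" "S (i + 1) = R s"
        unfolding b_def S_def n using 4 by auto
      then show ?thesis using M'(1) M'(3) M'(4) by simp
    qed
  qed
  then have "acyclic_cx A b S" by (simp add: acyclic_cx_def)
  moreover have "b (int j) = c j" "S (int j) = tr (free_mat A (c j) (c (Suc j)) (\<delta> j))" if "j > n" for j
    using that by (simp_all add: b_def S_def t_def E_def)
  ultimately show thesis using that by blast
qed

text \<open>Both directions of the duality meet in one syzygy \<open>L\<close> of \<open>N\<close>:
  it is Hom(W, A) for an image module W of the complete resolution, and vanishing of Ext from
  \<open>M\<close> passes from \<open>L\<close> down to \<open>N\<close>.\<close>

lemma ext_vanishing_swap: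
  fixes M :: "('a, 'm) module" and N :: "('a, 'n) module"
  assumes M: "fg_module A M" and red: "has_reducible_complexity A M" and N: "fg_module A N"
    and van: "\<forall>i\<ge>i0. zero_mod (Ext A i N M)"
  shows "\<exists>i1. \<forall>i\<ge>i1. zero_mod (Ext A i M N)"
proof -
  have mM: "module A M" and mN: "module A N" using M N by (auto simp: fg_module_def)
  define c where "c = fst (minimal_free_resolution A N)"
  define \<delta> where "\<delta> = res_diff A N"
  define D where "D s = free_mat A (c s) (c (Suc s)) (\<delta> s)" for s
  have F: "res_mod A N = (\<lambda>s. free_mod A (c s))" by (simp add: res_mod_def[abs_def] c_def)
  note resN = minimal_resolution[OF N, unfolded F, folded \<delta>_def]
  note MN = free_resolution_matrices[OF is_cring resN, folded D_def]
  obtain b S where bS: "acyclic_cx A b S" "\<And>j. j > n \<Longrightarrow> b (int j) = c j" "\<And>j. j > n \<Longrightarrow> S (int j) = tr (D j)"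
    using complete_resolution[OF resN] unfolding D_def by blast
  interpret gorenstein_complex A I d e n b S
    by unfold_locales (rule bS(1))
  have bS': "b (int j + 1) = c (Suc j)" "b (int j + 2) = c (Suc (Suc j))" "S (int j + 1) = tr (D (Suc j))" if "j > n" for j
    using bS(2)[of "Suc j"] bS(2)[of "Suc (Suc j)"] bS(3)[of "Suc j"] that by (simp_all add: algebra_simps)
  \<comment> \<open>\<open>ex_at\<close> at \<open>int j\<close> is Ext in degree
    \<open>Suc j\<close>; the bound \<open>j > n\<close> keeps all matrices involved in the range
    where the complex is the transposed resolution.\<close>
  have exM: "ex_at M (int j)" if "j > n" "j \<ge> i0" for j
    using zero_Ext_iff[OF N mM, of j, folded c_def \<delta>_def] van that bS(2,3)[OF that(1)] bS'[OF that(1)]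
    by (simp add: ex_at_def D_def)
  obtain X f where X: "red_cx A X" and f: "lin A X M f" "bij_betw f (carrier X) (carrier M)"
    using red mod_hom_lin unfolding has_reducible_complexity_def mod_iso_def by blast
  have mX: "module A X" using X by cases (auto simp: fg_module_def)
  note isoX = ex_at_iso[OF mX mM f]
  have "ex_all X"
  proof (rule red_cx_ex_all[OF X])
    fix i assume i: "i \<ge> int (Suc n + i0)"
    then have "ex_at M (int (nat i))" by (intro exM) auto
    then show "ex_at X i" using i isoX by simp
  qed
  then have eM: "ex_all M" using isoX by (simp add: ex_all_def)
  define cM where "cM = fst (minimal_free_resolution A M)"
  define E where "E s = free_mat A (cM s) (cM (Suc s)) (res_diff A M s)" for s
  have FM: "res_mod A M = (\<lambda>s. free_mod A (cM s))" by (simp add: res_mod_def[abs_def] cM_def)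
  note resM = minimal_resolution[OF M, unfolded FM]
  note MM = free_resolution_matrices[OF is_cring resM, folded E_def]
  \<comment> \<open>Any index beyond \<open>n\<close> serves, so that \<open>S\<close> near
    \<open>int t\<close> is made of transposed differentials of \<open>N\<close>.\<close>
  define t where "t = Suc n"
  have t: "t > n" by (simp add: t_def)
  let ?W = "im_mod (int t)"
  have exW: "exact_dual (hom_mod A ?W (reg_mod A)) cM E s" if "s > n" for s
    unfolding E_def by (rule exact_hom_im[OF resM mM eM that])
  have W: "w \<in> carrier ?W \<longleftrightarrow> w \<in> carrier (free_mod A (c (Suc t))) \<and>
    (\<forall>k < c (Suc (Suc t)). mact (reg_mod A) (c (Suc t)) (tr (D (Suc t))) w k = \<zero>)" for w
    by (simp add: im_mod_iff bS'[OF t])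
  \<comment> \<open>A row of \<open>D t\<close> is killed by the transpose of
    \<open>D (Suc t)\<close> because consecutive differentials compose to zero.\<close>
  have rows: "(\<lambda>k\<in>{..<b (int t + 1)}. D t r k) \<in> carrier ?W" if r: "r < c t" for r
    unfolding W bS'(1)[OF t]
  proof (intro conjI allI impI)
    show "(\<lambda>k\<in>{..<c (Suc t)}. D t r k) \<in> carrier (free_mod A (c (Suc t)))"
      using MN(1)[of t] by (simp add: mat_def)
    fix k assume k: "k < c (Suc (Suc t))"
    have "mact (reg_mod A) (c (Suc t)) (tr (D (Suc t))) (\<lambda>k\<in>{..<c (Suc t)}. D t r k) k
      = msum (reg_mod A) (\<lambda>l. tr (D (Suc t)) k l \<otimes> tr (D t) l r) (c (Suc t))"
      unfolding mact_def by (rule msum_cong) (simp add: tr_def)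
    also have "\<dots> = \<zero>"
      using zprod_tr[OF is_cring MN(1) MN(1)] MN(3)[of t] k r unfolding zprod_def by blast
    finally show "mact (reg_mod A) (c (Suc t)) (tr (D (Suc t))) (\<lambda>k\<in>{..<c (Suc t)}. D t r k) k = \<zero>" .
  qed
  interpret R: amod A "reg_mod A" by (rule amod.intro[OF module_reg])
  \<comment> \<open>Exactness of the resolution gives \<open>x\<close> as a value of
    \<open>D (Suc t)\<close>; moved across the pairing, this matrix becomes the transpose that kills
    \<open>w\<close>.\<close>
  have ker: "msum (reg_mod A) (\<lambda>k. w k \<otimes> x k) (b (int t + 1)) = \<zero>"
    if x: "x \<in> carrier (free_mod A (b (int t + 1)))" and 0: "matmap A (c t) (b (int t + 1)) (D t) x = \<zero>\<^bsub>free_mod A (c t)\<^esub>"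
      and w: "w \<in> carrier ?W" for x w
  proof -
    have x': "x \<in> carrier (free_mod A (c (Suc t)))" using x by (simp add: bS'[OF t])
    have "mact (reg_mod A) (c (Suc t)) (D t) x k = \<zero>" if "k < c t" for k
      using fun_cong[OF 0, of k] that by (simp add: matmap_def bS'[OF t])
    then obtain v where v: "v \<in> carrier (free_mod A (c (Suc (Suc t))))"
      "x = matmap A (c (Suc t)) (c (Suc (Suc t))) (D (Suc t)) v"
      using exact_at_free[OF is_cring MN(4)[of t] x'] by blast
    have wc: "w k \<in> carrier A" if "k < c (Suc t)" for k using w that by (auto simp: W)
    have "msum (reg_mod A) (\<lambda>k. w k \<otimes> x k) (c (Suc t))
      = msum (reg_mod A) (\<lambda>k. mact (reg_mod A) (c (Suc (Suc t))) (D (Suc t)) v k \<odot>\<^bsub>reg_mod A\<^esub> w k) (c (Suc t))"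
    proof (rule msum_cong)
      fix k assume k: "k < c (Suc t)"
      have "x k = mact (reg_mod A) (c (Suc (Suc t))) (D (Suc t)) v k" using v(2) k by (simp add: matmap_def)
      moreover have "x k \<in> carrier A" using x' k by auto
      ultimately show "w k \<otimes> x k = mact (reg_mod A) (c (Suc (Suc t))) (D (Suc t)) v k \<odot>\<^bsub>reg_mod A\<^esub> w k"
        using wc[OF k] m_comm by simp
    qed
    also have "\<dots> = msum (reg_mod A) (\<lambda>l. v l \<odot>\<^bsub>reg_mod A\<^esub> mact (reg_mod A) (c (Suc t)) (tr (D (Suc t))) w l) (c (Suc (Suc t)))"
      by (rule R.pairing[OF MN(1)]) (use v wc in auto)
    also have "\<dots> = \<zero>\<^bsub>reg_mod A\<^esub>"
      by (rule R.msum_zero) (use w v in \<open>simp add: W PiE_closed\<close>)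
    finally show ?thesis by (simp add: bS'[OF t])
  qed
  let ?P = "\<lambda>s. free_mod A (c s)"
  obtain G where G: "lin A ((free_mod A (c t))\<lparr>carrier := matmap A (c t) (b (int t + 1)) (D t) ` carrier (free_mod A (b (int t + 1)))\<rparr>)
      (hom_mod A ?W (reg_mod A)) G"
    "bij_betw G (matmap A (c t) (b (int t + 1)) (D t) ` carrier (free_mod A (b (int t + 1)))) (carrier (hom_mod A ?W (reg_mod A)))"
    using dual_im_iso[OF MN(1)[of t] rows ker] by blast
  \<comment> \<open>The image of \<open>D t\<close> is literally the syzygy
    \<open>res_syz ?P \<delta> t\<close>, so Hom(W, A) has become a syzygy of
    \<open>N\<close>.\<close>
  have L: "(free_mod A (c t))\<lparr>carrier := matmap A (c t) (b (int t + 1)) (D t) ` carrier (free_mod A (b (int t + 1)))\<rparr> = res_syz ?P \<delta> t"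
  proof -
    have "matmap A (c t) (c (Suc t)) (D t) ` carrier (free_mod A (c (Suc t))) = \<delta> t ` carrier (free_mod A (c (Suc t)))"
      by (rule image_cong[OF refl MN(2)[symmetric]])
    then show ?thesis by (simp only: res_syz_def bS'(1)[OF t])
  qed
  note sN = left_resolution_ses[OF resN mN]
  have mE: "mat A (tr (E s))" for s using MM(1) by simp
  have zE: "zprod A (cM (Suc (Suc s))) (tr (E (Suc s))) (cM (Suc s)) (tr (E s)) (cM s)" for s
    using zprod_tr[OF is_cring MM(1) MM(1)] MM(3) by blast
  have exF: "exact_dual (free_mod A m) cM E s" if "s > n" for s m
    using exact_at_free_mod[OF is_cring mE mE] exact_reg_dual[OF resM that] unfolding E_def by blast
  \<comment> \<open>Descent from the syzygy of index \<open>t\<close> to the one of index 0. Each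
    step needs the previous syzygy one degree higher, which costs nothing since the range
    \<open>s > n\<close> is closed upwards, and Ext from \<open>M\<close> into free modules vanishes
    in that range.\<close>
  have "exact_dual (res_syz ?P \<delta> j) cM E s"
    if "j + k = t" "s > n" for j k s
    using that
  proof (induction k arbitrary: j s)
    case 0
    have j: "j = t" using 0 by simp
    have "exact_dual (res_syz ?P \<delta> t) cM E s
      \<longleftrightarrow> exact_dual (hom_mod A ?W (reg_mod A)) cM E s"
      by (rule exact_at_iso[OF sN(1) module_hom_mod[OF module_im module_reg] G(1)[unfolded L] _ mE mE])
        (use G(2) L[THEN arg_cong[where f = carrier]] in simp)
    then show ?case unfolding j using exW[OF 0(2)] by blast
  next
    case (Suc k)
    then have "exact_at (res_syz ?P \<delta> (Suc j)) (cM (Suc s)) (tr (E (Suc s))) (cM (Suc (Suc s))) (tr (E (Suc (Suc s)))) (cM (Suc (Suc (Suc s))))"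
      by simp
    then show ?case by (rule ses_exact_right[OF sN(3) mE mE mE zE _ exF[OF Suc.prems(2)]])
  qed
  then have s0: "exact_dual (res_syz ?P \<delta> 0) cM E s" if "s > n" for s
    using that by simp
  have "zero_mod (Ext A (Suc s) M N)" if s: "s > n" for s
    unfolding zero_Ext_iff[OF M mN, of s, folded cM_def] E_def[symmetric]
    by (rule ses_exact_right[OF sN(2) mE mE mE zE _ exF[OF s]]) (rule s0, use s in simp)
  \<comment> \<open>The bound depends on the injective dimension only: \<open>Suc s\<close> with
    \<open>s > n\<close> starts at \<open>n + 2\<close>, whatever \<open>i0\<close> was.\<close>
  then have "zero_mod (Ext A i M N)" if "i \<ge> Suc (Suc n)" for i
    using that by (cases i) auto
  then show ?thesis by blast
qed

end

lemma ext_sup_less_infinity_iff: "ext_sup A X Y < \<infinity> \<longleftrightarrow> (\<exists>i0. \<forall>i\<ge>i0. zero_mod (Ext A i X Y))"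
proof
  assume "ext_sup A X Y < \<infinity>"
  then obtain k where k: "ext_sup A X Y < ereal (real k)"
    using less_PInf_Ex_of_nat by auto
  have "zero_mod (Ext A i X Y)" if "i \<ge> k" for i
  proof (rule ccontr)
    assume "\<not> zero_mod (Ext A i X Y)"
    then have "ereal (real i) \<le> ext_sup A X Y"
      unfolding ext_sup_def by (intro SUP_upper) simp
    with k have "ereal (real i) < ereal (real k)" by (rule order.strict_trans1[rotated])
    with that show False by simp
  qed
  then show "\<exists>i0. \<forall>i\<ge>i0. zero_mod (Ext A i X Y)" by blast
next
  assume "\<exists>i0. \<forall>i\<ge>i0. zero_mod (Ext A i X Y)"
  then obtain i0 where i0: "\<And>i. i \<ge> i0 \<Longrightarrow> zero_mod (Ext A i X Y)" by blast
  have "ext_sup A X Y \<le> ereal (real i0)"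
    unfolding ext_sup_def
  proof (rule SUP_least)
    fix i assume "i \<in> {n. \<not> zero_mod (Ext A n X Y)}"
    then have "\<not> i \<ge> i0" using i0 by auto
    then show "ereal (real i) \<le> ereal (real i0)" by simp
  qed
  then show "ext_sup A X Y < \<infinity>" by (rule order.strict_trans1) simp
qed

text \<open>A finite injective resolution of \<open>A\<close> is fixed here, which turns the
  existential in the definition of a Gorenstein ring into the parameters of the locale.\<close>

lemma gorenstein_ext_vanishing_swap:
  assumes "gorenstein_local_ring A" and "fg_module A M" "has_reducible_complexity A M" "fg_module A N"
    and "\<exists>i0. \<forall>i\<ge>i0. zero_mod (Ext A i N M)"
  shows "\<exists>i0. \<forall>i\<ge>i0. zero_mod (Ext A i M N)"
proof -
  have A: "local_ring A" "noetherian_ring A" "finite_inj_dim A (reg_mod A)" "cring A"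
    using assms(1) by (auto simp: gorenstein_local_ring_def local_ring_def)
  obtain I :: "nat \<Rightarrow> ('a, 'a univ) module" and d e n where "right_resolution A (reg_mod A) I d e"
    "\<And>i. injective_mod A (I i)" "\<And>i. i > n \<Longrightarrow> zero_mod (I i)"
    using A(3) unfolding finite_inj_dim_def by blast
  then interpret gorenstein_ring A I d e n
    using A by (intro gorenstein_ring.intro fin_inj_dim_ring.intro noeth_local_ring.intro
        fin_inj_dim_ring_axioms.intro noeth_local_ring_axioms.intro) auto
  show ?thesis using ext_vanishing_swap assms(2-5) by blast
qed

theorem theorem3p5:
  fixes A :: "'a ring" and M :: "('a, 'm) module" and N :: "('a, 'n) module"
  assumes "gorenstein_local_ring A"
    and "fg_module A M" and "\<not> zero_mod M" and "has_reducible_complexity A M"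
    and "fg_module A N" and "\<not> zero_mod N"
  shows "(ext_sup A N M < \<infinity> \<longrightarrow> ext_sup A M N < \<infinity>) \<and>
    (has_reducible_complexity A N \<longrightarrow>
      ((\<exists>i0. \<forall>i\<ge>i0. zero_mod (Ext A i M N)) \<longleftrightarrow> (\<exists>i0. \<forall>i\<ge>i0. zero_mod (Ext A i N M))))"
proof (intro conjI impI iffI)
  show "ext_sup A M N < \<infinity>" if "ext_sup A N M < \<infinity>"
    using that gorenstein_ext_vanishing_swap[OF assms(1,2,4,5)] unfolding ext_sup_less_infinity_iff by blast
  show "\<exists>i0. \<forall>i\<ge>i0. zero_mod (Ext A i M N)" if "\<exists>i0. \<forall>i\<ge>i0. zero_mod (Ext A i N M)"
    using gorenstein_ext_vanishing_swap[OF assms(1,2,4,5) that] .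
  show "\<exists>i0. \<forall>i\<ge>i0. zero_mod (Ext A i N M)"
    if "has_reducible_complexity A N" "\<exists>i0. \<forall>i\<ge>i0. zero_mod (Ext A i M N)"
    using gorenstein_ext_vanishing_swap[OF assms(1,5) that(1) assms(2) that(2)] .
qed

end
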